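(* For every $1\le \ell\le r(n-1)+1$, the restrictions to $X(\tau_\ell)$ of the Plücker coordinates $p_S$, where $S$ runs over the set $\mathcal{A}_\ell$ of all tuples admissible on $X(\tau_\ell)$, form a $K$-basis of $H^0(X(\tau_\ell),L_0)$.
   Context: $K$ is an algebraically closed field of arbitrary characteristic, $A=K[[t]]$, $F=K((t))$. Fix integers $n\ge1$, $s\ge 1$ and put $r=sn$. Let $e_1,\dots,e_n$ be the standard basis of $F^n$ and put $e_{cn+i}:=t^ce_i$ for $1\le i\le n$, $c\in\mathbb{Z}$. Let $L_1=A^n$ and $V_s=L_1/t^{r}L_1$, a $K$-space with basis (the images of) $e_1,\dots,e_{rn}$, on which multiplication by $t$ acts by $e_k\mapsto e_{k+n}$ (zero if $k+n>rn$). Schubert varieties: if $I=(i_1<\dots<i_r)$ with entries in $\{1,\dots,rn\}$ is such that $E_I=\mathrm{Span}_K(e_i: i\in I)\subset V_s$ is $t$-stable, let $X^\circ(I)\subset \mathrm{Gr}(r,V_s)$ be the orbit of $E_I$ under $\mathcal{B}=\{g\in GL_n(A): \mathrm{ord}(g_{ij})>0\text{ for } i<j\}$ (acting on $L_1/t^rL_1$), and let $X(I)$ be its Zariski closure with reduced structure. Lattices $L$ with $t^rL_1\subset L\subset L_1$ are identified with $L/t^rL_1\subset V_s$. For $w_s=(1,n+1,2n+1,\dots,(r-1)n+1)$, $X(w_s)$ is the variety of all $r$-dimensional $t$-stable subspaces of $V_s$. Plücker coordinates: $p_I$ is the $r\times r$ minor with row set $I$ of the $rn\times r$ matrix of a basis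 of a subspace. $L_0$ denotes the basic line bundle, i.e. the restriction of $\mathcal{O}(1)$ under the Plücker embedding $\mathrm{Gr}(r,V_s)\subset\mathbb{P}(\wedge^rV_s)$. Chain: for $1\le i\le r$, $1\le j\le n$ let $$\varphi_{ij}=\big((i-1)n+1+j-i,\ in+1+j-i,\ \dots,\ (r-1)n+1+j-i,\ rn+2-i,\ rn+3-i,\dots,\ rn\big)$$ (the first $r+1-i$ entries have successive differences $n$, the remaining $i-1$ entries are consecutive integers), and put $\tau_{(i-1)(n-1)+j}:=\varphi_{ij}$; this is well defined since $\varphi_{in}=\varphi_{i+1,1}$. This gives $w_s=\tau_1>\tau_2>\dots>\tau_{r(n-1)+1}=\mathrm{id}$. Admissibility: an $r$-tuple $S=(s_1<\dots<s_r)$ in $\{1,\dots,rn\}$ stands for the infinite sequence $(s_1,\dots,s_r,rn+1,rn+2,\dots)$; it is admissible if $s_{j+1}-s_j\le n$ for all $j\ge1$ (with $s_{r+1}=rn+1$). It is admissible on $X(w)$ if moreover $p_S|_{X(w)}\ne0$. *)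

theory Defs
  imports
    "HOL-Library.Function_Algebras"
    "HOL-Library.Poly_Mapping"
    "HOL-Computational_Algebra.Polynomial"
    "HOL-Computational_Algebra.Formal_Power_Series"
    "Jordan_Normal_Form.Determinant"
begin

text \<open>Functions into a field, with the pointwise operations, as a vector space.\<close>

global_interpretation fun_space: vector_space "\<lambda>(c :: 'k :: field) (f :: 'x \<Rightarrow> 'k) x. c * f x"
  by unfold_locales (auto simp: fun_eq_iff algebra_simps)


section \<open>The space \<open>V = L\<^sub>1 / t\<^sup>r L\<^sub>1\<close> and its Grassmannian\<close>

text \<open>
  A vector of \<open>V\<close> is given by its coordinates with respect to \<open>e\<^sub>1, \<dots>, e\<^sub>r\<^sub>n\<close>,
  extended by \<open>0\<close> outside of \<open>{1..rn}\<close>.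
\<close>

definition V_space :: "nat \<Rightarrow> nat \<Rightarrow> (nat \<Rightarrow> 'k :: field) set" where
  "V_space n r = {v. \<forall>k. k \<notin> {1..r * n} \<longrightarrow> v k = 0}"

definition e_vec :: "nat \<Rightarrow> nat \<Rightarrow> 'k :: field" where
  "e_vec k = (\<lambda>m. if m = k then 1 else 0)"

text \<open>
  The projection of \<open>L\<^sub>1 = K[[t]]\<^sup>n\<close> onto \<open>V\<close>. As \<open>e\<^sub>c\<^sub>n\<^sub>+\<^sub>i = t\<^sup>c e\<^sub>i\<close> for \<open>1 \<le> i \<le> n\<close>, the coordinate
  with number \<open>cn + i\<close> is the coefficient of \<open>t\<^sup>c\<close> in the \<open>i\<close>-th entry (which has index \<open>i - 1\<close>
  in the type of vectors used here).
\<close>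

definition proj_L1 :: "nat \<Rightarrow> nat \<Rightarrow> 'k :: field fps vec \<Rightarrow> nat \<Rightarrow> 'k" where
  "proj_L1 n r v =
     (\<lambda>k. if k \<in> {1..r * n} then fps_nth (vec_index v ((k - 1) mod n)) ((k - 1) div n) else 0)"

definition Grassmannian :: "nat \<Rightarrow> nat \<Rightarrow> (nat \<Rightarrow> 'k :: field) set set" where
  "Grassmannian n r = {W. fun_space.subspace W \<and> W \<subseteq> V_space n r \<and> fun_space.dim W = r}"

definition E_space :: "nat list \<Rightarrow> (nat \<Rightarrow> 'k :: field) set" where
  "E_space I = fun_space.span (e_vec ` set I)"


section \<open>Pluecker coordinates\<close>

definition tuples :: "nat \<Rightarrow> nat \<Rightarrow> nat list set" where
  "tuples n r = {I. length I = r \<and> sorted_wrt (<) I \<and> set I \<subseteq> {1..r * n}}"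

definition is_basis_of :: "(nat \<Rightarrow> 'k :: field) list \<Rightarrow> (nat \<Rightarrow> 'k) set \<Rightarrow> bool" where
  "is_basis_of bs W \<longleftrightarrow>
     distinct bs \<and> fun_space.independent (set bs) \<and> fun_space.span (set bs) = W"

text \<open>
  The vector of all Pluecker coordinates of a list of \<open>r\<close> vectors: the entry at \<open>I\<close> is the minor
  with row set \<open>I\<close> of the matrix with columns \<open>bs\<close>. Lists \<open>I\<close> that do not denote an index set
  get the value \<open>0\<close>.
\<close>

definition pluecker :: "nat \<Rightarrow> nat \<Rightarrow> (nat \<Rightarrow> 'k :: field) list \<Rightarrow> nat list \<Rightarrow> 'k" where
  "pluecker n r bs =
     (\<lambda>I. if I \<in> tuples n r then det (mat r r (\<lambda>(a, b). (bs ! b) (I ! a))) else 0)"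

text \<open>
  The affine cone over the image of \<open>X\<close> under the Pluecker embedding, without the origin.
  Changing the basis of a subspace multiplies its Pluecker vector by an arbitrary nonzero scalar
  (as \<open>r \<ge> 1\<close>), so for \<open>W \<in> X\<close> this set contains all of the line belonging to \<open>W\<close> except \<open>0\<close>.
\<close>

definition pluecker_cone ::
    "nat \<Rightarrow> nat \<Rightarrow> (nat \<Rightarrow> 'k :: field) set set \<Rightarrow> (nat list \<Rightarrow> 'k) set" where
  "pluecker_cone n r X = {pluecker n r bs | bs W. W \<in> X \<and> is_basis_of bs W}"


section \<open>Homogeneous polynomials and the Zariski topology\<close>

text \<open>Polynomials with coefficients in \<open>'k\<close> in variables indexed by \<open>'x\<close>.\<close>

type_synonym ('x, 'k) polynomial = "('x \<Rightarrow>\<^sub>0 nat) \<Rightarrow>\<^sub>0 'k"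

definition poly_eval :: "('x, 'k :: field) polynomial \<Rightarrow> ('x \<Rightarrow> 'k) \<Rightarrow> 'k" where
  "poly_eval P v =
     (\<Sum>m\<in>Poly_Mapping.keys P. Poly_Mapping.lookup P m *
        (\<Prod>x\<in>Poly_Mapping.keys m. v x ^ Poly_Mapping.lookup m x))"

text \<open>Homogeneous polynomials of degree \<open>d\<close> (including \<open>0\<close>) in the variables from \<open>J\<close>.\<close>

definition homogeneous :: "'x set \<Rightarrow> nat \<Rightarrow> ('x, 'k :: field) polynomial set" where
  "homogeneous J d =
     {P. \<forall>m\<in>Poly_Mapping.keys P. Poly_Mapping.keys m \<subseteq> J \<and>
           (\<Sum>x\<in>Poly_Mapping.keys m. Poly_Mapping.lookup m x) = d}"

definition zariski_closure ::
    "nat \<Rightarrow> nat \<Rightarrow> (nat \<Rightarrow> 'k :: field) set set \<Rightarrow> (nat \<Rightarrow> 'k) set set" where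
  "zariski_closure n r Y =
     {W \<in> Grassmannian n r. \<forall>d. \<forall>P\<in>homogeneous (tuples n r) d.
        (\<forall>x\<in>pluecker_cone n r Y. poly_eval P x = 0) \<longrightarrow>
        (\<forall>x\<in>pluecker_cone n r {W}. poly_eval P x = 0)}"


section \<open>Schubert varieties\<close>

definition B_group :: "nat \<Rightarrow> 'k :: field fps mat set" where
  "B_group n = {g \<in> carrier_mat n n. invertible_mat g \<and>
     (\<forall>i<n. \<forall>j<n. i < j \<longrightarrow> fps_nth (g $$ (i, j)) 0 = 0)}"

definition act :: "nat \<Rightarrow> nat \<Rightarrow> 'k :: field fps mat \<Rightarrow> (nat \<Rightarrow> 'k) set \<Rightarrow> (nat \<Rightarrow> 'k) set" where
  "act n r g W = {proj_L1 n r (g *\<^sub>v v) | v. v \<in> carrier_vec n \<and> proj_L1 n r v \<in> W}"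

text \<open>The following two notions are of interest only if \<open>E_space I\<close> is stable under \<open>t\<close>.\<close>

definition schubert_cell :: "nat \<Rightarrow> nat \<Rightarrow> nat list \<Rightarrow> (nat \<Rightarrow> 'k :: field) set set" where
  "schubert_cell n r I = {act n r g (E_space I) | g. g \<in> B_group n}"

definition schubert_variety :: "nat \<Rightarrow> nat \<Rightarrow> nat list \<Rightarrow> (nat \<Rightarrow> 'k :: field) set set" where
  "schubert_variety n r I = zariski_closure n r (schubert_cell n r I)"


section \<open>Global sections of the basic line bundle\<close>

text \<open>
  The fibre of \<open>\<O>(1)\<close> at a point of projective space is the dual of the corresponding line.
  Hence a section of \<open>\<O>(1)\<close> on a closed subvariety \<open>X\<close> (with reduced structure) is a function on
  the cone over \<open>X\<close> without the origin which in a neighbourhood \<open>{Q \<noteq> 0}\<close> of each point is a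
  quotient \<open>P / Q\<close> of homogeneous polynomials with \<open>deg P = deg Q + 1\<close>; in particular it is
  homogeneous of degree 1. Such functions are extended by \<open>0\<close> outside of the cone, so that they
  form a subspace of the space of all functions.
\<close>

definition global_sections ::
    "nat \<Rightarrow> nat \<Rightarrow> (nat \<Rightarrow> 'k :: field) set set \<Rightarrow> ((nat list \<Rightarrow> 'k) \<Rightarrow> 'k) set" where
  "global_sections n r X =
     {f. (\<forall>x. x \<notin> pluecker_cone n r X \<longrightarrow> f x = 0) \<and>
         (\<forall>x\<in>pluecker_cone n r X.
            \<exists>d. \<exists>P\<in>homogeneous (tuples n r) (d + 1). \<exists>Q\<in>homogeneous (tuples n r) d.
              poly_eval Q x \<noteq> 0 \<and>
              (\<forall>y\<in>pluecker_cone n r X. poly_eval Q y \<noteq> 0 \<longrightarrow>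
                 f y = poly_eval P y / poly_eval Q y))}"

text \<open>The restriction of the Pluecker coordinate \<open>p\<^sub>S\<close> to \<open>X\<close>, as a section.\<close>

definition pluecker_section ::
    "nat \<Rightarrow> nat \<Rightarrow> (nat \<Rightarrow> 'k :: field) set set \<Rightarrow> nat list \<Rightarrow> (nat list \<Rightarrow> 'k) \<Rightarrow> 'k" where
  "pluecker_section n r X S = (\<lambda>x. if x \<in> pluecker_cone n r X then x S else 0)"


section \<open>The chain of Schubert varieties\<close>

text \<open>For \<open>1 \<le> i \<le> r\<close> and \<open>1 \<le> j \<le> n\<close> none of the subtractions is truncated.\<close>

definition phi :: "nat \<Rightarrow> nat \<Rightarrow> nat \<Rightarrow> nat \<Rightarrow> nat list" where
  "phi n r i j =
     map (\<lambda>k. (i - 1 + k) * n + 1 + j - i) [0..<r + 1 - i] @ [r * n + 2 - i..<r * n + 1]"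

definition tau :: "nat \<Rightarrow> nat \<Rightarrow> nat \<Rightarrow> nat list" where
  "tau n r l =
     (THE w. \<exists>i\<in>{1..r}. \<exists>j\<in>{1..n}. l = (i - 1) * (n - 1) + j \<and> w = phi n r i j)"

lemma phi_n_eq:
  assumes "n \<ge> 1" "1 \<le> i" "i < r"
  shows "phi n r i n = phi n r (i + 1) 1"
proof -
  define d where "d = r - i - 1"
  have d: "r = i + 1 + d"
    using assms(3) by (simp add: d_def)
  obtain i' where i': "i = Suc i'"
    using assms(2) by (cases i) auto
  have rn: "r * n \<ge> i + 1"
    using assms mult_le_mono2[of 1 n r] by linarith
  have 1: "[0..<r + 1 - i] = [0..<Suc d] @ [Suc d]"
    using d by simp
  have 2: "[r * n + 2 - (i + 1)..<r * n + 1] = (r * n + 1 - i) # [r * n + 2 - i..<r * n + 1]"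
  proof -
    have "r * n + 2 - (i + 1) = r * n + 1 - i" "Suc (r * n + 1 - i) = r * n + 2 - i"
      "r * n + 1 - i < r * n + 1"
      using rn assms(2) by linarith+
    thus ?thesis by (metis upt_conv_Cons)
  qed
  have 3: "map (\<lambda>k. (i - 1 + k) * n + 1 + n - i) [0..<Suc d]
         = map (\<lambda>k. (i + 1 - 1 + k) * n + 1 + 1 - (i + 1)) [0..<Suc d]"
    by (auto simp: i' algebra_simps simp del: upt_Suc)
  have 4: "(i - 1 + Suc d) * n + 1 + n - i = r * n + 1 - i"
    by (simp add: i' d algebra_simps)
  have 5: "r + 1 - (i + 1) = Suc d"
    using d by simp
  show ?thesis
    unfolding phi_def 1 2 5 using 3 4 by simp
qed

lemma tau_eq:
  assumes "i \<in> {1..r}" "j \<in> {1..n}"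
  shows "tau n r ((i - 1) * (n - 1) + j) = phi n r i j"
proof -
  have *: "phi n r i1 j1 = phi n r i2 j2"
    if eq: "(i1 - 1) * (n - 1) + j1 = (i2 - 1) * (n - 1) + j2" and le: "i1 \<le> i2"
      and mem: "i1 \<in> {1..r}" "i2 \<in> {1..r}" "j1 \<in> {1..n}" "j2 \<in> {1..n}" for i1 i2 j1 j2
  proof (cases "n = 1")
    case True
    have step: "phi n r (Suc k) 1 = phi n r k 1" if "1 \<le> k" "k < r" for k
      using phi_n_eq[of n k r] that True by (simp only: Suc_eq_plus1 refl)
    have "1 + k \<le> r \<longrightarrow> phi n r (1 + k) 1 = phi n r 1 1" for k
    proof (induction k)
      case 0
      show ?case by (simp only: add_0_right simp_thms)
    next
      case (Suc k)
      show ?case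
        using Suc step[of "1 + k"] by (metis Suc_le_eq add_Suc_right le_add1 less_imp_le)
    qed
    hence all: "phi n r k 1 = phi n r 1 1" if "k \<in> {1..r}" for k
      using that by (metis atLeastAtMost_iff le_add_diff_inverse)
    have "phi n r i1 1 = phi n r i2 1"
      using all[OF mem(1)] all[OF mem(2)] by (rule trans[OF _ sym])
    moreover have "j1 = 1" "j2 = 1"
      using mem(3,4) True by auto
    ultimately show ?thesis by simp
  next
    case False
    define m where "m = n - 1"
    have m: "m \<ge> 1" "n = m + 1"
      using False mem by (auto simp: m_def)
    obtain d where d: "i2 = i1 + d"
      using le by (auto simp: le_iff_add)
    obtain i0 where i0: "i1 = Suc i0"
      using mem by (cases i1) auto
    have e: "j1 = d * m + j2"
      using eq by (simp add: d i0 m algebra_simps)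
    consider "d = 0" | "d = 1" | "d \<ge> 2" by linarith
    thus ?thesis
    proof cases
      case 1
      thus ?thesis using d e by simp
    next
      case 2
      have "j1 = m + j2" "1 \<le> j2" "j1 \<le> m + 1"
        using e 2 mem(3,4) m(2) by simp_all
      hence "j2 = 1" "j1 = n"
        using m(2) by linarith+
      moreover have "phi n r i1 n = phi n r (i1 + 1) 1"
        using mem(1,2) m(2) d 2 by (intro phi_n_eq) simp_all
      ultimately show ?thesis using d 2 by simp
    next
      case 3
      hence "2 * m \<le> d * m" by simp
      moreover have "1 \<le> j2" "j1 \<le> m + 1"
        using mem(3,4) m(2) by simp_all
      ultimately have False using e m(1) by linarith
      thus ?thesis ..
    qed
  qed
  show ?thesis
    unfolding tau_def
  proof (rule the_equality)
    show "\<exists>i'\<in>{1..r}. \<exists>j'\<in>{1..n}. (i - 1) * (n - 1) + j = (i' - 1) * (n - 1) + j' \<and>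
            phi n r i j = phi n r i' j'"
      using assms by blast
  next
    fix w
    assume "\<exists>i'\<in>{1..r}. \<exists>j'\<in>{1..n}. (i - 1) * (n - 1) + j = (i' - 1) * (n - 1) + j' \<and>
              w = phi n r i' j'"
    then obtain i' j' where "i' \<in> {1..r}" "j' \<in> {1..n}"
      "(i - 1) * (n - 1) + j = (i' - 1) * (n - 1) + j'" "w = phi n r i' j'" by blast
    thus "w = phi n r i j"
      using *[of i j i' j'] *[of i' j' i j] assms by (cases "i \<le> i'") auto
  qed
qed


section \<open>Admissibility\<close>

text \<open>The infinite sequence \<open>(s\<^sub>1, \<dots>, s\<^sub>r, rn + 1, rn + 2, \<dots>)\<close>, indexed from \<open>1\<close>.\<close>

definition ext_seq :: "nat \<Rightarrow> nat \<Rightarrow> nat list \<Rightarrow> nat \<Rightarrow> nat" where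
  "ext_seq n r S j = (if j \<le> r then S ! (j - 1) else r * n + (j - r))"

definition admissible :: "nat \<Rightarrow> nat \<Rightarrow> nat list \<Rightarrow> bool" where
  "admissible n r S \<longleftrightarrow> (\<forall>j\<ge>1. ext_seq n r S (j + 1) \<le> ext_seq n r S j + n)"

definition admissible_on :: "nat \<Rightarrow> nat \<Rightarrow> (nat \<Rightarrow> 'k :: field) set set \<Rightarrow> nat list set" where
  "admissible_on n r X = {S \<in> tuples n r. admissible n r S \<and> pluecker_section n r X S \<noteq> 0}"

end

theory Submission
  imports Defs
begin

text \<open>
  Write \<open>R = r + 1 - i\<close> and \<open>q = n + 1 - j\<close> for the member \<open>\<phi>\<^sub>i\<^sub>j\<close> of the chain. The subspaces in its
  Schubert cell are cyclic modulo a fixed subspace: they are spanned by a vector \<open>v\<close>, its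
  translates \<open>tv, \<dots>, t\<^bsup>R-1\<^esup>v\<close> and the last \<open>i - 1\<close> basis vectors. A section \<open>f\<close> of \<open>L\<^sub>0\<close> thus
  becomes a function \<open>h(v) = f(v \<and> tv \<and> \<dots>)\<close> which, being regular on the projective lines
  traced out by lines of vectors \<open>v\<close>, is a polynomial, satisfies \<open>h((e + t)v) = e\<^sup>R h(v)\<close>
  for all scalars \<open>e\<close>, and vanishes if the leading block of \<open>q\<close> coordinates of \<open>v\<close> does.

  The space of such \<open>h\<close> has dimension at most \<open>q n\<^bsup>R-1\<^esup>\<close>: restrict to the hyperplane on which the
  first coordinate \<open>v\<^sub>0\<close> is zero, which lowers \<open>q\<close>; the kernel consists of the products
  \<open>v\<^sub>0 h'\<close> with \<open>h'\<close> of degree \<open>R - 1\<close>. For \<open>h'\<close> the vanishing condition with \<open>q = n\<close> is automatic,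
  as \<open>e = 0\<close> gives \<open>h'(tv) = 0\<close>.

  Conversely, there are \<open>q n\<^bsup>R-1\<^esup>\<close> admissible tuples, and along the curve with coordinates
  \<open>v\<^sub>k = x\<close> to the power \<open>B\<^sup>k\<close>, with \<open>B\<close> large, their Pluecker coordinates are polynomials in \<open>x\<close>
  with pairwise different lowest terms. Hence they are independent and span.
\<close>

section \<open>Dimension bounds for spaces of functions\<close>

text \<open>A section is given only by local quotients on a cone, so its polynomiality has to be
  forced by testing it on curves: a function on the whole affine line that is locally a quotient is
  a polynomial, and homogeneity of degree \<open>R\<close> controls it at infinity. The obstacle is
  that \<open>om v\<close> is shown to lie in the cone only while the leading block of
  \<open>v\<close> is nonzero. The bad vectors have codimension \<open>q\<close>, so for
  \<open>q \<ge> 2\<close> enough complete lines avoid them; this is why a description of a chain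
  member with \<open>q = 1\<close> is kept only when \<open>R = 1\<close>. Limits are replaced by
  the fact that polynomials agreeing off a finite set agree.

  For nonzero \<open>e\<close>, multiplication by the unit \<open>e + t\<close> leaves the cyclic
  subspace unchanged modulo the fixed vectors and multiplies the wedge by \<open>e ^ R\<close>; the
  identity then extends to \<open>e = 0\<close>, the case that the induction exploits. Since the
  number of independent minors reaches the upper bound, spanning is obtained without straightening
  relations.\<close>

abbreviation fun_linear :: "(('x \<Rightarrow> 'k :: field) \<Rightarrow> ('y \<Rightarrow> 'k)) \<Rightarrow> bool" where
  "fun_linear \<equiv> Vector_Spaces.linear (\<lambda>c f x. c * f x) (\<lambda>c f x. c * f x)"

lemma fun_linearI:
  assumes "\<And>f g. T (f + g) = T f + T g" and "\<And>c f. T (\<lambda>x. c * f x) = (\<lambda>y. c * T f y)"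
  shows "fun_linear T"
  unfolding Vector_Spaces.linear_def module_hom_def module_hom_axioms_def
  by (intro conjI allI fun_space.vector_space_axioms fun_space.module_axioms) (simp_all add: assms)

definition dim_at_most :: "('x \<Rightarrow> 'k :: field) set \<Rightarrow> nat \<Rightarrow> bool" where
  "dim_at_most H N \<longleftrightarrow> (\<exists>B. finite B \<and> card B \<le> N \<and> H \<subseteq> fun_space.span B)"

lemma dim_at_most_subset: "dim_at_most H N \<Longrightarrow> G \<subseteq> H \<Longrightarrow> N \<le> N' \<Longrightarrow> dim_at_most G N'"
  unfolding dim_at_most_def by (meson order_trans)

lemma dim_at_most_zero: "H \<subseteq> {0} \<Longrightarrow> dim_at_most H 0"
  unfolding dim_at_most_def by (intro exI[of _ "{}"]) auto

lemma dim_at_most_image: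
  assumes T: "fun_linear T" and H: "dim_at_most H N"
  shows "dim_at_most (T ` H) N"
proof -
  obtain B where B: "finite B" "card B \<le> N" "H \<subseteq> fun_space.span B"
    using H by (auto simp: dim_at_most_def)
  interpret T: Vector_Spaces.linear "\<lambda>c f x. c * f x" "\<lambda>c f x. c * f x" T by (rule T)
  have "T ` H \<subseteq> fun_space.span (T ` B)"
    using B(3) T.span_image[of B] by (metis image_mono)
  moreover have "card (T ` B) \<le> N"
    using card_image_le[OF B(1), of T] B(2) by linarith
  ultimately show ?thesis using B(1) unfolding dim_at_most_def by blast
qed

text \<open>Rank-nullity as an inequality: lift a basis of the image to \<open>C\<close>, and
  correct any \<open>h\<close> by a combination of \<open>C\<close> to land in the kernel.\<close>

lemma dim_at_most_ker_image:
  assumes T: "fun_linear T" and H: "fun_space.subspace H"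
    and a: "dim_at_most (T ` H) a" and b: "dim_at_most {h \<in> H. T h = 0} b"
  shows "dim_at_most H (a + b)"
proof -
  interpret T: Vector_Spaces.linear "\<lambda>c f x. c * f x" "\<lambda>c f x. c * f x" T by (rule T)
  obtain A where A: "finite A" "card A \<le> a" "T ` H \<subseteq> fun_space.span A"
    using a by (auto simp: dim_at_most_def)
  obtain B where B: "finite B" "card B \<le> b" "{h \<in> H. T h = 0} \<subseteq> fun_space.span B"
    using b by (auto simp: dim_at_most_def)
  obtain A' where A': "A' \<subseteq> T ` H" "fun_space.independent A'" "T ` H \<subseteq> fun_space.span A'"
    by (rule fun_space.basis_exists)
  have A'_card: "finite A' \<and> card A' \<le> card A"
    by (rule fun_space.independent_span_bound[OF A(1) A'(2) order_trans[OF A'(1) A(3)]])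
  obtain C where C: "C \<subseteq> H" "inj_on T C" "A' = T ` C"
    using A'(1) by (auto simp: subset_image_inj)
  have finC: "finite C" "card C \<le> a"
    using C A'_card A(2) by (auto simp: card_image finite_image_iff)
  have "H \<subseteq> fun_space.span (C \<union> B)"
  proof
    fix h assume h: "h \<in> H"
    hence "T h \<in> T ` fun_space.span C"
      using A'(3) T.span_image[of C] C(3) by blast
    then obtain c where c: "c \<in> fun_space.span C" "T h = T c" by auto
    have "c \<in> H" using c(1) fun_space.span_minimal[OF C(1) H] by blast
    hence "h - c \<in> H" using h H fun_space.subspace_diff by blast
    moreover have "T (h - c) = 0" using c(2) T.diff by simp
    ultimately have "h - c \<in> fun_space.span B" using B(3) by blast
    hence "c + (h - c) \<in> fun_space.span (C \<union> B)"
      using c(1) fun_space.span_mono[of C "C \<union> B"] fun_space.span_mono[of B "C \<union> B"]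
      by (intro fun_space.span_add) auto
    thus "h \<in> fun_space.span (C \<union> B)" by simp
  qed
  moreover have "card (C \<union> B) \<le> a + b"
    using card_Un_le[of C B] finC B(2) by linarith
  ultimately show ?thesis
    using finC B(1) unfolding dim_at_most_def by blast
qed

text \<open>An element outside the span of \<open>A\<close> would enlarge \<open>A\<close> to more
  than \<open>N\<close> independent elements. This turns two counts into a spanning
  statement.\<close>

lemma span_eq_of_card:
  assumes G: "fun_space.subspace G" and A: "A \<subseteq> G" "fun_space.independent A"
    and N: "dim_at_most G N" "N \<le> card A"
  shows "fun_space.span A = G"
proof
  show "fun_space.span A \<subseteq> G" using fun_space.span_minimal[OF A(1) G] .
  obtain B where B: "finite B" "card B \<le> N" "G \<subseteq> fun_space.span B"
    using N by (auto simp: dim_at_most_def)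
  show "G \<subseteq> fun_space.span A"
  proof
    fix g assume g: "g \<in> G"
    show "g \<in> fun_space.span A"
    proof (rule ccontr)
      assume n: "g \<notin> fun_space.span A"
      hence "fun_space.independent (insert g A)" using A(2) fun_space.independent_insertI by blast
      moreover have "insert g A \<subseteq> fun_space.span B" using g A(1) B(3) by blast
      ultimately have "finite (insert g A) \<and> card (insert g A) \<le> card B"
        by (rule fun_space.independent_span_bound[OF B(1)])
      moreover have "g \<notin> A" using n fun_space.span_base[of g A] by auto
      ultimately have "card (insert g A) = Suc (card A)" "card (insert g A) \<le> card B"
        by (auto intro!: card_insert_disjoint)
      thus False using N(2) B(2) by linarith
    qed
  qed
qed

section \<open>Polynomial functions\<close>

text \<open>Polynomial maps are generated as functions, without coefficients; over the infinite
  field K an identity between them may be checked off a coordinate hyperplane, see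
  \<open>polyfuns_eqI\<close>.\<close>

inductive_set polyfuns :: "((nat \<Rightarrow> 'k :: field) \<Rightarrow> 'k) set" where
  const: "(\<lambda>v. c) \<in> polyfuns"
| coord: "(\<lambda>v. v k) \<in> polyfuns"
| add: "f \<in> polyfuns \<Longrightarrow> g \<in> polyfuns \<Longrightarrow> (\<lambda>v. f v + g v) \<in> polyfuns"
| mult: "f \<in> polyfuns \<Longrightarrow> g \<in> polyfuns \<Longrightarrow> (\<lambda>v. f v * g v) \<in> polyfuns"

lemma polyfuns_if: "(P \<Longrightarrow> f \<in> polyfuns) \<Longrightarrow> (\<not> P \<Longrightarrow> g \<in> polyfuns) \<Longrightarrow>
    (\<lambda>v. if P then f v else g v) \<in> polyfuns"
  by (cases P) auto

lemma polyfuns_compose: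
  "f \<in> polyfuns \<Longrightarrow> (\<And>k. (\<lambda>v. s v k) \<in> polyfuns) \<Longrightarrow> (\<lambda>v. f (s v)) \<in> polyfuns"
  by (induction rule: polyfuns.induct) (auto intro: polyfuns.intros)

lemma polyfuns_diff: "f \<in> polyfuns \<Longrightarrow> g \<in> polyfuns \<Longrightarrow> (\<lambda>v. f v - g v) \<in> polyfuns"
  using polyfuns.add[OF _ polyfuns.mult[OF polyfuns.const[of "-1"]], of f g] by simp

lemma polyfuns_sum:
  "(\<And>x. x \<in> A \<Longrightarrow> f x \<in> polyfuns) \<Longrightarrow> (\<lambda>v. \<Sum>x\<in>A. f x v) \<in> polyfuns"
  by (induction A rule: infinite_finite_induct) (auto intro: polyfuns.intros)

lemma polyfuns_prod:
  "(\<And>x. x \<in> A \<Longrightarrow> f x \<in> polyfuns) \<Longrightarrow> (\<lambda>v. \<Prod>x\<in>A. f x v) \<in> polyfuns"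
  by (induction A rule: infinite_finite_induct) (auto intro: polyfuns.intros)

lemma polyfuns_power: "f \<in> polyfuns \<Longrightarrow> (\<lambda>v. f v ^ m) \<in> polyfuns"
  by (induction m) (auto intro: polyfuns.intros)

lemma polyfuns_upd: "f \<in> polyfuns \<Longrightarrow> g \<in> polyfuns \<Longrightarrow> (\<lambda>v. f (v(a := g v))) \<in> polyfuns"
  by (rule polyfuns_compose[where s = "\<lambda>v. v(a := g v)"])
    (auto simp: fun_upd_def intro!: polyfuns_if intro: polyfuns.intros)

text \<open>Division with remainder by the coordinate \<open>v a\<close>: what vanishes on the
  hyperplane is divisible by it.\<close>

lemma polyfuns_split:
  "f \<in> polyfuns \<Longrightarrow> \<exists>f'\<in>polyfuns. \<forall>v. f v = f (v(a := 0)) + v a * f' v"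
proof (induction rule: polyfuns.induct)
  case (const c)
  show ?case by (intro bexI[of _ "\<lambda>v. 0"]) (auto intro: polyfuns.intros)
next
  case (coord k)
  show ?case
    by (intro bexI[of _ "\<lambda>v. if k = a then 1 else 0"]) (auto intro: polyfuns.intros)
next
  case (add f g)
  then obtain f' g' where fg: "f' \<in> polyfuns" "g' \<in> polyfuns"
    "\<And>v. f v = f (v(a := 0)) + v a * f' v" "\<And>v. g v = g (v(a := 0)) + v a * g' v" by blast
  have eq: "f v + g v = f (v(a := 0)) + g (v(a := 0)) + v a * (f' v + g' v)" for v
    by (subst fg(3), subst fg(4)) (simp only: algebra_simps)
  show ?case by (rule bexI[OF _ polyfuns.add[OF fg(1,2)]], rule allI, rule eq)
next
  case (mult f g)
  then obtain f' g' where fg: "f' \<in> polyfuns" "g' \<in> polyfuns"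
    "\<And>v. f v = f (v(a := 0)) + v a * f' v" "\<And>v. g v = g (v(a := 0)) + v a * g' v" by blast
  have eq: "f v * g v = f (v(a := 0)) * g (v(a := 0)) +
      v a * (f' v * g v + f (v(a := 0)) * g' v)" for v
  proof -
    have "f v * g v = (f (v(a := 0)) + v a * f' v) * g v"
      by (simp only: fg(3)[symmetric])
    also have "\<dots> = f (v(a := 0)) * g v + v a * (f' v * g v)"
      by (simp only: distrib_right mult.assoc)
    also have "f (v(a := 0)) * g v = f (v(a := 0)) * (g (v(a := 0)) + v a * g' v)"
      by (simp only: fg(4)[symmetric])
    finally show ?thesis by (simp only: distrib_left ac_simps)
  qed
  have P: "(\<lambda>v. f' v * g v + f (v(a := 0)) * g' v) \<in> polyfuns"
    using fg(1,2) mult.hyps polyfuns_upd[OF mult.hyps(1) polyfuns.const[of 0], of a]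
    by (auto intro: polyfuns.intros)
  show ?case by (rule bexI[OF _ P], rule allI, rule eq)
qed

section \<open>Univariate polynomial functions and the identity principle\<close>

definition upoly :: "('k :: field \<Rightarrow> 'k) \<Rightarrow> bool" where
  "upoly g \<longleftrightarrow> (\<exists>p. \<forall>b. g b = poly p b)"

lemma upoly_const [intro, simp]: "upoly (\<lambda>b. c)"
  unfolding upoly_def by (intro exI[of _ "[:c:]"]) simp
lemma upoly_id [intro, simp]: "upoly (\<lambda>b. b)"
  unfolding upoly_def by (intro exI[of _ "[:0,1:]"]) simp
lemma upoly_add [intro]: "upoly f \<Longrightarrow> upoly g \<Longrightarrow> upoly (\<lambda>b. f b + g b)"
  unfolding upoly_def by (metis poly_add)
lemma upoly_mult [intro]: "upoly f \<Longrightarrow> upoly g \<Longrightarrow> upoly (\<lambda>b. f b * g b)"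
  unfolding upoly_def by (metis poly_mult)
lemma upoly_power [intro]: "upoly f \<Longrightarrow> upoly (\<lambda>b. f b ^ m)"
  unfolding upoly_def by (metis poly_power)
lemma upoly_sum: "(\<And>x. x \<in> A \<Longrightarrow> upoly (f x)) \<Longrightarrow> upoly (\<lambda>b. \<Sum>x\<in>A. f x b)"
  by (induction A rule: infinite_finite_induct) auto
lemma upoly_prod: "(\<And>x. x \<in> A \<Longrightarrow> upoly (f x)) \<Longrightarrow> upoly (\<lambda>b. \<Prod>x\<in>A. f x b)"
  by (induction A rule: infinite_finite_induct) auto

lemma upoly_polyfun: "f \<in> polyfuns \<Longrightarrow> (\<And>k. upoly (\<lambda>b. s b k)) \<Longrightarrow> upoly (\<lambda>b. f (s b))"
  by (induction rule: polyfuns.induct) auto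

text \<open>Over a finite field, 1 plus the product of all \<open>x - a\<close> would be a
  nonconstant polynomial without roots.\<close>

lemma infinite_alg_closed: "infinite (UNIV :: 'k :: alg_closed_field set)"
proof
  assume fin: "finite (UNIV :: 'k set)"
  define p :: "'k poly" where "p = 1 + (\<Prod>a\<in>UNIV. [:-a, 1:])"
  have ev: "poly p x = 1" for x
    unfolding p_def using fin by (simp add: poly_prod prod_zero_iff)
  have "degree (\<Prod>a\<in>(UNIV::'k set). [:-a, 1:]) = card (UNIV :: 'k set)"
    by (subst degree_prod_eq_sum_degree) auto
  moreover have "card (UNIV :: 'k set) > 0" using fin by (simp add: card_gt_0_iff)
  ultimately have "degree p > 0"
    unfolding p_def by (subst degree_add_eq_right) auto
  then obtain x where "poly p x = 0" using alg_closed_imp_poly_has_root by blast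
  thus False using ev by simp
qed

text \<open>Stands in for passing to a limit: with \<open>S = {0}\<close>, an identity known for
  nonzero parameters extends to the parameter 0.\<close>

lemma upoly_eqI:
  fixes f g :: "'k :: alg_closed_field \<Rightarrow> 'k"
  assumes "upoly f" "upoly g" "finite S" "\<And>b. b \<notin> S \<Longrightarrow> f b = g b"
  shows "f b = g b"
proof -
  obtain p p' where p: "\<And>b. f b = poly p b" "\<And>b. g b = poly p' b"
    using assms(1,2) by (auto simp: upoly_def)
  have "p - p' = 0"
  proof (rule ccontr)
    assume "p - p' \<noteq> 0"
    hence "finite {b. poly (p - p') b = 0}" by (rule poly_roots_finite)
    moreover have "UNIV - S \<subseteq> {b. poly (p - p') b = 0}" using assms(4) p by auto
    ultimately have "finite (UNIV - S)" by (rule finite_subset[rotated])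
    thus False using assms(3) infinite_alg_closed[where 'k = 'k] by (simp add: finite_Diff2)
  qed
  thus ?thesis using p by simp
qed

lemma polyfuns_eqI:
  fixes f g :: "(nat \<Rightarrow> 'k :: alg_closed_field) \<Rightarrow> 'k"
  assumes "f \<in> polyfuns" "g \<in> polyfuns" "\<And>v. v a \<noteq> 0 \<Longrightarrow> f v = g v"
  shows "f v = g v"
proof -
  have u: "upoly (\<lambda>b. h (v(a := b)))" if "h \<in> polyfuns" for h :: "(nat \<Rightarrow> 'k) \<Rightarrow> 'k"
  proof (rule upoly_polyfun[OF that])
    fix k show "upoly (\<lambda>b. (v(a := b)) k)" by (cases "k = a") auto
  qed
  have "f (v(a := b)) = g (v(a := b))" for b
    using upoly_eqI[OF u[OF assms(1)] u[OF assms(2)], of "{0}"] assms(3) by auto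
  from this[of "v a"] show ?thesis by simp
qed

section \<open>Semi-invariant polynomial functions\<close>

text \<open>
  The action of \<open>e + t\<close> on vectors whose coordinates with numbers below \<open>a\<close> are regarded as zero.
\<close>

definition twist :: "nat \<Rightarrow> nat \<Rightarrow> 'k :: field \<Rightarrow> (nat \<Rightarrow> 'k) \<Rightarrow> nat \<Rightarrow> 'k" where
  "twist n a e v = (\<lambda>k. e * v k + (if k \<ge> a + n then v (k - n) else 0))"

text \<open>Semi-invariants of degree \<open>D\<close> under \<open>e + t\<close> in the coordinates
  from \<open>a\<close> to \<open>M - 1\<close>. The value \<open>e = 0\<close> is included: it
  gives \<open>f (t v) = 0\<close> for \<open>D \<ge> 1\<close>, and \<open>f (t v) = f v\<close>
  for \<open>D = 0\<close> because \<open>0 ^ 0 = 1\<close>.\<close>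

definition invs :: "nat \<Rightarrow> nat \<Rightarrow> nat \<Rightarrow> nat \<Rightarrow> ((nat \<Rightarrow> 'k :: field) \<Rightarrow> 'k) set" where
  "invs n D a M = {f \<in> polyfuns. (\<forall>v v'. (\<forall>k\<in>{a..<M}. v k = v' k) \<longrightarrow> f v = f v') \<and>
     (\<forall>e v. f (twist n a e v) = e ^ D * f v)}"

definition invs0 :: "nat \<Rightarrow> nat \<Rightarrow> nat \<Rightarrow> nat \<Rightarrow> nat \<Rightarrow> ((nat \<Rightarrow> 'k :: field) \<Rightarrow> 'k) set" where
  "invs0 n D a M q = {f \<in> invs n D a M. \<forall>v. (\<forall>k\<in>{a..<a + q}. v k = 0) \<longrightarrow> f v = 0}"

lemma polyfuns_twist: "f \<in> polyfuns \<Longrightarrow> (\<lambda>v. f (twist n a e v)) \<in> polyfuns"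
  by (rule polyfuns_compose[where s = "\<lambda>v. twist n a e v"])
    (auto simp: twist_def intro!: polyfuns.intros polyfuns_if)

lemma upoly_twist: "f \<in> polyfuns \<Longrightarrow> upoly (\<lambda>e. f (twist n a e v))"
  by (rule upoly_polyfun[where s = "\<lambda>e. twist n a e v"])
    (auto simp: twist_def intro!: upoly_add upoly_mult)

lemma invs_subset_invs0:
  assumes "D \<ge> 1"
  shows "invs n D a M \<subseteq> invs0 n D a M n"
proof
  fix f :: "(nat \<Rightarrow> 'a) \<Rightarrow> 'a"
  assume f: "f \<in> invs n D a M"
  have "f v = 0" if v: "\<forall>k\<in>{a..<a + n}. v k = 0" for v
  proof -
    have "f v = f (twist n a 0 (\<lambda>k. v (k + n)))"
      using f v by (auto simp: invs_def twist_def)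
    also have "\<dots> = 0" using f assms by (auto simp: invs_def)
    finally show ?thesis .
  qed
  thus "f \<in> invs0 n D a M n" using f by (auto simp: invs0_def)
qed

text \<open>With \<open>D = 0\<close> and \<open>e = 0\<close> the value is unchanged when
  \<open>v\<close> is replaced by \<open>t v\<close>; as \<open>t\<close> is nilpotent on finitely
  many coordinates, iteration ends at the zero vector.\<close>

lemma invs_0_const:
  assumes "n \<ge> 1" "f \<in> invs n 0 a M"
  shows "f v = f (\<lambda>_. 0)"
proof -
  have dep: "f v = f v'" if "\<forall>k\<in>{a..<M}. v k = v' k" for v v'
    using assms(2) that unfolding invs_def by blast
  have "f v = f (\<lambda>_. 0)" if "\<forall>k. k < a + m \<longrightarrow> a \<le> k \<longrightarrow> v k = 0" "M \<le> a + m + d" for m d v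
    using that
  proof (induction d arbitrary: m v)
    case 0
    thus ?case by (intro dep) auto
  next
    case (Suc d)
    have "f v = f (twist n a 0 v)" using assms(2) by (simp add: invs_def)
    also have "\<dots> = f (\<lambda>_. 0)"
      using Suc.prems assms(1) by (intro Suc.IH[of "Suc m"]) (auto simp: twist_def)
    finally show ?case .
  qed
  from this[of 0 v M] show ?thesis by simp
qed

lemma subspace_invs0: "fun_space.subspace (invs0 n D a M q)"
proof (rule fun_space.subspaceI)
  show "0 \<in> invs0 n D a M q"
    using polyfuns.const[of 0] by (auto simp: invs0_def invs_def zero_fun_def)
next
  fix f g :: "(nat \<Rightarrow> 'a) \<Rightarrow> 'a"
  assume f: "f \<in> invs0 n D a M q" and g: "g \<in> invs0 n D a M q"
  have "f + g \<in> polyfuns"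
    using polyfuns.add[of f g] f g by (simp add: invs0_def invs_def plus_fun_def)
  moreover have "(f + g) v = (f + g) v'" if "\<forall>k\<in>{a..<M}. v k = v' k" for v v'
  proof -
    have "f v = f v'" "g v = g v'" using f g that unfolding invs0_def invs_def by blast+
    thus ?thesis by simp
  qed
  ultimately show "f + g \<in> invs0 n D a M q"
    using f g unfolding invs0_def invs_def by (simp add: algebra_simps)
next
  fix c :: 'a and f :: "(nat \<Rightarrow> 'a) \<Rightarrow> 'a"
  assume f: "f \<in> invs0 n D a M q"
  have "(\<lambda>v. c * f v) \<in> polyfuns"
    using polyfuns.mult[OF polyfuns.const[of c], of f] f by (simp add: invs0_def invs_def)
  moreover have "f v = f v'" if "\<forall>k\<in>{a..<M}. v k = v' k" for v v'
    using f that unfolding invs0_def invs_def by blast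
  ultimately show "(\<lambda>v. c * f v) \<in> invs0 n D a M q"
    using f unfolding invs0_def invs_def by simp
qed

lemma dim_invs0_step:
  fixes a :: nat
  assumes "n \<ge> 1"
    and IH: "\<And>a M. dim_at_most (invs n D a M :: ((nat \<Rightarrow> 'k :: alg_closed_field) \<Rightarrow> 'k) set) N"
  shows "dim_at_most (invs0 n (Suc D) a M q :: ((nat \<Rightarrow> 'k) \<Rightarrow> 'k) set) (q * N)"
proof (induction q arbitrary: a)
  case 0
  have "invs0 n (Suc D) a M 0 \<subseteq> {0 :: (nat \<Rightarrow> 'k) \<Rightarrow> 'k}"
    by (auto simp: invs0_def fun_eq_iff)
  thus ?case by (simp add: dim_at_most_zero)
next
  case (Suc q)
  define T :: "((nat \<Rightarrow> 'k) \<Rightarrow> 'k) \<Rightarrow> (nat \<Rightarrow> 'k) \<Rightarrow> 'k" where "T = (\<lambda>f v. f (v(a := 0)))"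
  define H :: "((nat \<Rightarrow> 'k) \<Rightarrow> 'k) set" where "H = invs0 n (Suc D) a M (Suc q)"
  \<comment> \<open>Once coordinate \<open>a\<close> is 0, it is irrelevant whether it is shifted,
    so the active range may start at \<open>a + 1\<close>, and the leading block loses one
    entry.\<close>
  have "T ` H \<subseteq> invs0 n (Suc D) (Suc a) M q"
  proof safe
    fix f assume f: "f \<in> H"
    have "T f \<in> polyfuns"
      unfolding T_def using f polyfuns_upd[of f "\<lambda>_. 0"] polyfuns.const
      by (auto simp: H_def invs0_def invs_def)
    moreover have "T f v = T f v'" if "\<forall>k\<in>{Suc a..<M}. v k = v' k" for v v'
    proof -
      have "\<forall>k\<in>{a..<M}. (v(a := 0)) k = (v'(a := 0)) k" using that by auto
      thus ?thesis using f unfolding T_def H_def invs0_def invs_def by blast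
    qed
    moreover have "T f (twist n (Suc a) e v) = e ^ Suc D * T f v" for e v
    proof -
      have "T f (twist n (Suc a) e v) = f (twist n a e (v(a := 0)))"
        unfolding T_def by (rule arg_cong[of _ _ f]) (use assms(1) in \<open>auto simp: twist_def fun_eq_iff\<close>)
      also have "\<dots> = e ^ Suc D * T f v"
        using f by (simp add: T_def H_def invs0_def invs_def)
      finally show ?thesis .
    qed
    moreover have "T f v = 0" if "\<forall>k\<in>{Suc a..<Suc a + q}. v k = 0" for v
      using f that by (auto simp: T_def H_def invs0_def)
    ultimately show "T f \<in> invs0 n (Suc D) (Suc a) M q"
      unfolding invs0_def invs_def by blast
  qed
  hence 1: "dim_at_most (T ` H) (q * N)"
    using Suc.IH[of "Suc a"] dim_at_most_subset by blast
  define S :: "((nat \<Rightarrow> 'k) \<Rightarrow> 'k) \<Rightarrow> (nat \<Rightarrow> 'k) \<Rightarrow> 'k" where "S = (\<lambda>f v. v a * f v)"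
  have "{f \<in> H. T f = 0} \<subseteq> S ` invs n D a M"
  proof safe
    fix f assume f: "f \<in> H" "T f = 0"
    hence f0: "f (v(a := 0)) = 0" for v by (simp add: T_def fun_eq_iff)
    have fP: "f \<in> polyfuns" using f by (simp add: H_def invs0_def invs_def)
    obtain g where g: "g \<in> polyfuns" "\<And>v. f v = v a * g v"
      using polyfuns_split[OF fP, of a] f0 by auto
    \<comment> \<open>The quotient \<open>g\<close> may depend on coordinates outside
      \<open>{a..<M}\<close>; composing with the truncation \<open>r\<close> removes this.\<close>
    define r :: "(nat \<Rightarrow> 'k) \<Rightarrow> nat \<Rightarrow> 'k" where "r = (\<lambda>v k. if k \<in> {a..<M} then v k else 0)"
    have dep: "f v = f v'" if "\<forall>k\<in>{a..<M}. v k = v' k" for v v'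
      using f(1) that unfolding H_def invs0_def invs_def by blast
    show "f \<in> S ` invs n D a M"
    proof (cases "a < M")
      case False
      have "f v = 0" for v
        using dep[of v "v(a := 0)"] f0[of v] False by simp
      hence "f = 0" by (simp add: fun_eq_iff)
      moreover have "(\<lambda>v. 0) \<in> invs n D a M"
        by (auto simp: invs_def polyfuns.const)
      ultimately show ?thesis by (intro image_eqI[of _ _ "\<lambda>v. 0"]) (auto simp: S_def)
    next
      case True
      define h where "h = (\<lambda>v. g (r v))"
      have h: "h \<in> polyfuns"
        unfolding h_def by (rule polyfuns_compose[OF g(1)]) (auto simp: r_def intro!: polyfuns_if intro: polyfuns.intros)
      have fh: "f v = v a * h v" for v
      proof -
        have "f v = f (r v)" by (rule dep) (auto simp: r_def)
        thus ?thesis using g(2)[of "r v"] True by (simp add: h_def r_def)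
      qed
      have "h (twist n a e v) = e ^ D * h v" for e v
      proof -
        \<comment> \<open>Cancel \<open>e * v a\<close> where it is nonzero; density, first in
          \<open>v\<close> and then in \<open>e\<close>, removes both restrictions.\<close>
        have *: "h (twist n a e v) = e ^ D * h v" if "e \<noteq> 0" "v a \<noteq> 0" for e v
        proof -
          have "e * v a * h (twist n a e v) = f (twist n a e v)"
            using assms(1) by (simp add: fh twist_def)
          also have "\<dots> = e ^ Suc D * f v" using f(1) by (simp add: H_def invs0_def invs_def)
          also have "\<dots> = e * v a * (e ^ D * h v)" by (simp add: fh)
          finally show ?thesis using that by simp
        qed
        have **: "h (twist n a e v) = e ^ D * h v" if "e \<noteq> 0" for e v
          by (rule polyfuns_eqI[of _ _ a])
            (use h polyfuns_twist * that in \<open>auto intro: polyfuns.intros\<close>)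
        have u: "upoly (\<lambda>e. e ^ D * h v)"
          by (intro upoly_mult upoly_power upoly_id upoly_const)
        show ?thesis
          by (rule upoly_eqI[OF upoly_twist[OF h] u, of "{0}"]) (use ** in auto)
      qed
      moreover have "h v = h v'" if "\<forall>k\<in>{a..<M}. v k = v' k" for v v'
        using that unfolding h_def r_def by (metis (mono_tags, lifting))
      ultimately have "h \<in> invs n D a M" using h unfolding invs_def by blast
      moreover have "f = S h" using fh by (auto simp: S_def)
      ultimately show ?thesis by blast
    qed
  qed
  moreover have "fun_linear S"
    by (rule fun_linearI) (auto simp: S_def fun_eq_iff algebra_simps)
  ultimately have 2: "dim_at_most {f \<in> H. T f = 0} N"
    using dim_at_most_image[OF _ IH] dim_at_most_subset by blast
  have "fun_linear T" by (rule fun_linearI) (auto simp: T_def fun_eq_iff)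
  moreover have "fun_space.subspace H" unfolding H_def by (rule subspace_invs0)
  ultimately have "dim_at_most H (q * N + N)" by (rule dim_at_most_ker_image[OF _ _ 1 2])
  thus ?case unfolding H_def by (simp add: add.commute)
qed

lemma dim_invs:
  assumes "n \<ge> 1"
  shows "dim_at_most (invs n D a M :: ((nat \<Rightarrow> 'k :: alg_closed_field) \<Rightarrow> 'k) set) (n ^ D)"
proof (induction D arbitrary: a M)
  case 0
  have "invs n 0 a M \<subseteq> fun_space.span {\<lambda>_. 1 :: 'k}"
  proof
    fix f :: "(nat \<Rightarrow> 'k) \<Rightarrow> 'k" assume f: "f \<in> invs n 0 a M"
    define c where "c = f (\<lambda>_. 0)"
    have "f v = c" for v unfolding c_def by (rule invs_0_const[OF assms f])
    hence "f = (\<lambda>x. c * (\<lambda>_. 1) x)" by (simp add: fun_eq_iff)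
    thus "f \<in> fun_space.span {\<lambda>_. 1}"
      using fun_space.span_scale[OF fun_space.span_base, of "\<lambda>_. 1 :: 'k" "{\<lambda>_. 1}" c] by simp
  qed
  moreover have "finite {\<lambda>_ :: nat \<Rightarrow> 'k. 1 :: 'k}" "card {\<lambda>_ :: nat \<Rightarrow> 'k. 1 :: 'k} \<le> n ^ 0"
    by simp_all
  ultimately show ?case unfolding dim_at_most_def by blast
next
  case (Suc D)
  have "dim_at_most (invs0 n (Suc D) a M n :: ((nat \<Rightarrow> 'k) \<Rightarrow> 'k) set) (n * n ^ D)"
    by (rule dim_invs0_step[OF assms Suc.IH])
  thus ?case by (rule dim_at_most_subset) (simp_all add: invs_subset_invs0)
qed

lemma dim_invs0:
  assumes "n \<ge> 1"
  shows "dim_at_most (invs0 n (Suc D) a M q :: ((nat \<Rightarrow> 'k :: alg_closed_field) \<Rightarrow> 'k) set) (q * n ^ D)"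
  by (rule dim_invs0_step[OF assms dim_invs[OF assms]])

section \<open>Recognizing polynomial functions\<close>

lemma poly_eq_cofinite:
  fixes p q :: "'k :: alg_closed_field poly"
  assumes "finite S" "\<And>b. b \<notin> S \<Longrightarrow> poly p b = poly q b"
  shows "p = q"
proof (rule ccontr)
  assume "p \<noteq> q"
  hence "finite {b. poly (p - q) b = 0}" by (intro poly_roots_finite) simp
  moreover have "UNIV - S \<subseteq> {b. poly (p - q) b = 0}" using assms(2) by auto
  ultimately have "finite (UNIV - S)" by (rule finite_subset[rotated])
  thus False using assms(1) infinite_alg_closed[where 'k = 'k] by (simp add: finite_Diff2)
qed

text \<open>A quotient of least degree has a denominator without zeros.\<close>

lemma upoly_local_quotients:
  fixes F :: "'k :: alg_closed_field \<Rightarrow> 'k"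
  assumes loc: "\<And>b0. \<exists>p s. upoly p \<and> upoly s \<and> s b0 \<noteq> 0 \<and> (\<forall>b. s b \<noteq> 0 \<longrightarrow> F b = p b / s b)"
  shows "upoly F"
proof -
  have loc': "\<exists>p s. poly s b0 \<noteq> 0 \<and> (\<forall>b. poly s b \<noteq> 0 \<longrightarrow> F b * poly s b = poly p b)" for b0
  proof -
    obtain p s where "upoly p" "upoly s" "s b0 \<noteq> 0" "\<forall>b. s b \<noteq> 0 \<longrightarrow> F b = p b / s b"
      using loc[of b0] by blast
    moreover then obtain p' s' where "\<And>b. p b = poly p' b" "\<And>b. s b = poly s' b"
      by (auto simp: upoly_def)
    ultimately show ?thesis by (intro exI[of _ p'] exI[of _ s']) simp
  qed
  \<comment> \<open>The equation is asked for only off a finite set: this survives cancelling a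
    common linear factor, so the degree of the denominator can descend.\<close>
  define good where "good = (\<lambda>(s, p). s \<noteq> 0 \<and> finite {b. F b * poly s b \<noteq> poly p b})"
  have good0: "\<exists>x. good x"
  proof -
    obtain p s where ps: "poly s 0 \<noteq> 0" "\<forall>b. poly s b \<noteq> 0 \<longrightarrow> F b * poly s b = poly p b"
      using loc' by blast
    have "s \<noteq> 0" using ps(1) by auto
    hence "finite {b. poly s b = 0}" by (rule poly_roots_finite)
    hence "finite {b. F b * poly s b \<noteq> poly p b}"
      by (rule finite_subset[rotated]) (use ps(2) in blast)
    thus ?thesis using \<open>s \<noteq> 0\<close> by (auto simp: good_def intro!: exI[of _ "(s, p)"])
  qed
  obtain x where x: "good x" "\<And>y. good y \<Longrightarrow> degree (fst x) \<le> degree (fst y)"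
    using good0 ex_has_least_nat[of good _ "\<lambda>x. degree (fst x)"] by blast
  obtain s p where sp: "x = (s, p)" by (cases x)
  have s0: "s \<noteq> 0" and fin: "finite {b. F b * poly s b \<noteq> poly p b}"
    using x(1) by (auto simp: good_def sp)
  \<comment> \<open>Every local quotient is proportional to the minimal one, so a zero of the
    minimal denominator is also a zero of its numerator.\<close>
  have cross: "p * s1 = p1 * s"
    if "poly s1 b0 \<noteq> 0" "\<forall>b. poly s1 b \<noteq> 0 \<longrightarrow> F b * poly s1 b = poly p1 b" for b0 s1 p1
  proof (rule poly_eq_cofinite)
    have "s1 \<noteq> 0" using that(1) by auto
    thus "finite ({b. F b * poly s b \<noteq> poly p b} \<union> {b. poly s1 b = 0})"
      using fin poly_roots_finite by blast
    fix b assume "b \<notin> {b. F b * poly s b \<noteq> poly p b} \<union> {b. poly s1 b = 0}"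
    hence "poly p b = F b * poly s b" "poly p1 b = F b * poly s1 b" using that(2) by auto
    thus "poly (p * s1) b = poly (p1 * s) b" by simp
  qed
  have "degree s = 0"
  proof (rule ccontr)
    assume "degree s \<noteq> 0"
    then obtain b1 where b1: "poly s b1 = 0" using alg_closed_imp_poly_has_root by blast
    obtain p1 s1 where 1: "poly s1 b1 \<noteq> 0"
      "\<forall>b. poly s1 b \<noteq> 0 \<longrightarrow> F b * poly s1 b = poly p1 b" using loc' by blast
    have "poly p b1 * poly s1 b1 = 0"
      using arg_cong[OF cross[OF 1], of "\<lambda>q. poly q b1"] b1 by simp
    hence "poly p b1 = 0" using 1(1) by simp
    then obtain p' s' where p': "p = [:- b1, 1:] * p'" and s': "s = [:- b1, 1:] * s'"
      using b1 by (auto simp: poly_eq_0_iff_dvd dvd_def)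
    have "F b * poly s' b = poly p' b" if "b \<noteq> b1" "F b * poly s b = poly p b" for b
    proof -
      have "(b - b1) * (F b * poly s' b) = (b - b1) * poly p' b"
        using that(2) by (simp add: p' s' algebra_simps)
      thus ?thesis using that(1) by simp
    qed
    hence "{b. F b * poly s' b \<noteq> poly p' b} \<subseteq> insert b1 {b. F b * poly s b \<noteq> poly p b}"
      by blast
    hence "good (s', p')"
      using s0 fin finite_subset by (auto simp: good_def s')
    from x(2)[OF this] have "degree s \<le> degree s'" by (simp add: sp)
    moreover have "degree s = Suc (degree s')"
      using s0 unfolding s' by (subst degree_mult_eq) auto
    ultimately show False by simp
  qed
  then obtain c where c: "s = [:c:]" by (meson degree_eq_zeroE)
  have "F b = poly (smult (1 / c) p) b" for b
  proof -
    obtain p1 s1 where 1: "poly s1 b \<noteq> 0"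
      "\<forall>b. poly s1 b \<noteq> 0 \<longrightarrow> F b * poly s1 b = poly p1 b" using loc' by blast
    have "poly p b * poly s1 b = F b * poly s1 b * c"
      using arg_cong[OF cross[OF 1], of "\<lambda>q. poly q b"] 1 by (simp add: c)
    thus ?thesis using 1(1) s0 by (simp add: c field_simps)
  qed
  thus ?thesis unfolding upoly_def by blast
qed

definition udeg :: "nat \<Rightarrow> ('k :: field \<Rightarrow> 'k) \<Rightarrow> bool" where
  "udeg D g \<longleftrightarrow> (\<exists>p. degree p \<le> D \<and> (\<forall>b. g b = poly p b))"

text \<open>\<open>G\<close> is the function in the chart at infinity of the projective line: its
  regularity at 0 bounds the pole of \<open>F\<close>, hence the degree.\<close>

lemma udeg_reflect:
  fixes F G :: "'k :: alg_closed_field \<Rightarrow> 'k"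
  assumes "upoly F" "upoly G" "\<And>b. b \<noteq> 0 \<Longrightarrow> F b = b ^ D * G (1 / b)"
  shows "udeg D F"
proof -
  obtain p p' where p: "\<And>b. F b = poly p b" and p': "\<And>b. G b = poly p' b"
    using assms(1,2) by (auto simp: upoly_def)
  have "monom 1 (degree p') * p = monom 1 D * reflect_poly p'"
  proof (rule poly_eq_cofinite[of "{0}"])
    fix b :: 'k assume "b \<notin> {0}"
    hence b: "b \<noteq> 0" by simp
    have "poly p b = b ^ D * poly p' (inverse b)"
      using assms(3)[OF b] p p' by (simp add: divide_inverse)
    thus "poly (monom 1 (degree p') * p) b = poly (monom 1 D * reflect_poly p') b"
      using b by (simp add: poly_monom poly_reflect_poly_nz)
  qed simp
  hence eq: "degree (monom 1 (degree p') * p) = degree (monom 1 D * reflect_poly p')" by simp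
  have "degree p \<le> D"
  proof (cases "p = 0")
    case False
    have "degree (monom (1::'k) (degree p') * p) = degree p' + degree p"
      using False by (subst degree_mult_eq) (auto simp: degree_monom_eq monom_eq_0_iff)
    moreover have "degree (monom 1 D * reflect_poly p') \<le> D + degree p'"
      using degree_mult_le[of "monom 1 D" "reflect_poly p'"] degree_reflect_poly_le[of p']
      by (simp add: degree_monom_eq)
    ultimately show ?thesis using eq by linarith
  qed simp
  thus ?thesis using p by (auto simp: udeg_def)
qed

lemma udeg_interpolate:
  assumes "udeg D (g :: 'k :: field \<Rightarrow> 'k)" "finite G" "card G = Suc D"
  shows "g x = (\<Sum>a\<in>G. g a * (\<Prod>c\<in>G - {a}. (x - c) / (a - c)))"
proof -
  obtain p where p: "degree p \<le> D" "\<And>b. g b = poly p b" using assms(1) by (auto simp: udeg_def)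
  define L where "L = (\<lambda>a. \<Prod>c\<in>G - {a}. smult (1 / (a - c)) [:- c, 1:])"
  define q where "q = (\<Sum>a\<in>G. smult (g a) (L a))"
  have L: "poly (L a) y = (\<Prod>c\<in>G - {a}. (y - c) / (a - c))" for a y
    by (simp add: L_def poly_prod diff_divide_distrib)
  have "degree (L a) \<le> D" if "a \<in> G" for a
  proof -
    have "degree (L a) \<le> (\<Sum>c\<in>G - {a}. degree (smult (1 / (a - c)) [:- c, 1:]))"
      unfolding L_def using assms(2) by (intro degree_prod_sum_le[THEN order_trans]) auto
    also have "\<dots> \<le> (\<Sum>c\<in>G - {a}. 1)" by (intro sum_mono) auto
    also have "\<dots> = D" using assms that by simp
    finally show ?thesis .
  qed
  hence dq: "degree q \<le> D"
    unfolding q_def by (intro degree_sum_le) (auto simp: assms intro: order_trans[OF degree_smult_le])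
  have "p = q"
  proof (rule poly_eqI_degree)
    fix y assume y: "y \<in> G"
    have "poly q y = (\<Sum>a\<in>G. g a * (\<Prod>c\<in>G - {a}. (y - c) / (a - c)))"
      by (simp add: q_def poly_sum L)
    also have "\<dots> = (\<Sum>a\<in>G. if a = y then g y else 0)"
    proof (rule sum.cong)
      fix a assume a: "a \<in> G"
      show "g a * (\<Prod>c\<in>G - {a}. (y - c) / (a - c)) = (if a = y then g y else 0)"
      proof (cases "a = y")
        case True
        have "(\<Prod>c\<in>G - {a}. (y - c) / (a - c)) = 1"
          by (rule prod.neutral) (auto simp: True)
        thus ?thesis using True by simp
      next
        case False
        hence "(\<Prod>c\<in>G - {a}. (y - c) / (a - c)) = 0"
          using y assms(2) by (intro prod_zero) (auto intro!: bexI[of _ y])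
        thus ?thesis using False by simp
      qed
    qed simp
    also have "\<dots> = g y" using y assms(2) by simp
    finally show "poly p y = poly q y" using p(2) by simp
  qed (use p(1) dq assms(3) in auto)
  hence "g x = poly q x" using p(2) by simp
  thus ?thesis by (simp add: q_def poly_sum L)
qed

text \<open>Lagrange interpolation in the last coordinate with \<open>D + 1\<close> nodes reduces to
  functions of fewer coordinates. The common degree bound is essential: over a countable field,
  polynomiality in each coordinate separately does not suffice.\<close>

lemma polyfuns_of_separate:
  fixes h :: "(nat \<Rightarrow> 'k :: alg_closed_field) \<Rightarrow> 'k"
  assumes "\<And>v v'. (\<And>k. k \<in> {a..<m} \<Longrightarrow> v k = v' k) \<Longrightarrow> h v = h v'"
    and "\<And>v k. k \<in> {a..<m} \<Longrightarrow> udeg D (\<lambda>b. h (v(k := b)))"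
  shows "h \<in> polyfuns"
  using assms
proof (induction m arbitrary: h)
  case 0
  have "h = (\<lambda>v. h (\<lambda>_. 0))" by (intro ext 0) auto
  thus ?case using polyfuns.const[of "h (\<lambda>_. 0)"] by simp
next
  case (Suc m)
  show ?case
  proof (cases "a \<le> m")
    case False
    hence "{a..<Suc m} = {}" by auto
    hence "h = (\<lambda>v. h (\<lambda>_. 0))" by (intro ext Suc.prems(1)) auto
    thus ?thesis using polyfuns.const[of "h (\<lambda>_. 0)"] by simp
  next
    case True
    obtain G :: "'k set" where G: "finite G" "card G = Suc D"
      using infinite_arbitrarily_large[OF infinite_alg_closed[where 'k = 'k]] by blast
    have eq: "h = (\<lambda>v. \<Sum>g\<in>G. h (v(m := g)) * (\<Prod>c\<in>G - {g}. (v m - c) * (1 / (g - c))))"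
    proof
      fix v :: "nat \<Rightarrow> 'k"
      have "h v = h (v(m := v m))" by simp
      also have "\<dots> = (\<Sum>g\<in>G. h (v(m := g)) * (\<Prod>c\<in>G - {g}. (v m - c) / (g - c)))"
        by (rule udeg_interpolate[OF Suc.prems(2)]) (use True G in auto)
      finally show "h v = (\<Sum>g\<in>G. h (v(m := g)) * (\<Prod>c\<in>G - {g}. (v m - c) * (1 / (g - c))))"
        by simp
    qed
    have "(\<lambda>v. h (v(m := g))) \<in> polyfuns" for g
    proof (rule Suc.IH)
      fix v v' :: "nat \<Rightarrow> 'k" assume "\<And>k. k \<in> {a..<m} \<Longrightarrow> v k = v' k"
      thus "h (v(m := g)) = h (v'(m := g))" by (intro Suc.prems(1)) auto
    next
      fix v :: "nat \<Rightarrow> 'k" and k assume k: "k \<in> {a..<m}"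
      hence eq: "(\<lambda>b. h ((v(k := b))(m := g))) = (\<lambda>b. h ((v(m := g))(k := b)))"
        by (intro ext arg_cong[of _ _ h]) (auto simp: fun_eq_iff)
      show "udeg D (\<lambda>b. h ((v(k := b))(m := g)))"
        unfolding eq by (rule Suc.prems(2)) (use k in auto)
    qed
    thus ?thesis
      by (subst eq) (intro polyfuns_sum polyfuns.mult polyfuns_prod polyfuns_diff
          polyfuns.coord polyfuns.const)
  qed
qed

lemma polyfuns_dehomogenize:
  assumes "g \<in> polyfuns"
  shows "\<exists>N. \<exists>G\<in>polyfuns. \<forall>v. v a \<noteq> 0 \<longrightarrow> v a ^ N * g (\<lambda>k. v k / v a) = G v"
  using assms
proof (induction rule: polyfuns.induct)
  case (const c)
  show ?case by (intro exI[of _ 0] bexI[of _ "\<lambda>v. c"]) (auto intro: polyfuns.intros)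
next
  case (coord k)
  show ?case by (intro exI[of _ 1] bexI[of _ "\<lambda>v. v k"]) (auto intro: polyfuns.intros)
next
  case (add f g)
  then obtain N F N' G where *: "F \<in> polyfuns" "G \<in> polyfuns"
    "\<And>v. v a \<noteq> 0 \<Longrightarrow> v a ^ N * f (\<lambda>k. v k / v a) = F v"
    "\<And>v. v a \<noteq> 0 \<Longrightarrow> v a ^ N' * g (\<lambda>k. v k / v a) = G v" by blast
  have "v a ^ (N + N') * (f (\<lambda>k. v k / v a) + g (\<lambda>k. v k / v a)) = v a ^ N' * F v + v a ^ N * G v"
    if "v a \<noteq> 0" for v
    using *(3)[of v, OF that, symmetric] *(4)[of v, OF that, symmetric] by (simp add: algebra_simps power_add)
  moreover have "(\<lambda>v. v a ^ N' * F v + v a ^ N * G v) \<in> polyfuns"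
    by (intro polyfuns.intros polyfuns_power *)
  ultimately show ?case
    by (intro exI[of _ "N + N'"] bexI[of _ "\<lambda>v. v a ^ N' * F v + v a ^ N * G v"] allI impI)
next
  case (mult f g)
  then obtain N F N' G where *: "F \<in> polyfuns" "G \<in> polyfuns"
    "\<And>v. v a \<noteq> 0 \<Longrightarrow> v a ^ N * f (\<lambda>k. v k / v a) = F v"
    "\<And>v. v a \<noteq> 0 \<Longrightarrow> v a ^ N' * g (\<lambda>k. v k / v a) = G v" by blast
  have "v a ^ (N + N') * (f (\<lambda>k. v k / v a) * g (\<lambda>k. v k / v a)) = F v * G v"
    if "v a \<noteq> 0" for v
    using *(3)[of v, OF that, symmetric] *(4)[of v, OF that, symmetric] by (simp add: algebra_simps power_add)
  moreover have "(\<lambda>v. F v * G v) \<in> polyfuns" by (intro polyfuns.intros *)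
  ultimately show ?case
    by (intro exI[of _ "N + N'"] bexI[of _ "\<lambda>v. F v * G v"] allI impI)
qed

text \<open>A Hartogs argument. Regularity where \<open>v c\<close> is nonzero makes the numerator
  vanish on a dense part of the hyperplane \<open>v a = 0\<close>, hence on all of it, and one
  factor \<open>v a\<close> cancels at a time.\<close>

lemma polyfuns_cancel_power:
  fixes h :: "(nat \<Rightarrow> 'k :: alg_closed_field) \<Rightarrow> 'k"
  assumes "G \<in> polyfuns" "\<And>v. v a \<noteq> 0 \<Longrightarrow> v a ^ N * h v = G v"
    and reg: "\<And>v. v c \<noteq> 0 \<Longrightarrow> upoly (\<lambda>b. h (v(a := b)))" and "c \<noteq> a"
  shows "\<exists>h'\<in>polyfuns. \<forall>v. v a \<noteq> 0 \<longrightarrow> h v = h' v"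
  using assms(1,2)
proof (induction N arbitrary: G)
  case 0
  thus ?case by (intro bexI[of _ G]) auto
next
  case (Suc N)
  have G0: "G (v(a := 0)) = 0" for v
  proof (rule polyfuns_eqI[of "\<lambda>v. G (v(a := 0))" "\<lambda>v. 0" c])
    fix v :: "nat \<Rightarrow> 'k" assume v: "v c \<noteq> 0"
    have u1: "upoly (\<lambda>b. G (v(a := b)))"
    proof (rule upoly_polyfun[OF Suc.prems(1)])
      fix k show "upoly (\<lambda>b. (v(a := b)) k)" by (cases "k = a") auto
    qed
    have u2: "upoly (\<lambda>b. b ^ Suc N * h (v(a := b)))"
      by (intro upoly_mult upoly_power upoly_id reg v)
    have eqb: "G (v(a := b)) = b ^ Suc N * h (v(a := b))" if "b \<notin> {0}" for b
      using Suc.prems(2)[of "v(a := b)", unfolded fun_upd_same, symmetric] that by blast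
    have "G (v(a := 0)) = 0 ^ Suc N * h (v(a := 0))"
      by (rule upoly_eqI[OF u1 u2 _ eqb, of "{0}"]) auto
    thus "G (v(a := 0)) = 0" by simp
  qed (auto intro: polyfuns.const polyfuns_upd Suc.prems)
  obtain G' where G': "G' \<in> polyfuns" "\<forall>v. G v = G (v(a := 0)) + v a * G' v"
    using polyfuns_split[OF Suc.prems(1)] by blast
  have "v a ^ N * h v = G' v" if "v a \<noteq> 0" for v
  proof -
    have "v a * (v a ^ N * h v) = v a * G' v"
      using Suc.prems(2)[of v, OF that] G'(2)[rule_format, of v] G0[of v] by (simp add: mult.assoc)
    thus ?thesis using that by simp
  qed
  thus ?case by (rule Suc.IH[OF G'(1)])
qed

section \<open>Sections on projective closures\<close>

definition mon_eval :: "('x \<Rightarrow>\<^sub>0 nat) \<Rightarrow> ('x \<Rightarrow> 'k :: field) \<Rightarrow> 'k" where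
  "mon_eval m v = (\<Prod>x\<in>Poly_Mapping.keys m. v x ^ Poly_Mapping.lookup m x)"

lemma mon_eval_superset:
  "finite A \<Longrightarrow> Poly_Mapping.keys m \<subseteq> A \<Longrightarrow> mon_eval m v = (\<Prod>x\<in>A. v x ^ Poly_Mapping.lookup m x)"
  unfolding mon_eval_def by (rule prod.mono_neutral_left) (auto simp: in_keys_iff)

lemma mon_eval_add: "mon_eval (m + m') v = mon_eval m v * mon_eval m' v"
proof -
  let ?A = "Poly_Mapping.keys m \<union> Poly_Mapping.keys m'"
  have "Poly_Mapping.keys (m + m') \<subseteq> ?A" by (rule keys_add)
  thus ?thesis
    by (simp add: mon_eval_superset[of ?A] lookup_add power_add prod.distrib)
qed

lemma poly_eval_superset:
  "finite A \<Longrightarrow> Poly_Mapping.keys P \<subseteq> A \<Longrightarrow>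
     poly_eval P v = (\<Sum>m\<in>A. Poly_Mapping.lookup P m * mon_eval m v)"
  unfolding poly_eval_def mon_eval_def by (rule sum.mono_neutral_left) (auto simp: in_keys_iff)

lemma poly_eval_add: "poly_eval (P + Q) v = poly_eval P v + poly_eval Q v"
proof -
  let ?A = "Poly_Mapping.keys P \<union> Poly_Mapping.keys Q"
  have "Poly_Mapping.keys (P + Q) \<subseteq> ?A" by (rule keys_add)
  thus ?thesis
    by (simp add: poly_eval_superset[of ?A] lookup_add algebra_simps sum.distrib)
qed

lemma poly_eval_zero [simp]: "poly_eval 0 v = 0"
  by (simp add: poly_eval_def)

lemma poly_eval_sum: "poly_eval (\<Sum>x\<in>A. P x) v = (\<Sum>x\<in>A. poly_eval (P x) v)"
  by (induction A rule: infinite_finite_induct) (auto simp: poly_eval_add)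

lemma poly_eval_single: "poly_eval (Poly_Mapping.single m c) v = c * mon_eval m v"
  using poly_eval_superset[of "{m}" "Poly_Mapping.single m c" v] by simp

lemma sum_single_lookup: "(\<Sum>m\<in>Poly_Mapping.keys P. Poly_Mapping.single m (Poly_Mapping.lookup P m)) = P"
  by (rule poly_mapping_eqI) (auto simp: lookup_sum lookup_single when_def in_keys_iff)

lemma poly_eval_mult: "poly_eval (P * Q) v = poly_eval P v * poly_eval Q v"
proof -
  have "P * Q = (\<Sum>m\<in>Poly_Mapping.keys P. \<Sum>m'\<in>Poly_Mapping.keys Q.
      Poly_Mapping.single (m + m') (Poly_Mapping.lookup P m * Poly_Mapping.lookup Q m'))"
  proof -
    have "P * Q = (\<Sum>m\<in>Poly_Mapping.keys P. Poly_Mapping.single m (Poly_Mapping.lookup P m)) *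
        (\<Sum>m\<in>Poly_Mapping.keys Q. Poly_Mapping.single m (Poly_Mapping.lookup Q m))"
      by (simp only: sum_single_lookup)
    thus ?thesis by (simp only: sum_product mult_single)
  qed
  also have "poly_eval \<dots> v = (\<Sum>m\<in>Poly_Mapping.keys P. Poly_Mapping.lookup P m * mon_eval m v) *
      (\<Sum>m\<in>Poly_Mapping.keys Q. Poly_Mapping.lookup Q m * mon_eval m v)"
    by (simp add: poly_eval_sum poly_eval_single mon_eval_add sum_product algebra_simps)
  also have "\<dots> = poly_eval P v * poly_eval Q v"
    by (simp only: poly_eval_superset[OF finite_keys order_refl])
  finally show ?thesis .
qed

lemma upoly_poly_eval: "(\<And>x. upoly (\<lambda>b. c b x)) \<Longrightarrow> upoly (\<lambda>b. poly_eval P (c b))"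
  unfolding poly_eval_def by (intro upoly_sum upoly_mult upoly_prod upoly_power upoly_const)

definition mon_deg :: "('x \<Rightarrow>\<^sub>0 nat) \<Rightarrow> nat" where
  "mon_deg m = (\<Sum>x\<in>Poly_Mapping.keys m. Poly_Mapping.lookup m x)"

lemma mon_deg_add: "mon_deg (m + m') = mon_deg m + mon_deg m'"
proof -
  let ?A = "Poly_Mapping.keys m \<union> Poly_Mapping.keys m'"
  have *: "mon_deg p = (\<Sum>x\<in>?A. Poly_Mapping.lookup p x)" if "Poly_Mapping.keys p \<subseteq> ?A" for p
    unfolding mon_deg_def using that by (intro sum.mono_neutral_left) (auto simp: in_keys_iff)
  have "Poly_Mapping.keys (m + m') \<subseteq> ?A" by (rule keys_add)
  thus ?thesis by (simp add: * lookup_add sum.distrib)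
qed

lemma homogeneous_iff:
  "P \<in> homogeneous J d \<longleftrightarrow>
     (\<forall>m\<in>Poly_Mapping.keys P. Poly_Mapping.keys m \<subseteq> J \<and> mon_deg m = d)"
  by (auto simp: homogeneous_def mon_deg_def)

lemma homogeneous_add: "P \<in> homogeneous J d \<Longrightarrow> Q \<in> homogeneous J d \<Longrightarrow> P + Q \<in> homogeneous J d"
  unfolding homogeneous_iff using keys_add[of P Q] by blast

lemma homogeneous_mult:
  assumes "P \<in> homogeneous J d" "Q \<in> homogeneous J e"
  shows "P * Q \<in> homogeneous J (d + e)"
  unfolding homogeneous_iff
proof
  fix m assume "m \<in> Poly_Mapping.keys (P * Q)"
  then obtain a b where ab: "m = a + b" "a \<in> Poly_Mapping.keys P" "b \<in> Poly_Mapping.keys Q"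
    using keys_mult[of P Q] by blast
  moreover have "Poly_Mapping.keys m \<subseteq> Poly_Mapping.keys a \<union> Poly_Mapping.keys b"
    unfolding ab by (rule keys_add)
  ultimately show "Poly_Mapping.keys m \<subseteq> J \<and> mon_deg m = d + e"
    using assms by (auto simp: homogeneous_iff mon_deg_add)
qed

lemma homogeneous_const: "Poly_Mapping.single 0 c \<in> homogeneous J 0"
  by (auto simp: homogeneous_iff mon_deg_def)

lemma homogeneous_var: "x \<in> J \<Longrightarrow> Poly_Mapping.single (Poly_Mapping.single x 1) 1 \<in> homogeneous J 1"
  by (auto simp: homogeneous_iff mon_deg_def)

lemma poly_eval_const [simp]: "poly_eval (Poly_Mapping.single 0 c) v = c"
  by (simp add: poly_eval_single mon_eval_def)

lemma poly_eval_var [simp]: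
  "poly_eval (Poly_Mapping.single (Poly_Mapping.single x (Suc 0)) 1) v = v x"
  by (simp add: poly_eval_single mon_eval_def)

lemma poly_eval_homogeneous:
  assumes "P \<in> homogeneous J d"
  shows "poly_eval P (\<lambda>x. c * v x) = c ^ d * poly_eval P v"
proof -
  have "mon_eval m (\<lambda>x. c * v x) = c ^ mon_deg m * mon_eval m v" for m :: "'a \<Rightarrow>\<^sub>0 nat"
    by (simp add: mon_eval_def mon_deg_def power_mult_distrib prod.distrib power_sum)
  moreover have "mon_deg m = d" if "m \<in> Poly_Mapping.keys P" for m
    using assms that by (auto simp: homogeneous_iff)
  ultimately show ?thesis
    unfolding poly_eval_superset[OF finite_keys order_refl]
    by (simp add: sum_distrib_left algebra_simps)
qed

section \<open>Echelon bases, Pluecker vectors and Zariski closure\<close>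

lemma sum_apply_fun: "(\<Sum>x\<in>A. f x) k = (\<Sum>x\<in>A. f x k)"
  by (induction A rule: infinite_finite_induct) auto

text \<open>At the least pivot among the vectors with a nonzero coefficient, only one term of a
  linear relation survives.\<close>

lemma independent_pivots:
  fixes bs :: "(nat \<Rightarrow> 'k :: field) list"
  assumes inj: "inj_on piv {..<length bs}"
    and nz: "\<And>i. i < length bs \<Longrightarrow> (bs ! i) (piv i) \<noteq> 0"
    and z: "\<And>i k. i < length bs \<Longrightarrow> k < piv i \<Longrightarrow> (bs ! i) k = 0"
  shows "distinct bs \<and> fun_space.independent (set bs)"
proof
  show "distinct bs"
    unfolding distinct_conv_nth
  proof (intro allI impI)
    fix i j assume ij: "i < length bs" "j < length bs" "i \<noteq> j"
    hence "piv i \<noteq> piv j" using inj by (auto simp: inj_on_def)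
    thus "bs ! i \<noteq> bs ! j"
      using nz[OF ij(1)] nz[OF ij(2)] z[OF ij(1), of "piv j"] z[OF ij(2), of "piv i"]
      by (metis linorder_neqE_nat)
  qed
  show "fun_space.independent (set bs)"
  proof (rule fun_space.independent_if_scalars_zero)
    fix f :: "(nat \<Rightarrow> 'k) \<Rightarrow> 'k" and x
    assume sum: "(\<Sum>x\<in>set bs. (\<lambda>k. f x * x k)) = 0" and x: "x \<in> set bs"
    show "f x = 0"
    proof (rule ccontr)
      assume "f x \<noteq> 0"
      then obtain i0 where "i0 < length bs \<and> f (bs ! i0) \<noteq> 0" using x by (metis in_set_conv_nth)
      then obtain i where i: "i < length bs" "f (bs ! i) \<noteq> 0"
        and min: "\<And>j. j < length bs \<Longrightarrow> f (bs ! j) \<noteq> 0 \<Longrightarrow> piv i \<le> piv j"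
        using ex_has_least_nat[of "\<lambda>i. i < length bs \<and> f (bs ! i) \<noteq> 0" i0 piv] by auto
      have "f y * y (piv i) = 0" if y: "y \<in> set bs" "y \<noteq> bs ! i" for y
      proof -
        obtain j where j: "j < length bs" "y = bs ! j" using y by (metis in_set_conv_nth)
        hence "piv i \<noteq> piv j" using inj i(1) y(2) by (auto simp: inj_on_def)
        thus ?thesis using min[OF j(1)] z[OF j(1), of "piv i"] j(2) by fastforce
      qed
      hence "(\<Sum>y\<in>set bs. f y * y (piv i)) = f (bs ! i) * (bs ! i) (piv i)"
        using i(1) by (subst sum.remove[of _ "bs ! i"]) (auto intro!: sum.neutral simp del: mult_eq_0_iff)
      moreover have "(\<Sum>y\<in>set bs. f y * y (piv i)) = 0"
        using fun_cong[OF sum, of "piv i"] by (simp add: sum_apply_fun)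
      ultimately show False using i nz by auto
    qed
  qed simp
qed

lemma span_list:
  fixes bs :: "(nat \<Rightarrow> 'k :: field) list"
  assumes "v \<in> fun_space.span (set bs)"
  shows "\<exists>a. v = (\<lambda>k. \<Sum>i<length bs. a i * (bs ! i) k)"
proof -
  let ?S = "{v. \<exists>a. v = (\<lambda>k. \<Sum>i<length bs. a i * (bs ! i) k)}"
  have "fun_space.span (set bs) \<subseteq> ?S"
  proof (rule fun_space.span_minimal)
    show "set bs \<subseteq> ?S"
    proof
      fix x assume "x \<in> set bs"
      then obtain j where "j < length bs" "x = bs ! j" by (metis in_set_conv_nth)
      hence "x = (\<lambda>k. \<Sum>i<length bs. (if i = j then 1 else 0) * (bs ! i) k)"
        by (auto simp: fun_eq_iff if_distrib[of "\<lambda>c. c * _"] cong: if_cong)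
      thus "x \<in> ?S" by (intro CollectI exI[of _ "\<lambda>i. if i = j then 1 else 0"])
    qed
    show "fun_space.subspace ?S"
    proof (rule fun_space.subspaceI)
      show "0 \<in> ?S" by (auto simp: fun_eq_iff intro!: exI[of _ "\<lambda>_. 0"])
    next
      fix x y assume "x \<in> ?S" "y \<in> ?S"
      then obtain a b where "x = (\<lambda>k. \<Sum>i<length bs. a i * (bs ! i) k)"
        "y = (\<lambda>k. \<Sum>i<length bs. b i * (bs ! i) k)" by blast
      hence "x + y = (\<lambda>k. \<Sum>i<length bs. (a i + b i) * (bs ! i) k)"
        by (simp add: fun_eq_iff sum.distrib distrib_right)
      thus "x + y \<in> ?S" by (intro CollectI exI[of _ "\<lambda>i. a i + b i"])
    next
      fix c x assume "x \<in> ?S"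
      then obtain a where "x = (\<lambda>k. \<Sum>i<length bs. a i * (bs ! i) k)" by blast
      hence "(\<lambda>k. c * x k) = (\<lambda>k. \<Sum>i<length bs. (c * a i) * (bs ! i) k)"
        by (simp add: fun_eq_iff sum_distrib_left mult.assoc)
      thus "(\<lambda>k. c * x k) \<in> ?S" by (intro CollectI exI[of _ "\<lambda>i. c * a i"])
    qed
  qed
  thus ?thesis using assms by blast
qed

lemma homogeneous_one [simp]: "1 \<in> homogeneous J 0"
  using homogeneous_const[of 1 J] by simp

lemma poly_eval_one [simp]: "poly_eval 1 v = 1"
  using poly_eval_const[of 1 v] by simp

lemma upoly_pluecker:
  assumes "\<And>c k. c < r \<Longrightarrow> upoly (\<lambda>b. (bs b ! c) k)"
  shows "upoly (\<lambda>b. pluecker n r (bs b) S)"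
proof (cases "S \<in> tuples n r")
  case True
  have "det (mat r r (\<lambda>(i, j). (bs b ! j) (S ! i))) =
      (\<Sum>p\<in>{p. p permutes {0..<r}}. signof p * (\<Prod>i = 0..<r. (bs b ! p i) (S ! i)))" for b
    by (subst det_def'[of _ r]) (auto intro!: sum.cong prod.cong simp: permutes_in_image)
  moreover have "upoly (\<lambda>b. \<Sum>p\<in>{p. p permutes {0..<r}}. signof p * (\<Prod>i = 0..<r. (bs b ! p i) (S ! i)))"
  proof (intro upoly_sum upoly_mult upoly_const upoly_prod assms)
    fix p i assume "p \<in> {p. p permutes {0..<r}}" "i \<in> {0..<r}"
    thus "p i < r" using permutes_in_image[of p "{0..<r}" i] by simp
  qed
  ultimately show ?thesis using True by (simp add: pluecker_def)
qed (simp add: pluecker_def)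

lemma pluecker_change:
  assumes C: "C \<in> carrier_mat r r"
    and bs': "\<And>b k. b < r \<Longrightarrow> (bs' ! b) k = (\<Sum>c<r. (bs ! c) k * C $$ (c, b))"
  shows "pluecker n r bs' S = det C * pluecker n r bs S"
proof (cases "S \<in> tuples n r")
  case True
  let ?M = "\<lambda>bs. mat r r (\<lambda>(i, j). (bs ! j) (S ! i))"
  have "?M bs' = ?M bs * C"
    using C by (intro eq_matI) (auto simp: bs' scalar_prod_def lessThan_atLeast0)
  hence "det (?M bs') = det (?M bs) * det C"
    using det_mult[of "?M bs" r C] C by simp
  thus ?thesis using True by (simp add: pluecker_def)
qed (simp add: pluecker_def)

lemma is_basis_of_length:
  "is_basis_of bs W \<Longrightarrow> length bs = fun_space.dim W"
  by (auto simp: is_basis_of_def fun_space.dim_span fun_space.dim_eq_card_independent distinct_card)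

lemma pluecker_same_span:
  fixes bs bs' :: "(nat \<Rightarrow> 'k :: field) list"
  assumes "is_basis_of bs W" "is_basis_of bs' W" "length bs = r"
  shows "\<exists>c. pluecker n r bs' = (\<lambda>S. c * pluecker n r bs S)"
proof -
  have "\<exists>a. \<forall>b<r. bs' ! b = (\<lambda>k. \<Sum>i<r. a b i * (bs ! i) k)"
  proof -
    have "\<exists>a. bs' ! b = (\<lambda>k. \<Sum>i<r. a i * (bs ! i) k)" if "b < r" for b
    proof -
      have "length bs' = r" using assms is_basis_of_length by metis
      hence "bs' ! b \<in> set bs'" using that by simp
      also have "set bs' \<subseteq> fun_space.span (set bs)"
        using assms(1,2) fun_space.span_superset[of "set bs'"] by (simp add: is_basis_of_def)
      finally show ?thesis using span_list assms(3) by blast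
    qed
    thus ?thesis by metis
  qed
  then obtain a where a: "\<And>b. b < r \<Longrightarrow> bs' ! b = (\<lambda>k. \<Sum>i<r. a b i * (bs ! i) k)" by blast
  have "pluecker n r bs' S = det (mat r r (\<lambda>(i, b). a b i)) * pluecker n r bs S" for S
    by (rule pluecker_change) (auto simp: a mult.commute)
  thus ?thesis by blast
qed

lemma subspace_V_space: "fun_space.subspace (V_space n r)"
  by (rule fun_space.subspaceI) (auto simp: V_space_def)

lemma Grassmannian_span:
  assumes "distinct bs" "fun_space.independent (set bs)" "length bs = r" "set bs \<subseteq> V_space n r"
  shows "fun_space.span (set bs) \<in> Grassmannian n r"
  using assms fun_space.span_minimal[OF assms(4) subspace_V_space]
  by (auto simp: Grassmannian_def fun_space.subspace_span fun_space.dim_span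
      fun_space.dim_eq_card_independent distinct_card)

lemma pluecker_cone_Un: "pluecker_cone n r X = (\<Union>W\<in>X. pluecker_cone n r {W})"
  by (auto simp: pluecker_cone_def)

text \<open>Membership in the closure quantifies over all bases of a subspace; as these have
  proportional Pluecker vectors, homogeneity lets one basis decide.\<close>

lemma zariski_closureI:
  fixes bs :: "(nat \<Rightarrow> 'k :: field) list"
  assumes bs: "distinct bs" "fun_space.independent (set bs)" "length bs = r" "set bs \<subseteq> V_space n r"
    and P: "\<And>d P. P \<in> homogeneous (tuples n r) d \<Longrightarrow> (\<And>x. x \<in> pluecker_cone n r Y \<Longrightarrow> poly_eval P x = 0)
        \<Longrightarrow> poly_eval P (pluecker n r bs) = 0"
  shows "pluecker n r bs \<in> pluecker_cone n r (zariski_closure n r Y)"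
proof -
  let ?W = "fun_space.span (set bs)"
  have b: "is_basis_of bs ?W" using bs by (simp add: is_basis_of_def)
  have "?W \<in> zariski_closure n r Y"
    unfolding zariski_closure_def
  proof (intro CollectI conjI allI ballI impI)
    show "?W \<in> Grassmannian n r" using Grassmannian_span[OF bs] .
    fix d P x
    assume P1: "P \<in> homogeneous (tuples n r) d" "\<forall>x\<in>pluecker_cone n r Y. poly_eval P x = 0"
      and x: "x \<in> pluecker_cone n r {?W}"
    then obtain bs' where "is_basis_of bs' ?W" "x = pluecker n r bs'"
      by (auto simp: pluecker_cone_def)
    then obtain c where "x = (\<lambda>S. c * pluecker n r bs S)"
      using pluecker_same_span[OF b _ bs(3)] by blast
    thus "poly_eval P x = 0"
      using poly_eval_homogeneous[OF P1(1)] P[OF P1(1)] P1(2) by simp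
  qed
  thus ?thesis using b by (auto simp: pluecker_cone_def)
qed

lemma zariski_closure_vanish:
  assumes "P \<in> homogeneous (tuples n r) d" "\<And>x. x \<in> pluecker_cone n r Y \<Longrightarrow> poly_eval P x = 0"
    and "x \<in> pluecker_cone n r (zariski_closure n r Y)"
  shows "poly_eval P x = 0"
proof -
  obtain W where W: "W \<in> zariski_closure n r Y" "x \<in> pluecker_cone n r {W}"
    using assms(3) pluecker_cone_Un[of n r "zariski_closure n r Y"] by blast
  thus ?thesis using assms(1,2) unfolding zariski_closure_def by blast
qed

section \<open>Homogeneity, restriction to curves and vanishing of sections\<close>

lemma global_sectionE:
  assumes "f \<in> global_sections n r X" "x \<in> pluecker_cone n r X"
  obtains P d Q where "P \<in> homogeneous (tuples n r) (d + 1)" "Q \<in> homogeneous (tuples n r) d"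
    "poly_eval Q x \<noteq> 0"
    "\<And>y. y \<in> pluecker_cone n r X \<Longrightarrow> poly_eval Q y \<noteq> 0 \<Longrightarrow> f y = poly_eval P y / poly_eval Q y"
  using assms unfolding global_sections_def by blast

lemma section_homogeneous:
  assumes f: "f \<in> global_sections n r X"
    and x: "x \<in> pluecker_cone n r X" and y: "y \<in> pluecker_cone n r X" "y = (\<lambda>S. c * x S)"
  shows "f y = c * f x"
\<comment> \<open>The scalar is not known to be nonzero. If it is 0, the numerator vanishes at
  \<open>y\<close> because its degree \<open>d + 1\<close> is positive.\<close>
proof (cases "c = 0")
  case True
  obtain P d Q where PQ: "P \<in> homogeneous (tuples n r) (d + 1)" "Q \<in> homogeneous (tuples n r) d"
    "poly_eval Q y \<noteq> 0"
    "\<And>y. y \<in> pluecker_cone n r X \<Longrightarrow> poly_eval Q y \<noteq> 0 \<Longrightarrow> f y = poly_eval P y / poly_eval Q y"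
    by (rule global_sectionE[OF f y(1)]) (rule that)
  have "poly_eval P y = 0" unfolding y(2) poly_eval_homogeneous[OF PQ(1)] using True by simp
  thus ?thesis using PQ(4)[OF y(1) PQ(3)] True by simp
next
  case False
  obtain P d Q where PQ: "P \<in> homogeneous (tuples n r) (d + 1)" "Q \<in> homogeneous (tuples n r) d"
    "poly_eval Q x \<noteq> 0"
    "\<And>y. y \<in> pluecker_cone n r X \<Longrightarrow> poly_eval Q y \<noteq> 0 \<Longrightarrow> f y = poly_eval P y / poly_eval Q y"
    by (rule global_sectionE[OF f x]) (rule that)
  have Py: "poly_eval P y = c ^ (d + 1) * poly_eval P x" and Qy: "poly_eval Q y = c ^ d * poly_eval Q x"
    unfolding y(2) using poly_eval_homogeneous[OF PQ(1)] poly_eval_homogeneous[OF PQ(2)] by simp_all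
  hence "poly_eval Q y \<noteq> 0" using PQ(3) False by simp
  hence "f y = poly_eval P y / poly_eval Q y" by (rule PQ(4)[OF y(1)])
  moreover have "f x = poly_eval P x / poly_eval Q x" by (rule PQ(4)[OF x PQ(3)])
  ultimately show ?thesis using False by (simp add: Py Qy)
qed

text \<open>Local quotients pull back to local quotients on the affine line. The curve has to stay
  in the cone for every parameter; the later uses hinge on arranging this.\<close>

lemma upoly_section_curve:
  fixes g :: "'k :: alg_closed_field \<Rightarrow> nat list \<Rightarrow> 'k"
  assumes f: "f \<in> global_sections n r X"
    and g: "\<And>b. g b \<in> pluecker_cone n r X" "\<And>S. upoly (\<lambda>b. g b S)"
  shows "upoly (\<lambda>b. f (g b))"
proof (rule upoly_local_quotients)
  fix b0
  obtain P d Q where PQ: "P \<in> homogeneous (tuples n r) (d + 1)" "Q \<in> homogeneous (tuples n r) d"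
    "poly_eval Q (g b0) \<noteq> 0"
    "\<And>y. y \<in> pluecker_cone n r X \<Longrightarrow> poly_eval Q y \<noteq> 0 \<Longrightarrow> f y = poly_eval P y / poly_eval Q y"
    by (rule global_sectionE[OF f g(1)]) (rule that)
  show "\<exists>p s. upoly p \<and> upoly s \<and> s b0 \<noteq> 0 \<and> (\<forall>b. s b \<noteq> 0 \<longrightarrow> f (g b) = p b / s b)"
    by (intro exI[of _ "\<lambda>b. poly_eval P (g b)"] exI[of _ "\<lambda>b. poly_eval Q (g b)"] conjI
        allI impI upoly_poly_eval g(2) PQ(3) PQ(4)[OF g(1)])
qed

lemma subspace_global_sections: "fun_space.subspace (global_sections n r X)"
proof (rule fun_space.subspaceI)
  show "0 \<in> global_sections n r X"
    unfolding global_sections_def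
  proof (intro CollectI conjI ballI)
    fix x :: "nat list \<Rightarrow> 'a"
    have "0 \<in> homogeneous (tuples n r) d" for d by (simp add: homogeneous_def)
    thus "\<exists>d. \<exists>P\<in>homogeneous (tuples n r) (d + 1). \<exists>Q\<in>homogeneous (tuples n r) d.
        poly_eval Q x \<noteq> 0 \<and> (\<forall>y\<in>pluecker_cone n r X. poly_eval Q y \<noteq> 0 \<longrightarrow>
          0 y = poly_eval P y / poly_eval Q y)"
      by (intro exI[of _ 0] bexI[of _ 0] bexI[of _ 1]) simp_all
  qed simp
next
  fix f g assume f: "f \<in> global_sections n r X" and g: "g \<in> global_sections n r X"
  show "f + g \<in> global_sections n r X"
    unfolding global_sections_def
  proof (intro CollectI conjI ballI)
    show "\<forall>x. x \<notin> pluecker_cone n r X \<longrightarrow> (f + g) x = 0"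
      using f g by (simp add: global_sections_def)
    fix x assume x: "x \<in> pluecker_cone n r X"
    obtain P d Q where PQ: "P \<in> homogeneous (tuples n r) (d + 1)" "Q \<in> homogeneous (tuples n r) d"
      "poly_eval Q x \<noteq> 0"
      "\<And>y. y \<in> pluecker_cone n r X \<Longrightarrow> poly_eval Q y \<noteq> 0 \<Longrightarrow> f y = poly_eval P y / poly_eval Q y"
      by (rule global_sectionE[OF f x]) (rule that)
    obtain S e T where ST: "S \<in> homogeneous (tuples n r) (e + 1)" "T \<in> homogeneous (tuples n r) e"
      "poly_eval T x \<noteq> 0"
      "\<And>y. y \<in> pluecker_cone n r X \<Longrightarrow> poly_eval T y \<noteq> 0 \<Longrightarrow> g y = poly_eval S y / poly_eval T y"
      by (rule global_sectionE[OF g x]) (rule that)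
    have "P * T + S * Q \<in> homogeneous (tuples n r) (d + e + 1)"
      using homogeneous_mult[OF PQ(1) ST(2)] homogeneous_mult[OF ST(1) PQ(2)]
      by (intro homogeneous_add) (simp_all add: ac_simps)
    moreover have "Q * T \<in> homogeneous (tuples n r) (d + e)"
      by (rule homogeneous_mult[OF PQ(2) ST(2)])
    moreover have "poly_eval (Q * T) x \<noteq> 0" using PQ(3) ST(3) by (simp add: poly_eval_mult)
    moreover have "(f + g) y = poly_eval (P * T + S * Q) y / poly_eval (Q * T) y"
      if "y \<in> pluecker_cone n r X" "poly_eval (Q * T) y \<noteq> 0" for y
    proof -
      have nz: "poly_eval Q y \<noteq> 0" "poly_eval T y \<noteq> 0" using that(2) by (auto simp: poly_eval_mult)
      show ?thesis
        using PQ(4)[OF that(1) nz(1)] ST(4)[OF that(1) nz(2)] nz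
        by (simp add: poly_eval_mult poly_eval_add add_frac_eq)
    qed
    ultimately show "\<exists>d. \<exists>P\<in>homogeneous (tuples n r) (d + 1). \<exists>Q\<in>homogeneous (tuples n r) d.
        poly_eval Q x \<noteq> 0 \<and> (\<forall>y\<in>pluecker_cone n r X. poly_eval Q y \<noteq> 0 \<longrightarrow>
          (f + g) y = poly_eval P y / poly_eval Q y)"
      by (intro exI[of _ "d + e"] bexI[of _ "P * T + S * Q"] bexI[of _ "Q * T"]) auto
  qed
next
  fix c f assume f: "f \<in> global_sections n r X"
  show "(\<lambda>x. c * f x) \<in> global_sections n r X"
    unfolding global_sections_def
  proof (intro CollectI conjI ballI)
    show "\<forall>x. x \<notin> pluecker_cone n r X \<longrightarrow> c * f x = 0"
      using f by (simp add: global_sections_def)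
    fix x assume x: "x \<in> pluecker_cone n r X"
    obtain P d Q where PQ: "P \<in> homogeneous (tuples n r) (d + 1)" "Q \<in> homogeneous (tuples n r) d"
      "poly_eval Q x \<noteq> 0"
      "\<And>y. y \<in> pluecker_cone n r X \<Longrightarrow> poly_eval Q y \<noteq> 0 \<Longrightarrow> f y = poly_eval P y / poly_eval Q y"
      by (rule global_sectionE[OF f x]) (rule that)
    have "Poly_Mapping.single 0 c * P \<in> homogeneous (tuples n r) (d + 1)"
      using homogeneous_mult[OF homogeneous_const PQ(1)] by simp
    thus "\<exists>d. \<exists>P\<in>homogeneous (tuples n r) (d + 1). \<exists>Q\<in>homogeneous (tuples n r) d.
        poly_eval Q x \<noteq> 0 \<and> (\<forall>y\<in>pluecker_cone n r X. poly_eval Q y \<noteq> 0 \<longrightarrow>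
          c * f y = poly_eval P y / poly_eval Q y)"
      using PQ by (intro exI[of _ d] bexI[of _ "Poly_Mapping.single 0 c * P"] bexI[of _ Q])
        (auto simp: poly_eval_mult)
  qed
qed

lemma pluecker_section_global:
  assumes "S \<in> tuples n r"
  shows "pluecker_section n r X S \<in> global_sections n r X"
  unfolding global_sections_def
proof (intro CollectI conjI ballI)
  fix x assume "x \<in> pluecker_cone n r X"
  show "\<exists>d. \<exists>P\<in>homogeneous (tuples n r) (d + 1). \<exists>Q\<in>homogeneous (tuples n r) d.
        poly_eval Q x \<noteq> 0 \<and> (\<forall>y\<in>pluecker_cone n r X. poly_eval Q y \<noteq> 0 \<longrightarrow>
          pluecker_section n r X S y = poly_eval P y / poly_eval Q y)"
    by (rule exI[of _ 0], rule bexI[of _ "Poly_Mapping.single (Poly_Mapping.single S 1) 1"],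
        rule bexI[of _ 1]) (use homogeneous_var[OF assms] in \<open>auto simp: pluecker_section_def\<close>)
qed (simp add: pluecker_section_def)

text \<open>Only homogeneous polynomials can be carried over to the closure. Locally
  \<open>f = P / Q\<close>, and \<open>P * Q\<close> vanishes on the whole cone over
  \<open>Y\<close>, also where \<open>Q\<close> is zero.\<close>

lemma section_zero_on_closure:
  assumes f: "f \<in> global_sections n r (zariski_closure n r Y)"
    and Y: "pluecker_cone n r Y \<subseteq> pluecker_cone n r (zariski_closure n r Y)"
    and z: "\<And>x. x \<in> pluecker_cone n r Y \<Longrightarrow> f x = 0"
  shows "f = 0"
proof
  fix x
  show "f x = 0 x"
  proof (cases "x \<in> pluecker_cone n r (zariski_closure n r Y)")
    case False
    thus ?thesis using f by (simp add: global_sections_def)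
  next
    case True
    obtain P d Q where PQ: "P \<in> homogeneous (tuples n r) (d + 1)" "Q \<in> homogeneous (tuples n r) d"
      "poly_eval Q x \<noteq> 0"
      "\<And>y. y \<in> pluecker_cone n r (zariski_closure n r Y) \<Longrightarrow> poly_eval Q y \<noteq> 0 \<Longrightarrow>
         f y = poly_eval P y / poly_eval Q y"
      by (rule global_sectionE[OF f True]) (rule that)
    have "poly_eval (P * Q) x = 0"
    proof (rule zariski_closure_vanish[OF homogeneous_mult[OF PQ(1,2)] _ True])
      fix y assume "y \<in> pluecker_cone n r Y"
      thus "poly_eval (P * Q) y = 0" using z[of y] PQ(4)[of y] Y by (auto simp: poly_eval_mult)
    qed
    thus ?thesis using PQ(4)[OF True PQ(3)] PQ(3) by (simp add: poly_eval_mult)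
  qed
qed

section \<open>Families of cyclic subspaces\<close>

text \<open>
  For \<open>\<phi>\<^sub>i\<^sub>j\<close> the parameters are \<open>R = r + 1 - i\<close>, \<open>q = n + 1 - j\<close> and \<open>\<beta> = (i - 1)n + j - i\<close>; as
  \<open>\<phi>\<^sub>i\<^sub>n\<close> is also the first member of the next run, the case \<open>q = 1\<close> is needed only if \<open>R = 1\<close>.
\<close>

locale cyclic_family =
  fixes n r R q \<beta> :: nat
  assumes n: "n \<ge> 1" and R: "1 \<le> R" "R \<le> r" and q: "1 \<le> q" "q \<le> n"
    and rn: "\<beta> + ((R - 1) * n + q) + (r - R) = r * n"
    and qR: "q \<ge> 2 \<or> R = 1"
begin

text \<open>The truncation at \<open>\<beta> + M\<close> leaves to \<open>t ^ (R - 1) v\<close>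
  exactly the \<open>q\<close> coordinates of the leading block of \<open>v\<close>, and nothing to
  \<open>t ^ R v\<close>.\<close>

definition M :: nat where "M = (R - 1) * n + q"

text \<open>
  The vector \<open>t\<^sup>c v\<close>, where coordinate \<open>0\<close> of \<open>v\<close> belongs to \<open>e\<^sub>\<beta>\<^sub>+\<^sub>1\<close>, truncated to the basis vectors
  up to \<open>e\<^sub>\<beta>\<^sub>+\<^sub>M\<close>: the remaining ones belong to all subspaces of the family.
\<close>

definition U :: "nat \<Rightarrow> (nat \<Rightarrow> 'k :: field) \<Rightarrow> nat \<Rightarrow> 'k" where
  "U c v = (\<lambda>k. if \<beta> + c * n < k \<and> k \<le> \<beta> + M then v (k - \<beta> - c * n - 1) else 0)"

definition gens :: "(nat \<Rightarrow> nat \<Rightarrow> 'k :: field) \<Rightarrow> (nat \<Rightarrow> 'k) list" where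
  "gens u = map u [0..<R] @ map e_vec [\<beta> + M + 1..<r * n + 1]"

definition om :: "(nat \<Rightarrow> 'k :: field) \<Rightarrow> nat list \<Rightarrow> 'k" where
  "om v = pluecker n r (gens (\<lambda>c. U c v))"

definition cell :: "(nat \<Rightarrow> 'k :: field) set set" where
  "cell = {fun_space.span (set (gens (\<lambda>c. U c v))) | v. v 0 \<noteq> 0}"

abbreviation X :: "(nat \<Rightarrow> 'k :: field) set set" where
  "X \<equiv> zariski_closure n r cell"

lemma M_rn: "\<beta> + M + (r - R) = r * n"
  using rn by (simp add: M_def)

lemma length_gens [simp]: "length (gens u) = r"
  using M_rn R by (simp add: gens_def del: upt_Suc)

lemma nth_gens:
  "c < r \<Longrightarrow> gens u ! c = (if c < R then u c else e_vec (\<beta> + M + 1 + (c - R)))"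
proof -
  assume c: "c < r"
  show ?thesis
  proof (cases "c < R")
    case False
    have "\<beta> + M + 1 + (c - R) < r * n + 1" using M_rn c False by linarith
    thus ?thesis using False by (simp add: gens_def nth_append del: upt_Suc)
  qed (simp add: gens_def nth_append del: upt_Suc)
qed

text \<open>Stated for arbitrary \<open>u\<close> because the limits in
  \<open>section_vanishes\<close> are no longer given by translates of one vector.\<close>

lemma gens_basis:
  fixes u :: "nat \<Rightarrow> nat \<Rightarrow> 'k :: field"
  assumes "inj_on piv {..<R}"
    and "\<And>c. c < R \<Longrightarrow> piv c \<le> \<beta> + M"
    and "\<And>c. c < R \<Longrightarrow> u c (piv c) \<noteq> 0"
    and "\<And>c k. c < R \<Longrightarrow> k < piv c \<Longrightarrow> u c k = 0"
    and "\<And>c k. c < R \<Longrightarrow> k \<notin> {1..r * n} \<Longrightarrow> u c k = 0"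
  shows "distinct (gens u)" "fun_space.independent (set (gens u))" "set (gens u) \<subseteq> V_space n r"
proof -
  define piv' where "piv' = (\<lambda>c. if c < R then piv c else \<beta> + M + 1 + (c - R))"
  have "distinct (gens u) \<and> fun_space.independent (set (gens u))"
  proof (rule independent_pivots[where piv = piv'])
    show "inj_on piv' {..<length (gens u)}"
    proof (rule inj_onI)
      fix a b assume eq: "piv' a = piv' b"
      consider "a < R" "b < R" | "a < R" "\<not> b < R" | "\<not> a < R" "b < R" | "\<not> a < R" "\<not> b < R"
        by blast
      thus "a = b"
      proof cases
        case 1 thus ?thesis using assms(1) eq by (simp add: piv'_def inj_on_def)
      next
        case 2 thus ?thesis using assms(2)[of a] eq by (simp add: piv'_def)
      next
        case 3 thus ?thesis using assms(2)[of b] eq by (simp add: piv'_def)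
      next
        case 4 thus ?thesis using eq by (simp add: piv'_def)
      qed
    qed
  next
    fix i assume "i < length (gens u)"
    thus "(gens u ! i) (piv' i) \<noteq> 0"
      using assms(3)[of i] by (cases "i < R") (simp_all add: nth_gens piv'_def e_vec_def)
  next
    fix i k assume "i < length (gens u)" "k < piv' i"
    thus "(gens u ! i) k = 0"
      using assms(4)[of i k] by (cases "i < R") (simp_all add: nth_gens piv'_def e_vec_def)
  qed
  thus "distinct (gens u)" "fun_space.independent (set (gens u))" by auto
  show "set (gens u) \<subseteq> V_space n r"
  proof
    fix x assume "x \<in> set (gens u)"
    then obtain c where "c < r" "x = gens u ! c" by (metis in_set_conv_nth length_gens)
    thus "x \<in> V_space n r"
      using assms(5)[of c] M_rn by (auto simp: nth_gens V_space_def e_vec_def)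
  qed
qed

lemma U_support: "U c v k \<noteq> 0 \<Longrightarrow> k \<in> {1..r * n}"
  using M_rn by (auto simp: U_def split: if_splits)

lemma cn_le: "c < R \<Longrightarrow> c * n \<le> (R - 1) * n"
  by (intro mult_right_mono) auto

text \<open>The first nonzero coordinate of \<open>v\<close>, moved by \<open>c * n\<close>, is the
  pivot of \<open>U c v\<close>; lying in the leading block, it survives the truncation even for
  \<open>c = R - 1\<close>.\<close>

lemma gens_U_basis:
  assumes "t < q" "v t \<noteq> 0"
  shows "distinct (gens (\<lambda>c. U c v))" "fun_space.independent (set (gens (\<lambda>c. U c v)))"
    "set (gens (\<lambda>c. U c v)) \<subseteq> V_space n r"
proof -
  define t0 where "t0 = (LEAST t. v t \<noteq> 0)"
  have t0: "v t0 \<noteq> 0" "t0 < q"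
    using assms LeastI[of "\<lambda>t. v t \<noteq> 0" t] Least_le[of "\<lambda>t. v t \<noteq> 0" t] by (simp_all add: t0_def)
  have t0': "v k = 0" if "k < t0" for k
    using not_less_Least[of k "\<lambda>t. v t \<noteq> 0"] that by (simp add: t0_def)
  define piv where "piv = (\<lambda>c. \<beta> + c * n + t0 + 1)"
  have "inj_on piv {..<R}" using n by (auto simp: inj_on_def piv_def)
  moreover have "piv c \<le> \<beta> + M" if "c < R" for c
    unfolding piv_def M_def using cn_le[OF that] t0(2) by linarith
  moreover have "U c v (piv c) \<noteq> 0" if "c < R" for c
    using t0(1) calculation(2)[OF that] by (simp add: U_def piv_def)
  moreover have "U c v k = 0" if "c < R" "k < piv c" for c k
    using t0'[of "k - \<beta> - c * n - 1"] that(2) by (auto simp: U_def piv_def)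
  ultimately show "distinct (gens (\<lambda>c. U c v))" "fun_space.independent (set (gens (\<lambda>c. U c v)))"
    "set (gens (\<lambda>c. U c v)) \<subseteq> V_space n r"
    using gens_basis[of piv "\<lambda>c. U c v"] U_support by blast+
qed

lemma om_basis: "t < q \<Longrightarrow> v t \<noteq> 0 \<Longrightarrow>
    is_basis_of (gens (\<lambda>c. U c v)) (fun_space.span (set (gens (\<lambda>c. U c v))))"
  using gens_U_basis[of t v] by (simp add: is_basis_of_def)

lemma cell_subset: "cell \<subseteq> Grassmannian n r"
proof
  fix W assume "W \<in> cell"
  then obtain v where v: "v 0 \<noteq> 0" "W = fun_space.span (set (gens (\<lambda>c. U c v)))"
    by (auto simp: cell_def)
  have "0 < q" using q by simp
  from Grassmannian_span[OF gens_U_basis(1,2)[of 0 v, OF this v(1)] length_gens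
      gens_U_basis(3)[of 0 v, OF this v(1)]]
  show "W \<in> Grassmannian n r" using v(2) by simp
qed

lemma cone_cell_subset: "pluecker_cone n r cell \<subseteq> pluecker_cone n r X"
proof -
  have "cell \<subseteq> X"
    using cell_subset pluecker_cone_Un[of n r cell] unfolding zariski_closure_def by blast
  thus ?thesis by (auto simp: pluecker_cone_def)
qed

lemma om_in_cone_cell:
  assumes "v 0 \<noteq> 0"
  shows "om v \<in> pluecker_cone n r cell"
proof -
  have "0 < q" using q by simp
  from om_basis[of 0 v, OF this assms] show ?thesis
    using assms unfolding pluecker_cone_def om_def cell_def by blast
qed

lemma cone_cellE:
  assumes "x \<in> pluecker_cone n r cell"
  obtains c v where "v 0 \<noteq> 0" "x = (\<lambda>S. c * om v S)"
proof -
  obtain bs v where v: "v 0 \<noteq> 0" "x = pluecker n r bs"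
    "is_basis_of bs (fun_space.span (set (gens (\<lambda>c. U c v))))"
    using assms by (auto simp: pluecker_cone_def cell_def)
  have "0 < q" using q by simp
  from pluecker_same_span[OF om_basis[of 0 v, OF this v(1)] v(3) length_gens] v that
  show thesis by (auto simp: om_def)
qed

lemma upoly_U: "(\<And>k. upoly (\<lambda>b. s b k)) \<Longrightarrow> upoly (\<lambda>b. U c (s b) k)"
  by (cases "\<beta> + c * n < k \<and> k \<le> \<beta> + M") (auto simp: U_def)

lemma upoly_om:
  assumes "\<And>k. upoly (\<lambda>b. s b k)"
  shows "upoly (\<lambda>b. om (s b) S)"
  unfolding om_def
proof (rule upoly_pluecker)
  fix c k assume "c < r"
  thus "upoly (\<lambda>b. (gens (\<lambda>c. U c (s b)) ! c) k)"
    by (cases "c < R") (simp_all add: nth_gens upoly_U assms)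
qed

lemma upoly_fun_upd: "upoly (\<lambda>b. (v(a := b)) k)"
  by (cases "k = a") auto

text \<open>Vectors of the cell have \<open>v 0\<close> nonzero. Varying this coordinate alone, a
  polynomial vanishing on the cell vanishes along the whole line.\<close>

lemma om_in_cone:
  fixes v :: "nat \<Rightarrow> 'k :: alg_closed_field"
  assumes "t < q" "v t \<noteq> 0"
  shows "om v \<in> pluecker_cone n r X"
  unfolding om_def
proof (rule zariski_closureI[OF gens_U_basis(1,2)[of t v, OF assms] length_gens
      gens_U_basis(3)[of t v, OF assms]])
  fix d P
  assume P: "P \<in> homogeneous (tuples n r) d"
    "\<And>x. x \<in> pluecker_cone n r cell \<Longrightarrow> poly_eval P x = (0 :: 'k)"
  have u: "upoly (\<lambda>b. poly_eval P (om (v(0 := b))))"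
    by (intro upoly_poly_eval upoly_om upoly_fun_upd)
  have "poly_eval P (om (v(0 := b))) = 0" for b
    by (rule upoly_eqI[OF u upoly_const[of 0], of "{0}"]) (auto intro!: P(2) om_in_cone_cell)
  from this[of "v 0"] show "poly_eval P (pluecker n r (gens (\<lambda>c. U c v))) = 0"
    by (simp add: om_def)
qed

lemma om_cong:
  assumes "\<And>k. k < M \<Longrightarrow> v k = v' k"
  shows "om v = om v'"
proof -
  have "U c v = U c v'" for c using assms by (auto simp: U_def fun_eq_iff)
  thus ?thesis by (simp add: om_def)
qed

text \<open>The change of generators is lower triangular with diagonal \<open>e\<close>. It covers
  scaling, the action of \<open>e + t\<close> and, with \<open>d = 0\<close>, the extraction of a
  factor from one generator.\<close>

lemma pluecker_gens_triangular:
  fixes u :: "nat \<Rightarrow> nat \<Rightarrow> 'k :: field"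
  assumes u': "\<And>c k. c < R \<Longrightarrow> u' c k = e c * u c k + (if Suc c < R then d * u (Suc c) k else 0)"
  shows "pluecker n r (gens u') = (\<lambda>S. (\<Prod>c<R. e c) * pluecker n r (gens u) S)"
proof
  fix S
  define C where "C = mat r r (\<lambda>(c, b). if c = b then (if b < R then e b else 1)
    else if c = Suc b \<and> c < R then d else 0)"
  have C: "C \<in> carrier_mat r r" by (simp add: C_def)
  have "pluecker n r (gens u') S = det C * pluecker n r (gens u) S"
  proof (rule pluecker_change[OF C])
    fix b k assume b: "b < r"
    have "(\<Sum>c<r. (gens u ! c) k * C $$ (c, b)) =
        (\<Sum>c<r. (if c = b then (gens u ! b) k * (if b < R then e b else 1) else 0) +
          (if c = Suc b then (if Suc b < R then (gens u ! Suc b) k * d else 0) else 0))"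
      using b by (intro sum.cong) (auto simp: C_def)
    also have "\<dots> = (gens u ! b) k * (if b < R then e b else 1) +
        (if Suc b < R then (gens u ! Suc b) k * d else 0)"
      using b R by (simp add: sum.distrib)
    also have "\<dots> = (gens u' ! b) k"
      using b R by (auto simp: nth_gens u' mult.commute)
    finally show "(gens u' ! b) k = (\<Sum>c<r. (gens u ! c) k * C $$ (c, b))" by simp
  qed
  also have "det C = prod_list (diag_mat C)"
    by (rule det_lower_triangular[OF _ C]) (auto simp: C_def)
  also have "\<dots> = (\<Prod>c<r. if c < R then e c else 1)"
    by (simp add: prod_list_diag_prod C_def lessThan_atLeast0)
  also have "\<dots> = (\<Prod>c\<in>{..<r} \<inter> {c. c < R}. e c)"
    by (simp add: prod.inter_restrict)
  also have "{..<r} \<inter> {c. c < R} = {..<R}" using R by auto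
  finally show "pluecker n r (gens u') S = (\<Prod>c<R. e c) * pluecker n r (gens u) S" .
qed

lemma om_scale_shift:
  "om (\<lambda>k. e * v k + (if k \<ge> n then d * v (k - n) else 0)) = (\<lambda>S. e ^ R * om v S)"
proof -
  \<comment> \<open>\<open>M \<le> R * n\<close> means that the translate following the last
    generator is truncated to 0, so the shift never leaves the list of generators.\<close>
  have "R * n = (R - 1) * n + n" using R(1) by (cases R) auto
  hence M: "M \<le> R * n" unfolding M_def using q by linarith
  have "om (\<lambda>k. e * v k + (if k \<ge> n then d * v (k - n) else 0)) = (\<lambda>S. (\<Prod>c<R. e) * om v S)"
    unfolding om_def
  proof (rule pluecker_gens_triangular[where d = d])
    fix c k assume c: "c < R"
    have "\<not> (\<beta> + Suc c * n < k \<and> k \<le> \<beta> + M)" if "\<not> Suc c < R"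
    proof -
      have "Suc c = R" using that c by simp
      thus ?thesis using M by auto
    qed
    hence *: "(if Suc c < R then d * U (Suc c) v k else 0) = d * U (Suc c) v k"
      by (auto simp: U_def)
    show "U c (\<lambda>k. e * v k + (if k \<ge> n then d * v (k - n) else 0)) k =
        e * U c v k + (if Suc c < R then d * U (Suc c) v k else 0)"
    proof (cases "\<beta> + c * n < k \<and> k \<le> \<beta> + M")
      case True
      have "\<beta> + Suc c * n < k \<longleftrightarrow> k - \<beta> - c * n - 1 \<ge> n"
        "k - \<beta> - Suc c * n - 1 = k - \<beta> - c * n - 1 - n"
        using True n by auto
      thus ?thesis unfolding * using True by (simp add: U_def)
    next
      case False
      hence "\<not> (\<beta> + Suc c * n < k \<and> k \<le> \<beta> + M)" by auto
      thus ?thesis unfolding * using False unfolding U_def by (simp only: if_False mult_zero_right add_0_left)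
    qed
  qed
  thus ?thesis by simp
qed

lemma om_scale: "om (\<lambda>k. e * v k) = (\<lambda>S. e ^ R * om v S)"
  using om_scale_shift[of e v 0] by (simp add: if_distrib cong: if_cong)

lemma om_twist: "om (twist n 0 e v) = (\<lambda>S. e ^ R * om v S)"
  using om_scale_shift[of e v 1] by (simp add: twist_def cong: if_cong)

section \<open>Pulling a section back along \<open>om\<close>\<close>

context
  fixes f :: "(nat list \<Rightarrow> 'k :: alg_closed_field) \<Rightarrow> 'k"
  assumes f: "f \<in> global_sections n r X"
begin

lemma section_om_scale:
  assumes "t < q" "v t \<noteq> 0" "t' < q" "v' t' \<noteq> 0" "om v' = (\<lambda>S. c * om v S)"
  shows "f (om v') = c * f (om v)"
  using section_homogeneous[OF f om_in_cone[of t v, OF assms(1,2)] om_in_cone[of t' v', OF assms(3,4)] assms(5)] .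

lemma upoly_section_om:
  assumes "\<And>k. upoly (\<lambda>b. s b k)" "\<And>b. \<exists>t<q. s b t \<noteq> 0"
  shows "upoly (\<lambda>b. f (om (s b)))"
proof (rule upoly_section_curve[OF f])
  fix b show "om (s b) \<in> pluecker_cone n r X" using assms(2)[of b] om_in_cone by blast
qed (rule upoly_om[OF assms(1)])

text \<open>The hypothesis keeps the whole projective line, including the direction
  \<open>w\<close>, inside the domain of \<open>om\<close>. Substituting \<open>1 / b\<close> and
  using homogeneity of degree \<open>R\<close> bounds the pole at infinity by
  \<open>R\<close>.\<close>

lemma udeg_section_line:
  assumes "\<And>a b. a \<noteq> 0 \<or> b \<noteq> 0 \<Longrightarrow> \<exists>t<q. a * v t + b * w t \<noteq> 0"
  shows "udeg R (\<lambda>b. f (om (\<lambda>k. v k + b * w k)))"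
proof (rule udeg_reflect[where G = "\<lambda>a. f (om (\<lambda>k. a * v k + w k))"])
  show "upoly (\<lambda>b. f (om (\<lambda>k. v k + b * w k)))"
    by (rule upoly_section_om) (use assms[of 1] in \<open>auto intro!: upoly_add upoly_mult\<close>)
  show "upoly (\<lambda>a. f (om (\<lambda>k. a * v k + w k)))"
    by (rule upoly_section_om) (use assms[of _ 1] in \<open>auto intro!: upoly_add upoly_mult\<close>)
  fix b :: 'k assume b: "b \<noteq> 0"
  obtain t where t: "t < q" "v t + b * w t \<noteq> 0" using assms[of 1 b] by auto
  obtain t' where t': "t' < q" "1 / b * v t' + w t' \<noteq> 0" using assms[of "1 / b" 1] by auto
  have "om (\<lambda>k. v k + b * w k) = om (\<lambda>k. b * (1 / b * v k + w k))"
    using b by (simp add: distrib_left)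
  also have "\<dots> = (\<lambda>S. b ^ R * om (\<lambda>k. 1 / b * v k + w k) S)" by (rule om_scale)
  finally show "f (om (\<lambda>k. v k + b * w k)) = b ^ R * f (om (\<lambda>k. 1 / b * v k + w k))"
    by (rule section_om_scale[of t' "\<lambda>k. 1 / b * v k + w k" t "\<lambda>k. v k + b * w k", OF t' t])
qed

text \<open>
  The section is a polynomial of degree at most \<open>R\<close> along every line all of whose points have a
  nonzero leading block, also at infinity. For \<open>k \<ge> q\<close> the direction of the \<open>k\<close>-th unit vector
  does not have this property, hence the change of coordinates.
\<close>

lemma section_polyfun_general:
  assumes q2: "q \<ge> 2"
  shows "\<exists>h\<in>polyfuns. \<forall>v. v 0 \<noteq> 0 \<longrightarrow> f (om v) = h v"
proof -
  \<comment> \<open>For \<open>q \<le> k < M\<close>, \<open>\<Phi>\<close> sends the unit vector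
    with number \<open>k\<close> to its sum with unit vector number 1. That one lies in the leading
    block and differs from number 0, which is used for the chart \<open>v 0 = 1\<close>.\<close>
  define \<Phi> :: "(nat \<Rightarrow> 'k) \<Rightarrow> nat \<Rightarrow> 'k"
    where "\<Phi> = (\<lambda>x k. if k = 1 then x 1 + (\<Sum>j\<in>{q..<M}. x j) else x k)"
  define \<Psi> :: "(nat \<Rightarrow> 'k) \<Rightarrow> nat \<Rightarrow> 'k"
    where "\<Psi> = (\<lambda>x k. if k = 1 then x 1 - (\<Sum>j\<in>{q..<M}. x j) else x k)"
  have \<Phi>\<Psi>: "\<Phi> (\<Psi> x) = x" for x
    using q2 by (auto simp: \<Phi>_def \<Psi>_def fun_eq_iff)
  define h1 where "h1 = (\<lambda>x. f (om (\<Phi> (x(0 := 1)))))"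
  have "h1 \<in> polyfuns"
  proof (rule polyfuns_of_separate[of 1 M _ R])
    fix x x' :: "nat \<Rightarrow> 'k" assume eq: "\<And>k. k \<in> {1..<M} \<Longrightarrow> x k = x' k"
    have "(\<Sum>j\<in>{q..<M}. (x(0 := 1)) j) = (\<Sum>j\<in>{q..<M}. (x'(0 := 1)) j)"
      using eq q by (intro sum.cong) auto
    hence "om (\<Phi> (x(0 := 1))) = om (\<Phi> (x'(0 := 1)))"
      using eq by (intro om_cong) (auto simp: \<Phi>_def)
    thus "h1 x = h1 x'" by (simp add: h1_def)
  next
    fix x :: "nat \<Rightarrow> 'k" and k assume k: "k \<in> {1..<M}"
    define v where "v = \<Phi> ((x(k := 0))(0 := 1))"
    define w where "w = \<Phi> (\<lambda>j. if j = k then 1 else 0)"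
    have lin: "\<Phi> ((x(k := b))(0 := 1)) = (\<lambda>j. v j + b * w j)" for b
    proof -
      have "(\<Sum>j\<in>{q..<M}. ((x(k := b))(0 := 1)) j) =
          (\<Sum>j\<in>{q..<M}. ((x(k := 0))(0 := 1)) j) + b * (\<Sum>j\<in>{q..<M}. if j = k then 1 else 0)"
        unfolding sum_distrib_left sum.distrib[symmetric] using k by (intro sum.cong) auto
      thus ?thesis using k by (auto simp: v_def w_def \<Phi>_def fun_eq_iff algebra_simps)
    qed
    define t where "t = (if k < q then k else 1)"
    have tw: "v 0 = 1" "w 0 = 0" "t < q" "w t = 1"
      using k q2 by (auto simp: v_def w_def \<Phi>_def t_def)
    have "udeg R (\<lambda>b. f (om (\<lambda>j. v j + b * w j)))"
    proof (rule udeg_section_line)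
      fix a b :: 'k assume ab: "a \<noteq> 0 \<or> b \<noteq> 0"
      show "\<exists>t<q. a * v t + b * w t \<noteq> 0"
      proof (cases "a = 0")
        case True
        thus ?thesis using tw ab by (intro exI[of _ t]) simp
      next
        case False
        thus ?thesis using tw q2 by (intro exI[of _ 0]) simp
      qed
    qed
    thus "udeg R (\<lambda>b. h1 (x(k := b)))" by (simp only: h1_def lin)
  qed
  hence g: "(\<lambda>v. h1 (\<Psi> v)) \<in> polyfuns"
    by (rule polyfuns_compose)
      (auto simp: \<Psi>_def intro!: polyfuns_if polyfuns_diff polyfuns_sum polyfuns.coord)
  obtain N G where G: "G \<in> polyfuns"
    "\<And>v. v 0 \<noteq> 0 \<Longrightarrow> v 0 ^ N * h1 (\<Psi> (\<lambda>k. v k / v 0)) = G v"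
    using polyfuns_dehomogenize[OF g, of 0] by blast
  show ?thesis
  \<comment> \<open>Off \<open>v 0 = 0\<close> the section is now a polynomial divided by a power of
    \<open>v 0\<close>. Lines in direction 0 with \<open>v 1\<close> nonzero avoid the bad locus, so
    the power can be cancelled.\<close>
  proof (rule polyfuns_cancel_power[of "\<lambda>v. v 0 ^ R * G v" 0 N _ 1])
    show "(\<lambda>v. v 0 ^ R * G v) \<in> polyfuns"
      by (intro polyfuns.mult polyfuns_power polyfuns.coord G)
  next
    fix v :: "nat \<Rightarrow> 'k" assume v: "v 0 \<noteq> 0"
    let ?y = "\<lambda>k. v k / v 0"
    have "(\<Psi> ?y)(0 := 1) = \<Psi> ?y" using v by (auto simp: \<Psi>_def fun_eq_iff)
    hence h1: "h1 (\<Psi> ?y) = f (om ?y)" by (simp add: h1_def \<Phi>\<Psi>)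
    have "om v = om (\<lambda>k. v 0 * ?y k)" using v by simp
    also have "\<dots> = (\<lambda>S. v 0 ^ R * om ?y S)" by (rule om_scale)
    finally have "f (om v) = v 0 ^ R * f (om ?y)"
      by (rule section_om_scale[of 0 ?y 0 v, rotated -1]) (use v q in auto)
    thus "v 0 ^ N * f (om v) = v 0 ^ R * G v"
      using G(2)[of v, OF v] h1 by (simp add: algebra_simps)
  next
    fix v :: "nat \<Rightarrow> 'k" assume v: "v 1 \<noteq> 0"
    show "upoly (\<lambda>b. f (om (v(0 := b))))"
    proof (rule upoly_section_om)
      fix b show "\<exists>t<q. (v(0 := b)) t \<noteq> 0" using v q2 by (intro exI[of _ 1]) auto
    qed (rule upoly_fun_upd)
  qed simp
qed

text \<open>If \<open>q = 1\<close>, then \<open>R = 1\<close> and \<open>M = 1\<close>: only the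
  coordinate \<open>v 0\<close> is left, and homogeneity settles the claim.\<close>

lemma section_polyfun: "\<exists>h\<in>polyfuns. \<forall>v. v 0 \<noteq> 0 \<longrightarrow> f (om v) = h v"
proof (cases "q \<ge> 2")
  case False
  hence 1: "R = 1" "q = 1" using qR q by auto
  define e where "e = (\<lambda>k :: nat. if k = 0 then 1 else 0 :: 'k)"
  have "f (om v) = v 0 * f (om e)" if v: "v 0 \<noteq> 0" for v
  proof (rule section_om_scale[of 0 e 0 v])
    have "M = 1" unfolding M_def using 1 by simp
    hence "om v = om (\<lambda>k. v 0 * e k)" by (intro om_cong) (auto simp: e_def)
    thus "om v = (\<lambda>S. v 0 * om e S)" using om_scale[of "v 0" e] by (simp add: 1)
  qed (use v q in \<open>auto simp: e_def\<close>)
  moreover have "(\<lambda>v. v 0 * f (om e)) \<in> polyfuns" by (intro polyfuns.intros)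
  ultimately show ?thesis by (intro bexI[of _ "\<lambda>v. v 0 * f (om e)"]) auto
qed (rule section_polyfun_general)

text \<open>
  As \<open>v\<close> approaches a vector with vanishing leading block, \<open>om v\<close> tends to \<open>0\<close> to first order,
  and \<open>om v / b\<close> tends to the Pluecker vector of a subspace that is no longer cyclic.
\<close>

lemma section_vanishes:
  assumes h: "h \<in> polyfuns" "\<And>v. v 0 \<noteq> 0 \<Longrightarrow> f (om v) = h v"
    and R2: "R \<ge> 2" and v: "\<And>k. k < q \<Longrightarrow> v k = 0" "v q \<noteq> 0"
  shows "h v = 0"
proof -
  have q2: "q \<ge> 2" using qR R2 by simp
  \<comment> \<open>Moving along coordinate 0, which differs from \<open>q - 1\<close>, extends the
    formula from \<open>v 0\<close> nonzero to \<open>v (q - 1)\<close> nonzero.\<close>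
  have h': "f (om v) = h v" if "v (q - 1) \<noteq> 0" for v
  proof -
    have u1: "upoly (\<lambda>b. f (om (v(0 := b))))"
    proof (rule upoly_section_om)
      fix b show "\<exists>t<q. (v(0 := b)) t \<noteq> 0" using that q2 by (intro exI[of _ "q - 1"]) auto
    qed (rule upoly_fun_upd)
    have u2: "upoly (\<lambda>b. h (v(0 := b)))" by (rule upoly_polyfun[OF h(1) upoly_fun_upd])
    have "f (om (v(0 := b))) = h (v(0 := b))" for b
      by (rule upoly_eqI[OF u1 u2, of "{0}"]) (auto intro: h(2))
    from this[of "v 0"] show ?thesis by simp
  qed
  \<comment> \<open>Approach \<open>v\<close> by giving the value \<open>b\<close> to the last
    coordinate of the leading block. The other leading entries are 0, so the truncation of
    \<open>t ^ (R - 1) v\<close> becomes \<open>b\<close> times the basis vector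
    \<open>e_(\<beta>+M)\<close>; \<open>u\<close> divides this generator by
    \<open>b\<close>.\<close>
  define vb where "vb = (\<lambda>b. v(q - 1 := b))"
  define E where "E = (\<lambda>k. if k = q - 1 then 1 else 0 :: 'k)"
  define u where "u = (\<lambda>b c. if c = R - 1 then U c E else U c (vb b))"
  define om' where "om' = (\<lambda>b. pluecker n r (gens (u b)))"
  have last: "U (R - 1) (vb b) = (\<lambda>k. b * U (R - 1) E k)" for b
    using v(1) by (auto simp: fun_eq_iff U_def vb_def E_def M_def)
  have om': "om (vb b) = (\<lambda>S. b * om' b S)" for b
  proof -
    have "om (vb b) = (\<lambda>S. (\<Prod>c<R. if c = R - 1 then b else 1) * om' b S)"
      unfolding om_def om'_def
      by (rule pluecker_gens_triangular[where d = 0]) (use last[of b] in \<open>auto simp: u_def\<close>)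
    also have "(\<Prod>c<R. if c = R - 1 then b else 1) = b" using R by simp
    finally show ?thesis .
  qed
  have u_om': "upoly (\<lambda>b. om' b S)" for S
    unfolding om'_def
  proof (rule upoly_pluecker)
    fix c k assume "c < r"
    moreover have "upoly (\<lambda>b. u b c k)"
      by (cases "c = R - 1") (simp_all add: u_def vb_def upoly_U upoly_fun_upd del: fun_upd_apply)
    ultimately show "upoly (\<lambda>b. (gens (u b) ! c) k)" by (cases "c < R") (simp_all add: nth_gens)
  qed
  have in_cone: "om (vb b) \<in> pluecker_cone n r X" if "b \<noteq> 0" for b
    by (rule om_in_cone[of "q - 1"]) (use that q2 in \<open>auto simp: vb_def\<close>)
  have cone: "om' b \<in> pluecker_cone n r X" for b
  proof -
    \<comment> \<open>The position of the first nonzero entry of \<open>vb b\<close>; for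
      \<open>b = 0\<close> it is \<open>q\<close> by the hypothesis on \<open>v q\<close>. As
      \<open>n \<ge> 2\<close>, the pivots of the other translates stay below the last pivot
      \<open>\<beta> + M\<close> even then.\<close>
    define t where "t = (if b = 0 then q else q - 1)"
    define piv where "piv = (\<lambda>c. if c = R - 1 then \<beta> + (R - 1) * n + q else \<beta> + c * n + t + 1)"
    have tq: "t \<le> q" by (simp add: t_def)
    have t1: "vb b t \<noteq> 0" using v q2 by (cases "b = 0") (auto simp: t_def vb_def)
    have t2: "vb b k = 0" if "k < t" for k
      using that v(1)[of k] q2 by (cases "b = 0"; cases "k = q - 1") (simp_all add: t_def vb_def)
    have le: "c * n + n \<le> (R - 1) * n" if "c < R" "c \<noteq> R - 1" for c
    proof -
      have "Suc c * n \<le> (R - 1) * n" using that by (intro mult_right_mono) auto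
      thus ?thesis by simp
    qed
    have n2: "n \<ge> 2" using q q2 by simp
    have lt: "c * n + t + 1 < (R - 1) * n + q" if "c < R" "c \<noteq> R - 1" for c
      using le[OF that] n2 q2 tq by linarith
    have piv_last: "piv (R - 1) = \<beta> + (R - 1) * n + q"
      and piv_other: "c \<noteq> R - 1 \<Longrightarrow> piv c = \<beta> + c * n + t + 1" for c
      by (simp_all only: piv_def if_True if_False simp_thms)
    have u_last: "u b (R - 1) = U (R - 1) E" and u_other: "c \<noteq> R - 1 \<Longrightarrow> u b c = U c (vb b)" for c
      by (simp_all only: u_def if_True if_False simp_thms)
    have inj: "inj_on piv {..<R}"
    proof (rule inj_onI)
      fix a c assume ac: "a \<in> {..<R}" "c \<in> {..<R}" "piv a = piv c"
      consider "a = R - 1" "c = R - 1" | "a = R - 1" "c \<noteq> R - 1" | "a \<noteq> R - 1" "c = R - 1"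
        | "a \<noteq> R - 1" "c \<noteq> R - 1" by blast
      thus "a = c"
      proof cases
        case 2 thus ?thesis using lt[of c] ac piv_last piv_other[of c] by simp
      next
        case 3 thus ?thesis using lt[of a] ac piv_last piv_other[of a] by simp
      next
        case 4
        hence "a * n = c * n" using ac(3) by (simp add: piv_other)
        thus ?thesis using n by simp
      qed simp
    qed
    have pM: "piv c \<le> \<beta> + M" if "c < R" for c
    proof (cases "c = R - 1")
      case True
      thus ?thesis by (simp only: piv_last M_def add.assoc order_refl)
    next
      case False
      thus ?thesis using lt[OF that False] unfolding piv_other[OF False] M_def by linarith
    qed
    have nz: "u b c (piv c) \<noteq> 0" if "c < R" for c
    proof (cases "c = R - 1")
      case True
      have "U (R - 1) E (\<beta> + (R - 1) * n + q) = E (q - 1)"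
        using q2 by (simp add: U_def M_def)
      thus ?thesis unfolding True piv_last u_last by (simp add: E_def)
    next
      case False
      thus ?thesis using pM[OF that] t1 unfolding piv_other[OF False] u_other[OF False] U_def by simp
    qed
    have z: "u b c k = 0" if "c < R" "k < piv c" for c k
    proof (cases "c = R - 1")
      case True
      have "k - \<beta> - (R - 1) * n - 1 \<noteq> q - 1 \<or> \<not> \<beta> + (R - 1) * n < k"
        using that(2) q2 unfolding True piv_last by linarith
      thus ?thesis unfolding True u_last U_def E_def by simp
    next
      case False
      have "k - \<beta> - c * n - 1 < t \<or> \<not> \<beta> + c * n < k"
        using that(2) unfolding piv_other[OF False] by linarith
      thus ?thesis unfolding u_other[OF False] U_def using t2 by auto
    qed
    have V: "u b c k = 0" if "c < R" "k \<notin> {1..r * n}" for c k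
      using that(2) U_support[of c E k] U_support[of c "vb b" k] by (auto simp: u_def)
    note basis = gens_basis[of piv "u b", OF inj pM nz z V]
    show ?thesis
      unfolding om'_def
    proof (rule zariski_closureI[OF basis(1,2) length_gens basis(3)])
      fix d P
      assume P: "P \<in> homogeneous (tuples n r) d"
        "\<And>x. x \<in> pluecker_cone n r cell \<Longrightarrow> poly_eval P x = (0 :: 'k)"
      \<comment> \<open>Dividing by \<open>b ^ d\<close> shows the vanishing for nonzero
        \<open>b\<close>, and hence for the limit \<open>b = 0\<close>.\<close>
      have "poly_eval P (om' b) = 0" for b
      proof (rule upoly_eqI[of "\<lambda>b. poly_eval P (om' b)" "\<lambda>_. 0" "{0}"])
        fix b :: 'k assume "b \<notin> {0}"
        hence b: "b \<noteq> 0" by simp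
        have "poly_eval P (om (vb b)) = b ^ d * poly_eval P (om' b)"
          unfolding om' by (rule poly_eval_homogeneous[OF P(1)])
        moreover have "poly_eval P (om (vb b)) = 0"
          by (rule zariski_closure_vanish[OF P in_cone[OF b]])
        ultimately show "poly_eval P (om' b) = 0" using b by simp
      qed (auto intro: upoly_poly_eval u_om')
      thus "poly_eval P (pluecker n r (gens (u b))) = 0" by (simp add: om'_def)
    qed
  qed
  have u1: "upoly (\<lambda>b. h (vb b))"
    unfolding vb_def by (rule upoly_polyfun[OF h(1) upoly_fun_upd])
  have u2: "upoly (\<lambda>b. b * f (om' b))"
    by (intro upoly_mult upoly_id upoly_section_curve[OF f cone u_om'])
  \<comment> \<open>Both sides are polynomials in \<open>b\<close>; at 0 the factor \<open>b\<close>
    kills the right-hand side because \<open>om' 0\<close> is still in the cone.\<close>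
  have "h (vb 0) = 0 * f (om' 0)"
  proof (rule upoly_eqI[OF u1 u2, of "{0}"])
    fix b :: 'k assume "b \<notin> {0}"
    hence b: "b \<noteq> 0" by simp
    have "f (om (vb b)) = b * f (om' b)"
      by (rule section_homogeneous[OF f cone in_cone[OF b] om'])
    thus "h (vb b) = b * f (om' b)" using h'[of "vb b"] b by (simp add: vb_def)
  qed simp
  moreover have "vb 0 = v" using v(1)[of "q - 1"] q2 by (auto simp: vb_def fun_eq_iff)
  ultimately show ?thesis by simp
qed

lemma section_invs0: "\<exists>h\<in>invs0 n R 0 M q. \<forall>v. v 0 \<noteq> 0 \<longrightarrow> f (om v) = h v"
proof -
  obtain h where h: "h \<in> polyfuns" "\<And>v. v 0 \<noteq> 0 \<Longrightarrow> f (om v) = h v"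
    using section_polyfun by blast
  have M1: "M \<ge> 1" using q by (simp add: M_def)
  define rs where "rs = (\<lambda>v k. if k < M then v k else 0 :: 'k)"
  have hr: "h v = h (rs v)" for v
  proof (rule polyfuns_eqI[of h "\<lambda>v. h (rs v)" 0])
    show "(\<lambda>v. h (rs v)) \<in> polyfuns"
      by (rule polyfuns_compose[OF h(1)]) (auto simp: rs_def intro!: polyfuns_if polyfuns.intros)
    fix v :: "nat \<Rightarrow> 'k" assume v: "v 0 \<noteq> 0"
    have "om v = om (rs v)" by (rule om_cong) (simp add: rs_def)
    thus "h v = h (rs v)" using h(2)[of v] h(2)[of "rs v"] v M1 by (simp add: rs_def)
  qed (rule h(1))
  have dep: "h v = h v'" if "\<forall>k\<in>{0..<M}. v k = v' k" for v v'
  proof -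
    have "rs v = rs v'" using that by (auto simp: rs_def)
    thus ?thesis using hr[of v] hr[of v'] by simp
  qed
  have "h (twist n 0 e v) = e ^ R * h v" if "e \<noteq> 0" "v 0 \<noteq> 0" for e v
  proof -
    have t0: "twist n 0 e v 0 \<noteq> 0" using that n by (simp add: twist_def)
    have "f (om (twist n 0 e v)) = e ^ R * f (om v)"
      by (rule section_om_scale[of 0 v 0 "twist n 0 e v"]) (use that t0 q om_twist in auto)
    thus ?thesis using h(2)[of "twist n 0 e v"] h(2)[of v] t0 that by simp
  qed
  note tw0 = this
  have *: "h (twist n 0 e v) = e ^ R * h v" if "e \<noteq> 0" for e v
    by (rule polyfuns_eqI[of "\<lambda>v. h (twist n 0 e v)" "\<lambda>v. e ^ R * h v" 0,
          OF polyfuns_twist[OF h(1)] polyfuns.mult[OF polyfuns.const h(1)] tw0[OF that]])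
  have tw: "h (twist n 0 e v) = e ^ R * h v" for e v
  proof -
    have u: "upoly (\<lambda>e. e ^ R * h v)" by (intro upoly_mult upoly_power upoly_id upoly_const)
    show ?thesis by (rule upoly_eqI[OF upoly_twist[OF h(1)] u, of "{0}"]) (use * in auto)
  qed
  have inv: "h \<in> invs n R 0 M" using h(1) dep tw unfolding invs_def by blast
  have "h v = 0" if v: "\<forall>k\<in>{0..<0 + q}. v k = 0" for v
  \<comment> \<open>For \<open>R = 1\<close> the leading block is all of \<open>v\<close>, and
    homogeneity of degree 1 gives the value 0 at the origin.\<close>
  proof (cases "R = 1")
    case True
    have "M = q" unfolding M_def using True by simp
    hence "h v = h (twist n 0 0 (\<lambda>_. 0))"
      using v by (intro dep) (auto simp: twist_def)
    thus ?thesis using tw[of 0 "\<lambda>_. 0"] True by simp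
  next
    case False
    hence R2: "R \<ge> 2" using R by simp
    \<comment> \<open>\<open>z\<close> clears the leading block. \<open>section_vanishes\<close>
      asks for a nonzero coordinate \<open>q\<close>; density removes this condition.\<close>
    define z where "z = (\<lambda>v k. if k < q then 0 else v k :: 'k)"
    have "h (z v) = 0"
    proof (rule polyfuns_eqI[of "\<lambda>v. h (z v)" "\<lambda>_. 0" q])
      show "(\<lambda>v. h (z v)) \<in> polyfuns"
        by (rule polyfuns_compose[OF h(1)]) (auto simp: z_def intro!: polyfuns_if polyfuns.intros)
      fix v :: "nat \<Rightarrow> 'k" assume "v q \<noteq> 0"
      thus "h (z v) = 0" by (intro section_vanishes[OF h R2]) (auto simp: z_def)
    qed (rule polyfuns.const)
    moreover have "z v = v" using v by (auto simp: z_def fun_eq_iff)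
    ultimately show ?thesis by simp
  qed
  hence "h \<in> invs0 n R 0 M q" using inv by (simp add: invs0_def)
  thus ?thesis using h(2) by blast
qed

end

section \<open>The upper bound for the space of sections\<close>

lemma section_zero:
  fixes f :: "(nat list \<Rightarrow> 'k :: alg_closed_field) \<Rightarrow> 'k"
  assumes f: "f \<in> global_sections n r X" and z: "\<And>v. v 0 \<noteq> 0 \<Longrightarrow> f (om v) = 0"
  shows "f = 0"
proof (rule section_zero_on_closure[OF f cone_cell_subset])
  fix x :: "nat list \<Rightarrow> 'k" assume x: "x \<in> pluecker_cone n r cell"
  obtain c v where v: "v 0 \<noteq> 0" "x = (\<lambda>S. c * om v S)" by (rule cone_cellE[OF x])
  have "f x = c * f (om v)"
    using section_homogeneous[OF f _ _ v(2)] cone_cell_subset x om_in_cone_cell[of v, OF v(1)] by blast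
  thus "f x = 0" using z[of v, OF v(1)] by simp
qed

lemma dim_global_sections:
  "dim_at_most (global_sections n r X :: ((nat list \<Rightarrow> 'k :: alg_closed_field) \<Rightarrow> 'k) set)
     (q * n ^ (R - 1))"
proof -
  \<comment> \<open>The polynomial attached to \<open>f\<close> is only known to exist. Replacing
    values by 0 where \<open>v 0 = 0\<close> gives linear maps \<open>T\<close> and \<open>J\<close>
    that can be compared without choosing it.\<close>
  define T :: "((nat list \<Rightarrow> 'k) \<Rightarrow> 'k) \<Rightarrow> (nat \<Rightarrow> 'k) \<Rightarrow> 'k"
    where "T = (\<lambda>f v. if v 0 \<noteq> 0 then f (om v) else 0)"
  define J :: "((nat \<Rightarrow> 'k) \<Rightarrow> 'k) \<Rightarrow> (nat \<Rightarrow> 'k) \<Rightarrow> 'k"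
    where "J = (\<lambda>h v. if v 0 \<noteq> 0 then h v else 0)"
  let ?G = "global_sections n r X :: ((nat list \<Rightarrow> 'k) \<Rightarrow> 'k) set"
  have T: "fun_linear T" by (rule fun_linearI) (auto simp: T_def fun_eq_iff)
  have J: "fun_linear J" by (rule fun_linearI) (auto simp: J_def fun_eq_iff)
  have "T ` ?G \<subseteq> J ` invs0 n R 0 M q"
  proof safe
    fix f :: "(nat list \<Rightarrow> 'k) \<Rightarrow> 'k" assume "f \<in> ?G"
    then obtain h where "h \<in> invs0 n R 0 M q" "\<forall>v. v 0 \<noteq> 0 \<longrightarrow> f (om v) = h v"
      using section_invs0 by blast
    moreover from this have "T f = J h" by (auto simp: T_def J_def fun_eq_iff)
    ultimately show "T f \<in> J ` invs0 n R 0 M q" by blast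
  qed
  moreover have "dim_at_most (invs0 n R 0 M q :: ((nat \<Rightarrow> 'k) \<Rightarrow> 'k) set) (q * n ^ (R - 1))"
    using dim_invs0[OF n, of "R - 1" 0 M q] R by simp
  ultimately have 1: "dim_at_most (T ` ?G) (q * n ^ (R - 1))"
    using dim_at_most_image[OF J] dim_at_most_subset by blast
  have "{f \<in> ?G. T f = 0} \<subseteq> {0}"
  proof safe
    fix f :: "(nat list \<Rightarrow> 'k) \<Rightarrow> 'k" assume f: "f \<in> ?G" "T f = 0"
    show "f = 0"
    proof (rule section_zero[OF f(1)])
      fix v :: "nat \<Rightarrow> 'k" assume "v 0 \<noteq> 0"
      hence "f (om v) = T f v" by (simp add: T_def)
      thus "f (om v) = 0" using f(2) by simp
    qed
  qed
  from dim_at_most_ker_image[OF T subspace_global_sections 1 dim_at_most_zero[OF this]]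
  show ?thesis by simp
qed

end

section \<open>Zero columns and comparison of power sums\<close>

lemma pluecker_zero_column:
  assumes "c < r" "\<And>a. a < r \<Longrightarrow> (bs ! c) (S ! a) = 0"
  shows "pluecker n r bs S = 0"
proof -
  have "det (mat r r (\<lambda>(i, j). (bs ! j) (S ! i))) =
      (\<Sum>p\<in>{p. p permutes {0..<r}}. signof p * (\<Prod>i = 0..<r. (bs ! p i) (S ! i)))"
    by (subst det_def'[of _ r]) (auto intro!: sum.cong prod.cong simp: permutes_in_image)
  also have "\<dots> = 0"
  proof (intro sum.neutral ballI)
    fix p assume "p \<in> {p. p permutes {0..<r}}"
    hence p: "p permutes {0..<r}" by simp
    define i where "i = inv_into UNIV p c"
    have "p i = c" using p by (simp add: i_def permutes_inverses)
    moreover have "i < r" using permutes_in_image[OF permutes_inv[OF p], of c] assms(1) by (simp add: i_def)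
    ultimately have "(\<Prod>i = 0..<r. (bs ! p i) (S ! i)) = 0"
      using assms(2)[of i] by (intro prod_zero) (auto intro!: bexI[of _ i])
    thus "signof p * (\<Prod>i = 0..<r. (bs ! p i) (S ! i)) = 0" by simp
  qed
  finally show ?thesis by (simp add: pluecker_def)
qed

text \<open>Lexicographic comparison: from \<open>a\<close> on, the smaller sum totals at most
  \<open>R * B ^ f a\<close>, which is less than the single term \<open>B ^ g c\<close>.\<close>

lemma sum_powers_less:
  fixes f g :: "nat \<Rightarrow> nat"
  assumes B: "B > R" and a: "a < R" and eq: "\<And>i. i < a \<Longrightarrow> f i = g i"
    and dec: "\<And>i. a \<le> i \<Longrightarrow> i < R \<Longrightarrow> f i \<le> f a"
    and c: "a \<le> c" "c < R" "f a < g c"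
  shows "(\<Sum>i<R. B ^ f i) < (\<Sum>i<R. B ^ g i)"
proof -
  have split: "(\<Sum>i<R. B ^ h i) = (\<Sum>i<a. B ^ h i) + (\<Sum>i\<in>{a..<R}. B ^ h i)" for h :: "nat \<Rightarrow> nat"
    using a sum.atLeastLessThan_concat[of 0 a R "\<lambda>i. B ^ h i"] by (simp add: lessThan_atLeast0)
  have "(\<Sum>i\<in>{a..<R}. B ^ f i) \<le> (\<Sum>i\<in>{a..<R}. B ^ f a)"
    using B dec by (intro sum_mono power_increasing) auto
  also have "\<dots> \<le> R * B ^ f a" by simp
  also have "\<dots> < B * B ^ f a" using B by (intro mult_strict_right_mono) auto
  also have "\<dots> = B ^ Suc (f a)" by simp
  also have "\<dots> \<le> B ^ g c" using B c(3) by (intro power_increasing) auto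
  also have "\<dots> \<le> (\<Sum>i\<in>{a..<R}. B ^ g i)" using c by (intro member_le_sum) auto
  finally have "(\<Sum>i\<in>{a..<R}. B ^ f i) < (\<Sum>i\<in>{a..<R}. B ^ g i)" .
  moreover have "(\<Sum>i<a. B ^ f i) = (\<Sum>i<a. B ^ g i)" using eq by (intro sum.cong) auto
  ultimately show ?thesis by (simp add: split)
qed

lemma prod_monom: "finite A \<Longrightarrow> (\<Prod>i\<in>A. monom 1 (e i)) = monom (1 :: 'k :: field) (\<Sum>i\<in>A. e i)"
  by (induction A rule: finite_induct) (auto simp: mult_monom)

lemma finite_tuples: "finite (tuples n r)"
proof (rule finite_subset)
  show "tuples n r \<subseteq> {xs. set xs \<subseteq> {1..r * n} \<and> length xs = r}" by (auto simp: tuples_def)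
qed (rule finite_lists_length_eq, simp)

context cyclic_family
begin

section \<open>Admissible tuples\<close>

text \<open>The concrete shape of the tuples admissible on \<open>X\<close>, see
  \<open>admissible_on_eq\<close>: the fixed basis vectors force the tail, and the column of
  \<open>t ^ (R - 1) v\<close> confines entry \<open>R - 1\<close> to a window of length
  \<open>q\<close>.\<close>

definition adm :: "nat list set" where
  "adm = {S \<in> tuples n r. (\<forall>a. R \<le> a \<and> a < r \<longrightarrow> S ! a = \<beta> + M + 1 + (a - R)) \<and>
     \<beta> + (R - 1) * n < S ! (R - 1) \<and> S ! (R - 1) \<le> \<beta> + M \<and>
     (\<forall>a. Suc a < R \<longrightarrow> S ! Suc a \<le> S ! a + n)}"

lemma tuples_nth_less: "S \<in> tuples n r \<Longrightarrow> a < b \<Longrightarrow> b < r \<Longrightarrow> S ! a < S ! b"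
  by (simp add: tuples_def sorted_wrt_iff_nth_less)

lemma adm_upper:
  assumes "S \<in> adm" "a < R"
  shows "S ! a \<le> \<beta> + M"
proof (cases "a = R - 1")
  case False
  have "S ! a < S ! (R - 1)"
    by (rule tuples_nth_less) (use assms R False in \<open>auto simp: adm_def\<close>)
  thus ?thesis using assms(1) by (simp add: adm_def)
qed (use assms(1) in \<open>simp add: adm_def\<close>)

text \<open>Descending from the window at \<open>R - 1\<close>, each step loses at most
  \<open>n\<close>. Together with \<open>adm_upper\<close> this puts a coordinate of
  \<open>v\<close> at each of the first \<open>R\<close> diagonal places of the minor.\<close>

lemma adm_lower:
  assumes "S \<in> adm" "a < R"
  shows "\<beta> + a * n < S ! a"
proof -
  have "\<beta> + (R - 1 - d) * n < S ! (R - 1 - d)" if "d \<le> R - 1" for d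
    using that
  proof (induction d)
    case 0
    show ?case using assms(1) by (simp add: adm_def)
  next
    case (Suc d)
    define a where "a = R - 1 - Suc d"
    have a: "R - 1 - d = Suc a" using Suc.prems by (simp add: a_def)
    have "Suc a < R" using Suc.prems R by (simp add: a_def)
    hence "S ! Suc a \<le> S ! a + n" using assms(1) by (simp add: adm_def)
    moreover have "\<beta> + Suc a * n < S ! Suc a" using Suc.IH Suc.prems a by simp
    ultimately show ?case unfolding a_def[symmetric] by simp
  qed
  from this[of "R - 1 - a"] assms(2) show ?thesis by simp
qed

text \<open>The number of the coordinate of \<open>v\<close> at the diagonal place \<open>a\<close>
  of the minor \<open>om v S\<close>. Gaps of at most \<open>n\<close> mean that these numbers do
  not increase.\<close>

definition ht :: "nat list \<Rightarrow> nat \<Rightarrow> nat" where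
  "ht S a = S ! a - \<beta> - a * n - 1"

lemma ht_decreasing:
  assumes S: "S \<in> adm" and "a \<le> b" "b < R"
  shows "ht S b \<le> ht S a"
  using assms(2,3)
proof (induction b rule: dec_induct)
  case (step b)
  have "S ! Suc b \<le> S ! b + n" using S step.prems by (simp add: adm_def)
  moreover have "\<beta> + b * n < S ! b" using adm_lower[OF S] step.prems by simp
  ultimately have "ht S (Suc b) \<le> ht S b" by (simp add: ht_def)
  thus ?case using step by simp
qed simp

text \<open>Exceeds the number \<open>R\<close> of summands in \<open>low\<close>, as the comparison
  of power sums demands.\<close>

definition B :: nat where "B = R + 2"

text \<open>The minor \<open>om v S\<close> along the curve \<open>v k = x ^ (B ^ k)\<close>, as a polynomial in \<open>x\<close>.\<close>

definition entry :: "nat list \<Rightarrow> nat \<Rightarrow> nat \<Rightarrow> 'k :: field poly" where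
  "entry S a b = (if b < R then
      if \<beta> + b * n < S ! a \<and> S ! a \<le> \<beta> + M then monom 1 (B ^ (S ! a - \<beta> - b * n - 1)) else 0
     else if S ! a = \<beta> + M + 1 + (b - R) then 1 else 0)"

definition om_poly :: "nat list \<Rightarrow> 'k :: field poly" where
  "om_poly S = (\<Sum>p\<in>{p. p permutes {0..<r}}. signof p * (\<Prod>i = 0..<r. entry S i (p i)))"

definition low :: "nat list \<Rightarrow> nat" where "low S = (\<Sum>a<R. B ^ ht S a)"

lemma poly_signof: "poly (signof p) x = signof p"
  by (cases "sign p = 1") (auto simp: sign_def)

lemma poly_om_poly:
  assumes "S \<in> tuples n r"
  shows "poly (om_poly S) x = om (\<lambda>k. x ^ (B ^ k)) S"
proof -
  have "det (mat r r (\<lambda>(i, j). (gens (\<lambda>c. U c (\<lambda>k. x ^ (B ^ k))) ! j) (S ! i))) =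
      (\<Sum>p\<in>{p. p permutes {0..<r}}. signof p *
        (\<Prod>i = 0..<r. (gens (\<lambda>c. U c (\<lambda>k. x ^ (B ^ k))) ! p i) (S ! i)))"
    by (subst det_def'[of _ r]) (auto intro!: sum.cong prod.cong simp: permutes_in_image)
  moreover have "poly (entry S i j) x = (gens (\<lambda>c. U c (\<lambda>k. x ^ (B ^ k))) ! j) (S ! i)"
    if "j < r" for i j
    using that by (auto simp: entry_def nth_gens U_def e_vec_def poly_monom)
  hence "(\<Prod>i = 0..<r. poly (entry S i (p i)) x) =
      (\<Prod>i = 0..<r. (gens (\<lambda>c. U c (\<lambda>k. x ^ (B ^ k))) ! p i) (S ! i))"
    if "p permutes {0..<r}" for p
    using permutes_in_image[OF that] by (intro prod.cong) auto
  ultimately show ?thesis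
    using assms unfolding om_def pluecker_def om_poly_def
    by (simp add: poly_sum poly_prod poly_signof)
qed

text \<open>
  Since \<open>ht S\<close> is decreasing and the base \<open>B\<close> exceeds the number of factors, every permutation
  other than the identity contributes only terms of higher degree.
\<close>

lemma coeff_entry_prod:
  assumes S: "S \<in> adm" and p: "p permutes {0..<r}" and k: "k \<le> low S"
  shows "coeff (\<Prod>i = 0..<r. entry S i (p i)) k = (if p = id \<and> k = low S then 1 else 0 :: 'k :: field)"
proof (cases "\<exists>i<r. entry S i (p i) = (0 :: 'k poly)")
  case True
  hence 0: "(\<Prod>i = 0..<r. entry S i (p i)) = (0 :: 'k poly)"
    by (intro prod_zero) auto
  have "entry S i i \<noteq> (0 :: 'k poly)" if "i < r" for i
    using S that adm_lower[OF S, of i] adm_upper[OF S, of i]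
    by (auto simp: entry_def adm_def monom_eq_0_iff)
  hence "p \<noteq> id" using True by auto
  thus ?thesis unfolding 0 by simp
next
  case False
  hence nz: "entry S i (p i) \<noteq> (0 :: 'k poly)" if "i < r" for i using that by blast
  have tail: "S ! a = \<beta> + M + 1 + (a - R)" if "R \<le> a" "a < r" for a
    using S that by (simp add: adm_def)
  have pr: "p i < r" if "i < r" for i using permutes_in_image[OF p, of i] that by simp
  \<comment> \<open>A nonzero product forces \<open>p\<close> to preserve the first \<open>R\<close>
    places and to fix the others: rows up to \<open>\<beta> + M\<close> miss the columns of the
    fixed vectors, and each later row meets exactly one column.\<close>
  have less: "p i < R" if "i < R" for i
  proof (rule ccontr)
    assume "\<not> p i < R"
    hence "S ! i > \<beta> + M" using nz[of i] that R by (auto simp: entry_def split: if_splits)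
    thus False using adm_upper[OF S that] by simp
  qed
  have fixd: "p i = i" if "R \<le> i" "i < r" for i
  proof -
    have "\<not> p i < R" using nz[of i] that tail[OF that] by (auto simp: entry_def split: if_splits)
    moreover from this have "S ! i = \<beta> + M + 1 + (p i - R)"
      using nz[of i] that by (auto simp: entry_def split: if_splits)
    ultimately show ?thesis using tail[OF that] that by simp
  qed
  define e where "e = (\<lambda>i. S ! i - \<beta> - p i * n - 1)"
  have ei: "entry S i (p i) = monom (1 :: 'k) (B ^ e i)" "\<beta> + p i * n < S ! i" if "i < R" for i
    using nz[of i] less[OF that] that R by (auto simp: entry_def e_def split: if_splits)
  have "(\<Prod>i = 0..<r. entry S i (p i)) = (\<Prod>i\<in>{0..<r}. if i < R then monom (1 :: 'k) (B ^ e i) else 1)"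
    using ei(1) fixd tail by (intro prod.cong) (auto simp: entry_def)
  also have "\<dots> = (\<Prod>i\<in>{0..<r} \<inter> {i. i < R}. monom (1 :: 'k) (B ^ e i))"
    by (simp add: prod.inter_restrict)
  also have "{0..<r} \<inter> {i. i < R} = {..<R}" using R by auto
  finally have eq: "(\<Prod>i = 0..<r. entry S i (p i)) = monom (1 :: 'k) (\<Sum>i<R. B ^ e i)"
    by (simp only: prod_monom[OF finite_lessThan])
  show ?thesis
  proof (cases "p = id")
    case True
    hence "(\<Sum>i<R. B ^ e i) = low S" by (simp add: e_def low_def ht_def)
    thus ?thesis using eq True by simp
  next
    case False
    \<comment> \<open>At the first index \<open>a\<close> moved by \<open>p\<close>, column
      \<open>a\<close> is paired with a later row \<open>c\<close>, whose entry has a coordinate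
      number above \<open>ht S a\<close>; so the degree exceeds \<open>low S\<close>.\<close>
    define a where "a = (LEAST a. p a \<noteq> a)"
    have "\<exists>a. p a \<noteq> a" using False by (auto simp: fun_eq_iff)
    hence a: "p a \<noteq> a" unfolding a_def by (rule LeastI_ex)
    have min: "p i = i" if "i < a" for i using not_less_Least[of i "\<lambda>a. p a \<noteq> a"] that by (simp add: a_def)
    have "a < r" using a permutes_not_in[OF p, of a] by auto
    hence aR: "a < R" using a fixd[of a] by force
    define c where "c = inv_into UNIV p a"
    have pc: "p c = a" using p by (simp add: c_def permutes_inverses)
    have "c \<noteq> a" using a pc by auto
    moreover have "\<not> c < a" using min[of c] pc by auto
    ultimately have ac: "a < c" by simp
    have "c < r" using permutes_in_image[OF permutes_inv[OF p], of a] \<open>a < r\<close> by (simp add: c_def)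
    hence cR: "c < R" using fixd[of c] pc ac by force
    have "low S < (\<Sum>i<R. B ^ e i)"
      unfolding low_def
    proof (rule sum_powers_less[OF _ aR, of B "ht S" e c])
      show "B > R" by (simp add: B_def)
      show "ht S i = e i" if "i < a" for i using min[OF that] by (simp add: ht_def e_def)
      show "ht S i \<le> ht S a" if "a \<le> i" "i < R" for i by (rule ht_decreasing[OF S that])
      have "S ! a < S ! c" using tuples_nth_less[of S a c] S ac \<open>c < r\<close> by (simp add: adm_def)
      thus "ht S a < e c" using adm_lower[OF S aR] by (simp add: ht_def e_def pc)
    qed (use ac cR in auto)
    hence "(\<Sum>i<R. B ^ e i) \<noteq> k" using k by linarith
    thus ?thesis unfolding eq using False by simp
  qed
qed

lemma coeff_om_poly:
  assumes S: "S \<in> adm" and k: "k \<le> low S"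
  shows "coeff (om_poly S) k = (if k = low S then 1 else 0 :: 'k :: field)"
proof -
  have sg: "signof p = [:signof p :: 'k:]" for p
    by (cases "sign p = 1") (auto simp: sign_def one_pCons)
  have "coeff (om_poly S) k = (\<Sum>p\<in>{p. p permutes {0..<r}}. signof p *
      coeff (\<Prod>i = 0..<r. entry S i (p i)) k :: 'k)"
    unfolding om_poly_def coeff_sum
    by (rule sum.cong[OF refl], subst sg) simp
  also have "\<dots> = (\<Sum>p\<in>{p. p permutes {0..<r}}. if p = id then (if k = low S then 1 else 0) else 0)"
    by (intro sum.cong refl) (auto simp: coeff_entry_prod[OF S _ k])
  also have "\<dots> = (if k = low S then 1 else 0)"
    by (subst sum.delta) (auto simp: finite_permutations permutes_id)
  finally show ?thesis .
qed

lemma adm_eqI: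
  assumes "S \<in> adm" "S' \<in> adm" "\<And>a. a < R \<Longrightarrow> ht S a = ht S' a"
  shows "S = S'"
proof (rule nth_equalityI)
  show "length S = length S'" using assms by (simp add: adm_def tuples_def)
  fix i assume "i < length S"
  hence i: "i < r" using assms by (simp add: adm_def tuples_def)
  show "S ! i = S' ! i"
  proof (cases "i < R")
    case True
    thus ?thesis
      using assms(3)[OF True] adm_lower[OF assms(1) True] adm_lower[OF assms(2) True]
      by (simp add: ht_def)
  next
    case False
    thus ?thesis using assms(1,2) i by (simp add: adm_def)
  qed
qed

text \<open>The height sequences do not increase, so the first place where two of them differ
  decides the comparison of the power sums.\<close>

lemma low_inj: "inj_on low adm"
proof -
  have "low S \<noteq> low S'" if S: "S \<in> adm" and S': "S' \<in> adm" and ne: "S \<noteq> S'" for S S'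
  proof -
    let ?P = "\<lambda>a. a < R \<and> ht S a \<noteq> ht S' a"
    define a where "a = (LEAST a. ?P a)"
    have "\<exists>a. ?P a" using adm_eqI[OF S S'] ne by blast
    hence a: "a < R" "ht S a \<noteq> ht S' a" using LeastI_ex[of ?P] by (simp_all add: a_def)
    have min: "ht S i = ht S' i" if "i < a" for i
      using not_less_Least[of i ?P] that a(1) by (simp add: a_def)
    have lt: "low T < low T'" if "T \<in> adm" "\<And>i. i < a \<Longrightarrow> ht T i = ht T' i" "ht T a < ht T' a" for T T'
      unfolding low_def
      by (rule sum_powers_less[of R B a "ht T" "ht T'" a])
        (use that a(1) ht_decreasing in \<open>auto simp: B_def\<close>)
    show ?thesis
    proof (cases "ht S a < ht S' a")
      case True
      thus ?thesis using lt[OF S min] by simp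
    next
      case False
      hence "ht S' a < ht S a" using a(2) by simp
      thus ?thesis using lt[OF S' min[symmetric]] by simp
    qed
  qed
  thus ?thesis by (auto simp: inj_on_def)
qed

lemma adm_subset_tuples: "adm \<subseteq> tuples n r"
  by (auto simp: adm_def)

lemma finite_adm: "finite adm"
  using finite_subset[OF adm_subset_tuples finite_tuples] .

text \<open>In a relation, the tuple of least \<open>low\<close> among those with nonzero
  coefficient contributes the only term of its lowest degree along the curve.\<close>

lemma adm_lin_indep:
  fixes c :: "nat list \<Rightarrow> 'k :: alg_closed_field"
  assumes z: "\<And>x. x \<in> pluecker_cone n r X \<Longrightarrow> (\<Sum>S\<in>adm. c S * x S) = 0" and S: "S \<in> adm"
  shows "c S = 0"
proof (rule ccontr)
  assume "c S \<noteq> 0"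
  then obtain T where T: "T \<in> adm" "c T \<noteq> 0"
    and min: "\<And>T'. T' \<in> adm \<Longrightarrow> c T' \<noteq> 0 \<Longrightarrow> low T \<le> low T'"
    using S ex_has_least_nat[of "\<lambda>T. T \<in> adm \<and> c T \<noteq> 0" S low] by auto
  have "(\<Sum>S\<in>adm. smult (c S) (om_poly S)) = 0"
  proof (rule poly_eq_cofinite[of "{0}"])
    fix x :: 'k assume "x \<notin> {0}"
    hence x: "x \<noteq> 0" by simp
    have "om (\<lambda>k. x ^ (B ^ k)) \<in> pluecker_cone n r X"
      by (rule om_in_cone[of 0]) (use q x in auto)
    from z[OF this] show "poly (\<Sum>S\<in>adm. smult (c S) (om_poly S)) x = poly 0 x"
      using adm_subset_tuples by (simp add: poly_sum poly_om_poly subset_iff)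
  qed simp
  hence "(\<Sum>S\<in>adm. c S * coeff (om_poly S) (low T)) = 0"
    by (metis (no_types, lifting) coeff_0 coeff_smult coeff_sum sum.cong)
  also have "(\<Sum>S\<in>adm. c S * coeff (om_poly S) (low T)) = (\<Sum>S\<in>adm. if S = T then c T else 0)"
  proof (rule sum.cong[OF refl])
    fix S assume S: "S \<in> adm"
    show "c S * coeff (om_poly S) (low T) = (if S = T then c T else 0)"
    proof (cases "c S = 0")
      case False
      hence "low T \<le> low S" by (rule min[OF S])
      moreover have "low T = low S \<longleftrightarrow> S = T" using low_inj S T(1) by (auto simp: inj_on_def)
      ultimately show ?thesis by (simp add: coeff_om_poly[OF S])
    qed (use T(2) in auto)
  qed
  also have "\<dots> = c T" using T(1) finite_adm by simp
  finally show False using T(2) by simp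
qed

lemma adm_sections:
  fixes sec :: "nat list \<Rightarrow> (nat list \<Rightarrow> 'k :: alg_closed_field) \<Rightarrow> 'k"
  defines "sec \<equiv> pluecker_section n r X"
  shows "inj_on sec adm" "fun_space.independent (sec ` adm)"
proof -
  show inj: "inj_on sec adm"
  proof (rule inj_onI, rule ccontr)
    fix S T assume ST: "S \<in> adm" "T \<in> adm" "sec S = sec T" "S \<noteq> T"
    define c where "c = (\<lambda>Q. if Q = S then 1 else if Q = T then -1 else 0 :: 'k)"
    have "c S = 0"
    proof (rule adm_lin_indep[where c = c, OF _ ST(1)])
      fix x :: "nat list \<Rightarrow> 'k" assume x: "x \<in> pluecker_cone n r X"
      have "x S = x T" using fun_cong[OF ST(3), of x] x by (simp add: sec_def pluecker_section_def)
      moreover have "(\<Sum>Q\<in>adm. c Q * x Q) = (\<Sum>Q\<in>{S, T}. c Q * x Q)"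
        using ST(1,2) finite_adm by (intro sum.mono_neutral_right) (auto simp: c_def)
      ultimately show "(\<Sum>Q\<in>adm. c Q * x Q) = 0" using ST(4) by (simp add: c_def)
    qed
    thus False by (simp add: c_def)
  qed
  show "fun_space.independent (sec ` adm)"
    unfolding fun_space.dependent_finite[OF finite_imageI[OF finite_adm]]
  proof (rule notI, elim exE conjE bexE)
    fix f :: "((nat list \<Rightarrow> 'k) \<Rightarrow> 'k) \<Rightarrow> 'k" and g
    assume sum: "(\<Sum>s\<in>sec ` adm. (\<lambda>x. f s * s x)) = 0" and g: "g \<in> sec ` adm" "f g \<noteq> 0"
    obtain S where S: "S \<in> adm" "g = sec S" using g(1) by blast
    have "(\<Sum>S\<in>adm. f (sec S) * x S) = 0" if x: "x \<in> pluecker_cone n r X" for x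
    proof -
      have "(\<Sum>s\<in>sec ` adm. f s * s x) = 0"
        using fun_cong[OF sum, of x] by (simp add: sum_apply_fun)
      also have "(\<Sum>s\<in>sec ` adm. f s * s x) = (\<Sum>S\<in>adm. f (sec S) * sec S x)"
        by (subst sum.reindex[OF inj]) simp
      also have "\<dots> = (\<Sum>S\<in>adm. f (sec S) * x S)" using x by (simp add: sec_def pluecker_section_def)
      finally show ?thesis .
    qed
    from adm_lin_indep[where c = "\<lambda>S. f (sec S)", OF this S(1)] show False
      using S(2) g(2) by simp
  qed
qed

lemma adm_section_nonzero:
  assumes S: "S \<in> adm"
  shows "pluecker_section n r X S \<noteq> (0 :: (nat list \<Rightarrow> 'k :: alg_closed_field) \<Rightarrow> 'k)"
proof (rule notI)
  assume zero: "pluecker_section n r X S = (0 :: (nat list \<Rightarrow> 'k) \<Rightarrow> 'k)"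
  define d :: "nat list \<Rightarrow> 'k" where "d = (\<lambda>Q. if Q = S then 1 else 0)"
  have z: "(\<Sum>Q\<in>adm. d Q * x Q) = 0" if x: "x \<in> pluecker_cone n r X" for x
  proof -
    have "x S = 0" using fun_cong[OF zero, of x] x by (simp add: pluecker_section_def)
    hence "d Q * x Q = 0" for Q by (cases "Q = S") (simp_all add: d_def)
    thus ?thesis by (intro sum.neutral ballI)
  qed
  have "d S = 0" by (rule adm_lin_indep[where c = d, OF z S])
  thus False by (simp add: d_def)
qed

text \<open>The column of the fixed vector belonging to place \<open>a\<close> must meet
  \<open>S\<close> somewhere. Descending from the last place, the later entries are already known,
  and an earlier place would leave no room for \<open>S ! a\<close>.\<close>

lemma tail_of_nonzero:
  fixes v :: "nat \<Rightarrow> 'k :: field"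
  assumes S: "S \<in> tuples n r" and nz: "om v S \<noteq> 0" and "R \<le> a" "a < r"
  shows "S ! a = \<beta> + M + 1 + (a - R)"
  using assms(3,4)
proof (induction "r - a" arbitrary: a rule: less_induct)
  case less
  have "\<exists>a'<r. (gens (\<lambda>c. U c v) ! a) (S ! a') \<noteq> 0"
    using pluecker_zero_column[of a r "gens (\<lambda>c. U c v)" S n] nz less.prems by (auto simp: om_def)
  then obtain a' where a': "a' < r" "S ! a' = \<beta> + M + 1 + (a - R)"
    using less.prems by (auto simp: nth_gens e_vec_def split: if_splits)
  have IH: "S ! b = \<beta> + M + 1 + (b - R)" if "a < b" "b < r" for b
    using less.hyps[of b] that less.prems by simp
  have "\<not> a < a'" using IH[of a'] a' less.prems by auto
  moreover have "\<not> a' < a"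
  proof
    assume *: "a' < a"
    hence lt: "S ! a' < S ! a" using tuples_nth_less[OF S] less.prems by simp
    show False
    proof (cases "Suc a < r")
      case True
      have "S ! a < S ! Suc a" using tuples_nth_less[OF S, of a "Suc a"] True by simp
      thus False using IH[of "Suc a"] True lt a'(2) less.prems by simp
    next
      case False
      hence "a = r - 1" using less.prems by simp
      hence "S ! a' = r * n" using a'(2) M_rn R less.prems by simp
      moreover have "S ! a \<le> r * n" using S less.prems unfolding tuples_def by (auto simp: subset_iff)
      ultimately show False using lt by simp
    qed
  qed
  ultimately have "a = a'" by simp
  thus ?case using a'(2) by simp
qed

text \<open>A nonzero minor needs a nonzero entry in the column of \<open>t ^ (R - 1) v\<close>,
  which is supported on the window. Its row lies before the tail, so entry \<open>R - 1\<close> is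
  at least as large.\<close>

lemma admissible_on_subset:
  "admissible_on n r (X :: (nat \<Rightarrow> 'k :: alg_closed_field) set set) \<subseteq> adm"
proof
  fix S assume "S \<in> admissible_on n r (X :: (nat \<Rightarrow> 'k) set set)"
  hence S: "S \<in> tuples n r" and ad: "admissible n r S"
    and nz: "pluecker_section n r X S \<noteq> (0 :: (nat list \<Rightarrow> 'k) \<Rightarrow> 'k)"
    by (auto simp: admissible_on_def)
  have "\<exists>v :: nat \<Rightarrow> 'k. om v S \<noteq> 0"
  proof (rule ccontr)
    assume z: "\<not> (\<exists>v :: nat \<Rightarrow> 'k. om v S \<noteq> 0)"
    have "pluecker_section n r X S = (0 :: (nat list \<Rightarrow> 'k) \<Rightarrow> 'k)"
      by (rule section_zero[OF pluecker_section_global[OF S]])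
        (use z in \<open>simp add: pluecker_section_def\<close>)
    thus False using nz by simp
  qed
  then obtain v :: "nat \<Rightarrow> 'k" where v: "om v S \<noteq> 0" by blast
  note tail = tail_of_nonzero[OF S v]
  have "R - 1 < r" using R by simp
  hence "\<exists>a<r. (gens (\<lambda>c. U c v) ! (R - 1)) (S ! a) \<noteq> 0"
    using pluecker_zero_column[of "R - 1" r "gens (\<lambda>c. U c v)" S n] v by (auto simp: om_def)
  then obtain a where a: "a < r" "U (R - 1) v (S ! a) \<noteq> 0"
    using R by (auto simp: nth_gens)
  hence bd: "\<beta> + (R - 1) * n < S ! a" "S ! a \<le> \<beta> + M" by (auto simp: U_def split: if_splits)
  have "a < R" using tail[of a] a(1) bd(2) by (cases "a < R") auto
  hence "a = R - 1 \<or> a < R - 1" by linarith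
  hence "S ! a \<le> S ! (R - 1)"
    using tuples_nth_less[OF S _ \<open>R - 1 < r\<close>, of a] by (elim disjE) simp_all
  hence 1: "\<beta> + (R - 1) * n < S ! (R - 1)" using bd(1) by simp
  have 2: "S ! (R - 1) \<le> \<beta> + M"
  proof (cases "R < r")
    case True
    thus ?thesis using tuples_nth_less[OF S, of "R - 1" R] tail[of R] R by simp
  next
    case False
    have "S ! (R - 1) \<in> set S" using S \<open>R - 1 < r\<close> by (simp add: tuples_def)
    hence "S ! (R - 1) \<le> r * n" using S by (auto simp: tuples_def)
    thus ?thesis using M_rn False R by simp
  qed
  have 3: "S ! Suc a \<le> S ! a + n" if "Suc a < R" for a
  proof -
    have "ext_seq n r S (Suc a + 1) \<le> ext_seq n r S (Suc a) + n"
      using ad unfolding admissible_def by simp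
    thus ?thesis using that R by (simp add: ext_seq_def)
  qed
  show "S \<in> adm" unfolding adm_def using S tail 1 2 3 by blast
qed

lemma adm_admissible:
  assumes S: "S \<in> adm"
  shows "admissible n r S"
  unfolding admissible_def
proof (intro allI impI)
  fix j :: nat assume j: "1 \<le> j"
  \<comment> \<open>The window has length \<open>q \<le> n\<close>, so the gap to the tail, or to
    \<open>r * n + 1\<close> if there is no tail, is at most \<open>n\<close>.\<close>
  have last: "\<beta> + M < S ! (R - 1) + n"
    using S q by (simp add: adm_def M_def)
  consider "j < R" | "j = R" "R < r" | "R < j" "j < r" | "j = r" | "j > r" using R by linarith
  thus "ext_seq n r S (j + 1) \<le> ext_seq n r S j + n"
  proof cases
    case 1
    obtain i where i: "j = Suc i" using j by (cases j) auto
    have "S ! Suc i \<le> S ! i + n" using S 1 i by (simp add: adm_def)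
    thus ?thesis using 1 i R by (simp add: ext_seq_def)
  next
    case 2
    have "S ! R = \<beta> + M + 1" using S 2 by (simp add: adm_def)
    thus ?thesis using 2 last by (simp add: ext_seq_def)
  next
    case 3
    obtain i where i: "j = Suc i" using j by (cases j) auto
    have "S ! Suc i = \<beta> + M + 1 + (Suc i - R)" "S ! i = \<beta> + M + 1 + (i - R)"
      using S 3 i by (simp_all add: adm_def)
    thus ?thesis using 3 i n by (simp add: ext_seq_def)
  next
    case 4
    show ?thesis
    proof (cases "R < r")
      case True
      have "R \<le> r - 1 \<and> r - 1 < r" using True by linarith
      hence "S ! (r - 1) = \<beta> + M + 1 + (r - 1 - R)" using S unfolding adm_def by blast
      hence "S ! (r - 1) = r * n" using M_rn True by linarith
      thus ?thesis using 4 n by (simp add: ext_seq_def)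
    next
      case False
      hence "R = r" using R by simp
      thus ?thesis using 4 last M_rn R by (simp add: ext_seq_def)
    qed
  next
    case 5
    thus ?thesis using n by (simp add: ext_seq_def)
  qed
qed

lemma admissible_on_eq: "admissible_on n r (X :: (nat \<Rightarrow> 'k :: alg_closed_field) set set) = adm"
proof
  show "adm \<subseteq> admissible_on n r (X :: (nat \<Rightarrow> 'k) set set)"
    using adm_section_nonzero adm_admissible adm_subset_tuples
    unfolding admissible_on_def by blast
qed (rule admissible_on_subset)

text \<open>The final part of a tuple in \<open>adm\<close>, with \<open>k\<close> free entries
  before the tail, to be extended at the front. The bound on \<open>hd x\<close> leaves room for all
  \<open>n\<close> choices of the preceding entry.\<close>

definition partial_adm :: "nat \<Rightarrow> nat list \<Rightarrow> bool" where
  "partial_adm k x \<longleftrightarrow> length x = k + (r - R) \<and> sorted_wrt (<) x \<and> set x \<subseteq> {1..r * n} \<and>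
     \<beta> + (R - k) * n < hd x \<and>
     (\<forall>a. k \<le> a \<and> a < k + (r - R) \<longrightarrow> x ! a = \<beta> + M + 1 + (a - k)) \<and>
     \<beta> + (R - 1) * n < x ! (k - 1) \<and> x ! (k - 1) \<le> \<beta> + M \<and>
     (\<forall>a. Suc a < k \<longrightarrow> x ! Suc a \<le> x ! a + n)"

lemma partial_adm_Cons:
  assumes x: "partial_adm k x" and k: "1 \<le> k" "k < R" and d: "d \<in> {1..n}"
  shows "n < hd x" "partial_adm (Suc k) ((hd x - d) # x)"
proof -
  define m where "m = R - Suc k"
  have m: "R - k = Suc m" using k by (simp add: m_def)
  have hd: "\<beta> + m * n + n < hd x" using x unfolding partial_adm_def m by simp
  thus "n < hd x" by linarith
  have len: "length x = k + (r - R)" using x by (simp add: partial_adm_def)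
  obtain y ys where ys: "x = y # ys" using len k by (cases x) auto
  have y: "hd x = y" using ys by simp
  have hdx: "y \<in> {1..r * n}" using x ys by (simp add: partial_adm_def)
  have lt: "\<beta> + m * n < y - d" "y - d < y" "y \<le> y - d + n" using hd d y by auto
  have "sorted_wrt (<) ((y - d) # x)"
    using x lt(2) unfolding partial_adm_def ys by auto
  moreover have "set ((y - d) # x) \<subseteq> {1..r * n}"
    using x lt(1) hdx unfolding partial_adm_def by auto
  moreover have "((y - d) # x) ! a = \<beta> + M + 1 + (a - Suc k)"
    if "Suc k \<le> a" "a < Suc k + (r - R)" for a
    using x that by (cases a) (auto simp: partial_adm_def)
  moreover have "((y - d) # x) ! Suc a \<le> ((y - d) # x) ! a + n" if "Suc a < Suc k" for a
    using x that lt(3) k by (cases a) (auto simp: partial_adm_def ys)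
  moreover have "((y - d) # x) ! (Suc k - 1) = x ! (k - 1)" using k by (cases k) auto
  ultimately show "partial_adm (Suc k) ((hd x - d) # x)"
    using x lt(1) len unfolding partial_adm_def m_def[symmetric] y by simp
qed

lemma partial_adm_one:
  assumes "s \<in> {\<beta> + (R - 1) * n<..\<beta> + M}"
  shows "partial_adm 1 (s # [\<beta> + M + 1..<r * n + 1])"
  using assms M_rn by (auto simp: partial_adm_def nth_Cons' simp del: upt_Suc)

text \<open>There are \<open>q\<close> choices for the last free entry, and then \<open>n\<close>
  choices for the gap at each further one.\<close>

lemma card_partial_adm:
  "k < R \<Longrightarrow> \<exists>L. finite L \<and> card L = q * n ^ k \<and> (\<forall>x\<in>L. partial_adm (Suc k) x)"
proof (induction k)
  case 0
  let ?I = "{\<beta> + (R - 1) * n<..\<beta> + M}"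
  have "inj_on (\<lambda>s. s # [\<beta> + M + 1..<r * n + 1]) ?I" by (auto simp: inj_on_def)
  hence "card ((\<lambda>s. s # [\<beta> + M + 1..<r * n + 1]) ` ?I) = q"
    by (simp add: card_image M_def del: upt_Suc)
  thus ?case
    using partial_adm_one by (intro exI[of _ "(\<lambda>s. s # [\<beta> + M + 1..<r * n + 1]) ` ?I"]) auto
next
  case (Suc k)
  then obtain L where L: "finite L" "card L = q * n ^ k" "\<And>x. x \<in> L \<Longrightarrow> partial_adm (Suc k) x"
    by auto
  let ?F = "\<lambda>(x, d). (hd x - d) # x"
  note step = partial_adm_Cons[OF L(3) _ Suc.prems]
  have "inj_on ?F (L \<times> {1..n})"
  proof (rule inj_onI)
    fix u w assume *: "u \<in> L \<times> {1..n}" "w \<in> L \<times> {1..n}" "?F u = ?F w"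
    obtain x d d' where xd: "u = (x, d)" "w = (x, d')" using *(3) by (cases u; cases w) auto
    have "n < hd x" using step(1)[of x d] *(1) xd(1) by simp
    thus "u = w" using * xd by auto
  qed
  hence "card (?F ` (L \<times> {1..n})) = q * n ^ Suc k"
    using L(1,2) by (simp add: card_image card_cartesian_product)
  moreover have "\<forall>x\<in>?F ` (L \<times> {1..n}). partial_adm (Suc (Suc k)) x"
    using step(2) by auto
  ultimately show ?case using L(1) by (intro exI[of _ "?F ` (L \<times> {1..n})"]) auto
qed

lemma card_adm: "q * n ^ (R - 1) \<le> card adm"
proof -
  have "R - 1 < R" using R by simp
  from card_partial_adm[OF this] obtain L where L: "finite L" "card L = q * n ^ (R - 1)"
    "\<And>x. x \<in> L \<Longrightarrow> partial_adm R x" using R by auto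
  have "L \<subseteq> adm"
  proof
    fix x assume "x \<in> L"
    from L(3)[OF this] show "x \<in> adm"
      using R by (auto simp: partial_adm_def adm_def tuples_def)
  qed
  from card_mono[OF finite_adm this] show ?thesis using L(2) by simp
qed

theorem admissible_basis:
  "inj_on (pluecker_section n r (X :: (nat \<Rightarrow> 'k :: alg_closed_field) set set))
     (admissible_on n r (X :: (nat \<Rightarrow> 'k) set set))"
  "fun_space.independent (pluecker_section n r (X :: (nat \<Rightarrow> 'k) set set) ` admissible_on n r (X :: (nat \<Rightarrow> 'k) set set))"
  "fun_space.span (pluecker_section n r (X :: (nat \<Rightarrow> 'k) set set) ` admissible_on n r (X :: (nat \<Rightarrow> 'k) set set)) =
     global_sections n r X"
proof -
  let ?sec = "pluecker_section n r (X :: (nat \<Rightarrow> 'k) set set)"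
  show inj: "inj_on ?sec (admissible_on n r (X :: (nat \<Rightarrow> 'k) set set))"
    unfolding admissible_on_eq by (rule adm_sections)
  show ind: "fun_space.independent (?sec ` admissible_on n r (X :: (nat \<Rightarrow> 'k) set set))"
    unfolding admissible_on_eq by (rule adm_sections)
  show "fun_space.span (?sec ` admissible_on n r (X :: (nat \<Rightarrow> 'k) set set)) = global_sections n r X"
  proof (rule span_eq_of_card[OF subspace_global_sections _ ind dim_global_sections])
    show "?sec ` admissible_on n r (X :: (nat \<Rightarrow> 'k) set set) \<subseteq> global_sections n r X"
      using pluecker_section_global adm_subset_tuples unfolding admissible_on_eq by blast
    show "q * n ^ (R - 1) \<le> card (?sec ` admissible_on n r (X :: (nat \<Rightarrow> 'k) set set))"
      using card_adm card_image[OF inj] by (simp add: admissible_on_eq)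
  qed
qed

end

section \<open>The Schubert cells of the chain\<close>

text \<open>The coefficient of \<open>e\<^sub>k\<close> in \<open>g e\<^sub>m\<close>, for \<open>k, m \<ge> 1\<close>.\<close>

definition mat_coeff :: "nat \<Rightarrow> 'k :: field fps mat \<Rightarrow> nat \<Rightarrow> nat \<Rightarrow> 'k" where
  "mat_coeff n g k m = (if (m - 1) div n \<le> (k - 1) div n
     then fps_nth (g $$ ((k - 1) mod n, (m - 1) mod n)) ((k - 1) div n - (m - 1) div n) else 0)"

definition mat_act :: "nat \<Rightarrow> nat \<Rightarrow> 'k :: field fps mat \<Rightarrow> (nat \<Rightarrow> 'k) \<Rightarrow> nat \<Rightarrow> 'k" where
  "mat_act n r g w = (\<lambda>k. if k \<in> {1..r * n} then \<Sum>m\<in>{1..r * n}. mat_coeff n g k m * w m else 0)"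

lemma linear_mat_act: "fun_linear (mat_act n r g)"
  by (rule fun_linearI)
    (auto simp: mat_act_def fun_eq_iff distrib_left sum.distrib sum_distrib_left mult.left_commute)

lemma index_bounds:
  fixes n r k :: nat
  assumes "n \<ge> 1" "k \<in> {1..r * n}"
  shows "(k - 1) div n < r" "(k - 1) mod n < n" "(k - 1) div n * n + (k - 1) mod n + 1 = k"
proof -
  have "k - 1 < r * n" using assms by auto
  thus "(k - 1) div n < r" using assms(1) by (simp add: less_mult_imp_div_less)
  show "(k - 1) mod n < n" using assms(1) by simp
  show "(k - 1) div n * n + (k - 1) mod n + 1 = k" using assms(2) by simp
qed

lemma index_in_range:
  fixes n r c j :: nat
  assumes "c < r" "j < n"
  shows "c * n + j + 1 \<in> {1..r * n}" "(c * n + j) div n = c" "(c * n + j) mod n = j"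
proof -
  have "Suc c * n \<le> r * n" using assms(1) by (intro mult_right_mono) auto
  thus "c * n + j + 1 \<in> {1..r * n}" using assms(2) by simp
qed (use assms in auto)

text \<open>\<open>m = a * n + j + 1\<close> matches coordinates with pairs of an entry
  \<open>j\<close> and a power \<open>a\<close> of \<open>t\<close>, turning the Cauchy products
  into one matrix product. In particular the result depends only on \<open>x\<close> modulo
  \<open>t ^ r\<close>.\<close>

lemma proj_mult_mat_vec:
  assumes n: "n \<ge> 1" and g: "g \<in> carrier_mat n n" and x: "x \<in> carrier_vec n"
  shows "proj_L1 n r (g *\<^sub>v x) = mat_act n r g (proj_L1 n r x)"
proof
  fix k
  show "proj_L1 n r (g *\<^sub>v x) k = mat_act n r g (proj_L1 n r x) k"
  proof (cases "k \<in> {1..r * n}")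
    case True
    define c where "c = (k - 1) div n"
    define i where "i = (k - 1) mod n"
    have ci: "c < r" "i < n" using index_bounds[OF n True] by (simp_all add: c_def i_def)
    have "proj_L1 n r (g *\<^sub>v x) k = fps_nth (\<Sum>j\<in>{0..<n}. g $$ (i, j) * vec_index x j) c"
      using True g x ci unfolding c_def i_def by (simp add: proj_L1_def scalar_prod_def)
    also have "\<dots> = (\<Sum>j\<in>{0..<n}. \<Sum>a\<in>{0..c}. fps_nth (g $$ (i, j)) (c - a) * fps_nth (vec_index x j) a)"
      unfolding fps_sum_nth
    proof (rule sum.cong[OF refl])
      fix j
      have "fps_nth (g $$ (i, j) * vec_index x j) c = fps_nth (vec_index x j * g $$ (i, j)) c"
        by (simp add: mult.commute)
      thus "fps_nth (g $$ (i, j) * vec_index x j) c =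
          (\<Sum>a\<in>{0..c}. fps_nth (g $$ (i, j)) (c - a) * fps_nth (vec_index x j) a)"
        by (simp add: fps_mult_nth mult.commute)
    qed
    also have "\<dots> = (\<Sum>j\<in>{0..<n}. \<Sum>a\<in>{0..<r}.
        if a \<le> c then fps_nth (g $$ (i, j)) (c - a) * fps_nth (vec_index x j) a else 0)"
      using ci by (intro sum.cong refl sum.mono_neutral_cong_left) auto
    also have "\<dots> = (\<Sum>(j, a)\<in>{0..<n} \<times> {0..<r}.
        if a \<le> c then fps_nth (g $$ (i, j)) (c - a) * fps_nth (vec_index x j) a else 0)"
      by (rule sum.cartesian_product)
    also have "\<dots> = (\<Sum>m\<in>{1..r * n}. mat_coeff n g k m * proj_L1 n r x m)"
    proof (rule sum.reindex_bij_witness[where i = "\<lambda>m. ((m - 1) mod n, (m - 1) div n)"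
          and j = "\<lambda>(j, a). a * n + j + 1"])
      fix m assume m: "m \<in> {1..r * n}"
      show "(case ((m - 1) mod n, (m - 1) div n) of (j, a) \<Rightarrow> a * n + j + 1) = m"
        using index_bounds(3)[OF n m] by simp
      show "((m - 1) mod n, (m - 1) div n) \<in> {0..<n} \<times> {0..<r}"
        using index_bounds[OF n m] by simp
    next
      fix p assume "p \<in> {0..<n} \<times> {0..<r}"
      then obtain j a where p: "p = (j, a)" "j < n" "a < r" by (cases p) auto
      note ir = index_in_range[OF p(3,2)]
      show "(((case p of (j, a) \<Rightarrow> a * n + j + 1) - 1) mod n,
          ((case p of (j, a) \<Rightarrow> a * n + j + 1) - 1) div n) = p"
        using ir p by simp
      show "(case p of (j, a) \<Rightarrow> a * n + j + 1) \<in> {1..r * n}" using ir p by simp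
      show "mat_coeff n g k (case p of (j, a) \<Rightarrow> a * n + j + 1) *
          proj_L1 n r x (case p of (j, a) \<Rightarrow> a * n + j + 1) =
          (case p of (j, a) \<Rightarrow> if a \<le> c then fps_nth (g $$ (i, j)) (c - a) * fps_nth (vec_index x j) a else 0)"
        using ir p by (simp add: mat_coeff_def proj_L1_def c_def i_def)
    qed
    finally show ?thesis using True by (simp add: mat_act_def)
  next
    case False
    thus ?thesis unfolding proj_L1_def mat_act_def by (simp only: if_False)
  qed
qed

lemma act_eq:
  assumes n: "n \<ge> 1" and g: "g \<in> carrier_mat n n" and W: "W \<subseteq> V_space n r"
  shows "act n r g W = mat_act n r g ` W"
proof
  show "act n r g W \<subseteq> mat_act n r g ` W"
    using proj_mult_mat_vec[OF n g] by (auto simp: act_def)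
  show "mat_act n r g ` W \<subseteq> act n r g W"
  proof safe
    fix w assume w: "w \<in> W"
    define x where "x = vec n (\<lambda>j. Abs_fps (\<lambda>c. w (c * n + j + 1)))"
    have x: "x \<in> carrier_vec n" by (simp add: x_def)
    have "proj_L1 n r x k = w k" for k
    proof (cases "k \<in> {1..r * n}")
      case True
      thus ?thesis using index_bounds[OF n True] by (simp add: proj_L1_def x_def)
    next
      case False
      have "w \<in> V_space n r" using w W by blast
      hence "w k = 0" using False unfolding V_space_def by blast
      thus ?thesis using False unfolding proj_L1_def by (simp only: if_False)
    qed
    hence px: "proj_L1 n r x = w" by (rule ext)
    show "mat_act n r g w \<in> act n r g W"
      using proj_mult_mat_vec[OF n g x, of r] x w unfolding act_def px by (intro CollectI exI[of _ x]) (simp add: px)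
  qed
qed

text \<open>Modulo \<open>t\<close> the matrix is lower triangular and invertible, so the product of
  its diagonal entries is nonzero.\<close>

lemma B_group_diag:
  assumes n: "n \<ge> 1" and g: "g \<in> B_group n" and i: "i < n"
  shows "fps_nth (g $$ (i, i)) 0 \<noteq> 0"
proof -
  have gc: "g \<in> carrier_mat n n" and up: "\<And>i j. i < j \<Longrightarrow> j < n \<Longrightarrow> fps_nth (g $$ (i, j)) 0 = 0"
    using g by (auto simp: B_group_def)
  obtain h where h: "g * h = 1\<^sub>m (dim_row g)" "h * g = 1\<^sub>m (dim_row h)"
    using g by (auto simp: B_group_def invertible_mat_def inverts_mat_def)
  have hc: "h \<in> carrier_mat n n"
    using arg_cong[OF h(1), of dim_col] arg_cong[OF h(2), of dim_col] gc by auto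
  define A where "A = mat n n (\<lambda>(i, j). fps_nth (g $$ (i, j)) 0)"
  define H where "H = mat n n (\<lambda>(i, j). fps_nth (h $$ (i, j)) 0)"
  have A: "A \<in> carrier_mat n n" and H: "H \<in> carrier_mat n n" by (simp_all add: A_def H_def)
  have "A * H = 1\<^sub>m n"
  proof (rule eq_matI)
    fix a b assume ab: "a < dim_row (1\<^sub>m n)" "b < dim_col (1\<^sub>m n)"
    have "(A * H) $$ (a, b) = fps_nth ((g * h) $$ (a, b)) 0"
      using ab gc hc by (simp add: A_def H_def scalar_prod_def fps_sum_nth fps_mult_nth_0)
    also have "\<dots> = 1\<^sub>m n $$ (a, b)" using ab gc by (simp add: h(1))
    finally show "(A * H) $$ (a, b) = 1\<^sub>m n $$ (a, b)" .
  qed (simp_all add: A_def H_def)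
  hence "det A * det H = 1" using det_mult[OF A H] by simp
  hence "det A \<noteq> 0" by auto
  moreover have "det A = prod_list (diag_mat A)"
    by (rule det_lower_triangular[OF _ A]) (use up in \<open>auto simp: A_def\<close>)
  hence "det A = (\<Prod>i = 0..<n. A $$ (i, i))" by (simp add: prod_list_diag_prod A_def)
  ultimately have "A $$ (i, i) \<noteq> 0" using i by auto
  thus ?thesis using i by (simp add: A_def)
qed

text \<open>The group acts by lower triangular matrices in the basis of all \<open>e_k\<close>:
  inside one block of \<open>n\<close> this is the defining condition modulo \<open>t\<close>, and
  powers of \<open>t\<close> never go down between blocks.\<close>

lemma mat_coeff_upper:
  assumes n: "n \<ge> 1" and g: "g \<in> B_group n" and km: "1 \<le> k" "k < m"
  shows "mat_coeff n g k m = 0"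
proof (cases "(m - 1) div n \<le> (k - 1) div n")
  case True
  moreover have "(k - 1) div n \<le> (m - 1) div n" using km by (intro div_le_mono) auto
  ultimately have eq: "(m - 1) div n = (k - 1) div n" by simp
  have "(k - 1) div n * n + (m - 1) mod n = m - 1"
    using div_mult_mod_eq[of "m - 1" n] unfolding eq .
  hence "(k - 1) mod n < (m - 1) mod n"
    using div_mult_mod_eq[of "k - 1" n] km by linarith
  moreover have "(m - 1) mod n < n" using n by simp
  ultimately have "fps_nth (g $$ ((k - 1) mod n, (m - 1) mod n)) 0 = 0"
    using g by (simp add: B_group_def)
  thus ?thesis using eq by (simp add: mat_coeff_def)
qed (simp add: mat_coeff_def)

lemma mat_coeff_diag: "n \<ge> 1 \<Longrightarrow> g \<in> B_group n \<Longrightarrow> mat_coeff n g k k \<noteq> 0"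
  using B_group_diag[of n g "(k - 1) mod n"] by (simp add: mat_coeff_def)

lemma mat_coeff_shift:
  assumes n: "n \<ge> 1" and "1 \<le> k" "1 \<le> m"
  shows "mat_coeff n g (k + c * n) (m + c * n) = mat_coeff n g k m"
proof -
  have "k + c * n - 1 = k - 1 + c * n" "m + c * n - 1 = m - 1 + c * n" using assms by simp_all
  thus ?thesis using n by (simp add: mat_coeff_def)
qed

lemma mat_act_e_vec:
  assumes "m \<in> {1..r * n}"
  shows "mat_act n r g (e_vec m) k = (if k \<in> {1..r * n} then mat_coeff n g k m else 0)"
proof -
  have "(\<Sum>l\<in>{1..r * n}. mat_coeff n g k l * e_vec m l) =
      (\<Sum>l\<in>{1..r * n}. if l = m then mat_coeff n g k m else 0)"
    by (rule sum.cong) (auto simp: e_vec_def)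
  also have "\<dots> = mat_coeff n g k m" using assms by simp
  finally show ?thesis by (simp add: mat_act_def)
qed

text \<open>Sends one standard basis vector to \<open>u\<close> and fixes the others; the inverse
  has the same form. Such matrices suffice to carry the cyclic generator to any prescribed
  one.\<close>

definition column_mat :: "nat \<Rightarrow> nat \<Rightarrow> (nat \<Rightarrow> 'k :: field fps) \<Rightarrow> 'k fps mat" where
  "column_mat n m u = mat n n (\<lambda>(i, j). if j = m then u i else if i = j then 1 else 0)"

lemma column_mat_mult:
  assumes m: "m < n" and u: "u m * u' m = 1" "\<And>i. i \<noteq> m \<Longrightarrow> u i * u' m + u' i = 0"
  shows "column_mat n m u * column_mat n m u' = 1\<^sub>m n"
proof (rule eq_matI)
  fix i j assume ij: "i < dim_row (1\<^sub>m n)" "j < dim_col (1\<^sub>m n)"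
  have "(column_mat n m u * column_mat n m u') $$ (i, j) =
      (\<Sum>k\<in>{0..<n}. (if k = m then u i else if i = k then 1 else 0) *
        (if j = m then u' k else if k = j then 1 else 0))"
    using ij by (simp add: column_mat_def scalar_prod_def)
  also have "\<dots> = (if i = j then 1 else 0)"
  proof (cases "j = m")
    case False
    have "(\<Sum>k\<in>{0..<n}. (if k = m then u i else if i = k then 1 else 0) *
        (if j = m then u' k else if k = j then 1 else 0)) =
        (\<Sum>k\<in>{0..<n}. if k = j then (if i = j then 1 else 0) else 0)"
      using False by (intro sum.cong) auto
    thus ?thesis using ij by simp
  next
    case True
    have "(\<Sum>k\<in>{0..<n}. (if k = m then u i else if i = k then 1 else 0) * u' k) =
        (\<Sum>k\<in>{0..<n}. (if k = m then u i * u' m else 0) + (if k = i then (if i = m then 0 else u' i) else 0))"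
      by (intro sum.cong) auto
    also have "\<dots> = u i * u' m + (if i = m then 0 else u' i)" using m ij by (simp add: sum.distrib)
    finally show ?thesis using True u by auto
  qed
  finally show "(column_mat n m u * column_mat n m u') $$ (i, j) = 1\<^sub>m n $$ (i, j)" using ij by simp
qed (simp_all add: column_mat_def)

lemma column_mat_B_group:
  assumes m: "m < n" and u: "fps_nth (u m) 0 \<noteq> 0" "\<And>i. i < m \<Longrightarrow> fps_nth (u i) 0 = 0"
  shows "column_mat n m u \<in> B_group n"
proof -
  define u' where "u' = (\<lambda>i. if i = m then inverse (u m) else - (u i * inverse (u m)))"
  have um: "u m * inverse (u m) = 1" using inverse_mult_eq_1[OF u(1)] by (simp add: mult.commute)
  have "column_mat n m u * column_mat n m u' = 1\<^sub>m n"
    by (rule column_mat_mult[OF m]) (simp_all add: u'_def um)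
  moreover have "column_mat n m u' * column_mat n m u = 1\<^sub>m n"
  proof (rule column_mat_mult[OF m])
    show "u' m * u m = 1" using um by (simp add: u'_def mult.commute)
    fix i assume "i \<noteq> m"
    hence "u' i * u m + u i = - (u i * (u m * inverse (u m))) + u i"
      by (simp add: u'_def algebra_simps)
    thus "u' i * u m + u i = 0" by (simp add: um)
  qed
  moreover have "fps_nth (column_mat n m u $$ (i, j)) 0 = 0" if "i < n" "j < n" "i < j" for i j
    using that u(2) by (simp add: column_mat_def)
  ultimately show ?thesis
    unfolding B_group_def invertible_mat_def inverts_mat_def
    by (auto simp: column_mat_def intro!: exI[of _ "column_mat n m u'"])
qed

context cyclic_family
begin

definition idx :: "nat list" where
  "idx = map (\<lambda>c. \<beta> + 1 + c * n) [0..<R] @ [\<beta> + M + 1..<r * n + 1]"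

lemma length_idx: "length idx = r"
  using M_rn R by (simp add: idx_def del: upt_Suc)

lemma nth_idx: "c < r \<Longrightarrow> idx ! c = (if c < R then \<beta> + 1 + c * n else \<beta> + M + 1 + (c - R))"
  using M_rn R by (auto simp: idx_def nth_append simp del: upt_Suc)

lemma nth_idx_le: "c < R \<Longrightarrow> \<beta> + 1 + c * n \<le> \<beta> + M"
  using cn_le[of c] q unfolding M_def by linarith

lemma nth_idx_range: "c < r \<Longrightarrow> idx ! c \<in> {1..r * n}"
  using nth_idx_le[of c] M_rn by (auto simp: nth_idx)

text \<open>As \<open>g\<close> commutes with \<open>t\<close>, translates of
  \<open>e_(\<beta>+1)\<close> go to translates of its image, whose coordinates are
  \<open>v\<close>; by triangularity the tail is preserved and may be subtracted. One inclusion and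
  a dimension count suffice.\<close>

lemma act_E_space:
  fixes g :: "'k :: field fps mat"
  assumes g: "g \<in> B_group n"
  defines "v \<equiv> \<lambda>t. mat_coeff n g (\<beta> + 1 + t) (\<beta> + 1)"
  shows "act n r g (E_space idx) = fun_space.span (set (gens (\<lambda>c. U c v)))" "v 0 \<noteq> 0"
proof -
  show v0: "v 0 \<noteq> 0" using mat_coeff_diag[OF n g] by (simp add: v_def)
  let ?W = "fun_space.span (set (gens (\<lambda>c. U c v)))"
  let ?G = "mat_act n r g"
  interpret T: Vector_Spaces.linear "\<lambda>c f x. c * f x" "\<lambda>c f x. c * f x" ?G by (rule linear_mat_act)
  have gc: "g \<in> carrier_mat n n" using g by (simp add: B_group_def)
  have "E_space idx \<subseteq> (V_space n r :: (nat \<Rightarrow> 'k) set)"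
    unfolding E_space_def
  proof (rule fun_space.span_minimal[OF _ subspace_V_space])
    show "e_vec ` set idx \<subseteq> V_space n r"
      using nth_idx_range length_idx by (auto simp: V_space_def e_vec_def in_set_conv_nth)
  qed
  hence "act n r g (E_space idx) = ?G ` E_space idx" by (rule act_eq[OF n gc])
  also have "\<dots> = fun_space.span (?G ` (e_vec ` set idx))"
    unfolding E_space_def by (rule T.span_image[symmetric])
  also have "?G ` (e_vec ` set idx) = set (map (\<lambda>m. ?G (e_vec m)) idx)" by auto
  finally have act: "act n r g (E_space idx) = fun_space.span (set (map (\<lambda>m. ?G (e_vec m)) idx))" .
  let ?bs = "map (\<lambda>m. ?G (e_vec m)) idx"
  have bs: "distinct ?bs \<and> fun_space.independent (set ?bs)"
  proof (rule independent_pivots[where piv = "\<lambda>c. idx ! c"])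
    show "inj_on ((!) idx) {..<length ?bs}"
    proof (rule inj_onI)
      fix a b assume ab: "a \<in> {..<length ?bs}" "b \<in> {..<length ?bs}" "idx ! a = idx ! b"
      thus "a = b"
        using nth_idx_le[of a] nth_idx_le[of b] n length_idx by (auto simp: nth_idx split: if_splits)
    qed
    fix c assume "c < length ?bs"
    hence c: "c < r" by (simp add: length_idx)
    show "(?bs ! c) (idx ! c) \<noteq> 0"
      using c nth_idx_range[OF c] mat_coeff_diag[OF n g] by (simp add: length_idx mat_act_e_vec)
    fix k assume "k < idx ! c"
    thus "(?bs ! c) k = 0"
      using c nth_idx_range[OF c] mat_coeff_upper[OF n g, of k "idx ! c"]
      by (simp add: length_idx mat_act_e_vec)
  qed
  have tail: "(\<Sum>k\<in>{\<beta> + M + 1..r * n}. (\<lambda>x. a k * e_vec k x)) \<in> ?W" for a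
  proof (intro fun_space.span_sum fun_space.span_scale fun_space.span_base)
    fix k assume "k \<in> {\<beta> + M + 1..r * n}"
    thus "e_vec k \<in> set (gens (\<lambda>c. U c v))" by (auto simp: gens_def simp del: upt_Suc)
  qed
  have "set ?bs \<subseteq> ?W"
  proof
    fix x assume "x \<in> set ?bs"
    then obtain c where c: "c < r" "x = ?G (e_vec (idx ! c))"
      by (auto simp: in_set_conv_nth length_idx)
    define y where "y = (\<lambda>k. if k \<le> \<beta> + M then x k else 0)"
    have x: "x k = (if k \<in> {1..r * n} then mat_coeff n g k (idx ! c) else 0)" for k
      unfolding c(2) by (rule mat_act_e_vec[OF nth_idx_range[OF c(1)]])
    have eq: "x = y + (\<Sum>k\<in>{\<beta> + M + 1..r * n}. (\<lambda>z. x k * e_vec k z))"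
    proof
      fix z
      have "(\<Sum>k\<in>{\<beta> + M + 1..r * n}. x k * e_vec k z) =
          (\<Sum>k\<in>{\<beta> + M + 1..r * n}. if k = z then x z else 0)"
        by (rule sum.cong) (auto simp: e_vec_def)
      thus "x z = (y + (\<Sum>k\<in>{\<beta> + M + 1..r * n}. (\<lambda>z. x k * e_vec k z))) z"
        using x[of z] by (auto simp: sum_apply_fun y_def)
    qed
    have "y \<in> ?W"
    proof (cases "c < R")
      case True
      have "y = U c v"
      proof
        fix k
        show "y k = U c v k"
        proof (cases "\<beta> + c * n < k \<and> k \<le> \<beta> + M")
          case k: True
          define t where "t = k - \<beta> - c * n - 1"
          have "k = \<beta> + 1 + t + c * n" using k by (simp add: t_def)
          hence "mat_coeff n g k (\<beta> + 1 + c * n) = v t"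
            using mat_coeff_shift[OF n, of "\<beta> + 1 + t" "\<beta> + 1" g c] by (simp add: v_def)
          thus ?thesis using k x[of k] True c(1) M_rn by (simp add: y_def U_def nth_idx t_def)
        next
          case k: False
          have "y k = 0"
          proof (cases "k \<in> {1..r * n} \<and> k \<le> \<beta> + M")
            case True
            hence "k < idx ! c" using k \<open>c < R\<close> c(1) by (simp add: nth_idx)
            thus ?thesis using mat_coeff_upper[OF n g, of k "idx ! c"] True x[of k] by (simp add: y_def)
          qed (use x[of k] in \<open>auto simp: y_def\<close>)
          thus ?thesis unfolding U_def using k by (simp only: if_False)
        qed
      qed
      moreover have "U c v \<in> set (gens (\<lambda>c. U c v))" using True by (simp add: gens_def)
      ultimately show ?thesis by (simp add: fun_space.span_base)
    next
      case False
      have "y = 0"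
      proof
        fix k
        have "mat_coeff n g k (idx ! c) = 0" if "1 \<le> k" "k \<le> \<beta> + M"
          using that False c(1) by (intro mat_coeff_upper[OF n g]) (simp_all add: nth_idx)
        thus "y k = 0 k" using x[of k] by (auto simp: y_def)
      qed
      thus ?thesis by (simp add: fun_space.span_zero)
    qed
    from fun_space.span_add[OF this tail[of x]] show "x \<in> ?W" unfolding eq[symmetric] .
  qed
  moreover have "dim_at_most ?W r"
    unfolding dim_at_most_def
    using card_length[of "gens (\<lambda>c. U c v)"] by (intro exI[of _ "set (gens (\<lambda>c. U c v))"]) auto
  moreover have "r \<le> card (set ?bs)" using bs distinct_card[of ?bs] by (simp add: length_idx)
  ultimately have "fun_space.span (set ?bs) = ?W"
    using bs by (intro span_eq_of_card[of ?W "set ?bs" r]) (auto simp: fun_space.subspace_span)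
  thus "act n r g (E_space idx) = ?W" using act by simp
qed

lemma schubert_cell_idx: "schubert_cell n r idx = (cell :: (nat \<Rightarrow> 'k :: field) set set)"
proof
  show "schubert_cell n r idx \<subseteq> (cell :: (nat \<Rightarrow> 'k) set set)"
    using act_E_space unfolding schubert_cell_def cell_def by blast
  show "(cell :: (nat \<Rightarrow> 'k) set set) \<subseteq> schubert_cell n r idx"
  proof
    fix W :: "(nat \<Rightarrow> 'k) set" assume "W \<in> cell"
    then obtain v where v: "v 0 \<noteq> 0" "W = fun_space.span (set (gens (\<lambda>c. U c v)))"
      by (auto simp: cell_def)
    \<comment> \<open>\<open>m\<close> is the position of \<open>e_(\<beta>+1)\<close> in its block,
      and column \<open>m\<close> of \<open>g\<close> lists \<open>v\<close> from there on. The
      leading coefficient \<open>v 0\<close> makes \<open>g\<close> invertible, and the zeros before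
      it put \<open>g\<close> into the group.\<close>
    define m where "m = \<beta> mod n"
    define u where "u = (\<lambda>i. Abs_fps (\<lambda>a. if m \<le> a * n + i then v (a * n + i - m) else 0))"
    define g where "g = column_mat n m u"
    have m: "m < n" using n by (simp add: m_def)
    have g: "g \<in> B_group n"
      unfolding g_def by (rule column_mat_B_group[OF m]) (use v(1) in \<open>auto simp: u_def\<close>)
    have "mat_coeff n g (\<beta> + 1 + t) (\<beta> + 1) = v t" for t
    proof -
      have \<beta>: "\<beta> = m + \<beta> div n * n" by (simp add: m_def)
      have "mat_coeff n g (\<beta> + 1 + t) (\<beta> + 1) = mat_coeff n g (m + 1 + t + \<beta> div n * n) (m + 1 + \<beta> div n * n)"
        using \<beta> by (metis add.assoc add.commute)
      also have "\<dots> = mat_coeff n g (m + 1 + t) (m + 1)" by (rule mat_coeff_shift[OF n]) auto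
      also have "\<dots> = fps_nth (u ((m + t) mod n)) ((m + t) div n)"
        using m n by (simp add: mat_coeff_def g_def column_mat_def)
      also have "\<dots> = v t" by (simp add: u_def)
      finally show ?thesis .
    qed
    hence "act n r g (E_space idx) = W" using act_E_space(1)[OF g] v(2) by simp
    thus "W \<in> schubert_cell n r idx" using g unfolding schubert_cell_def by blast
  qed
qed

end

section \<open>Matching the parameters with the chain\<close>

lemma cyclic_family_phi:
  assumes "n \<ge> 1" "i \<in> {1..r}" "j \<in> {1..n}" "j < n \<or> i = r"
  shows "cyclic_family n r (r + 1 - i) (n + 1 - j) ((i - 1) * n + j - i)"
proof
  define a where "a = i - 1"
  define d where "d = r - i"
  have ar: "i = a + 1" "r = a + 1 + d" using assms(2) by (simp_all add: a_def d_def)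
  have "a \<le> a * n" using assms(1) by simp
  moreover have "(i - 1) * n = a * n" "(r + 1 - i - 1) * n = d * n" "r * n = a * n + n + d * n"
    "r - (r + 1 - i) = a" by (simp_all add: ar algebra_simps)
  moreover have "1 \<le> j" "j \<le> n" using assms(3) by simp_all
  ultimately show "(i - 1) * n + j - i + ((r + 1 - i - 1) * n + (n + 1 - j)) + (r - (r + 1 - i)) = r * n"
    using ar(1) by linarith
qed (use assms in auto)

lemma phi_eq_idx:
  assumes "n \<ge> 1" "i \<in> {1..r}" "j \<in> {1..n}" "j < n \<or> i = r"
  shows "phi n r i j = cyclic_family.idx n r (r + 1 - i) (n + 1 - j) ((i - 1) * n + j - i)"
proof -
  interpret cyclic_family n r "r + 1 - i" "n + 1 - j" "(i - 1) * n + j - i"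
    by (rule cyclic_family_phi[OF assms])
  define a where "a = i - 1"
  have ia: "i = a + 1" using assms(2) by (simp add: a_def)
  have a: "a \<le> a * n" using assms(1) by simp
  have "(i - 1) * n + j - i + M + 1 = r * n + 2 - i"
  proof -
    have "r - (r + 1 - i) = i - 1" "1 \<le> i" using assms(2) by auto
    thus ?thesis using M_rn by linarith
  qed
  moreover have "(i - 1 + k) * n + 1 + j - i = (i - 1) * n + j - i + 1 + k * n" for k
  proof -
    have "(i - 1 + k) * n = a * n + k * n" "(i - 1) * n = a * n" by (simp_all add: ia algebra_simps)
    moreover have "1 \<le> j" using assms(3) by simp
    ultimately show ?thesis using a ia by linarith
  qed
  ultimately show ?thesis by (simp only: phi_def idx_def)
qed

text \<open>Of two descriptions of a common member the one with \<open>j < n\<close> is taken, so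
  that \<open>q \<ge> 2\<close>; \<open>j = n\<close> remains only at the end of the chain, where
  \<open>R = 1\<close>. Elsewhere \<open>i\<close> and \<open>j\<close> come from dividing
  \<open>l - 1\<close> by \<open>n - 1\<close>.\<close>

lemma chain_index:
  fixes n r l :: nat
  assumes "n \<ge> 1" "r \<ge> 1" "1 \<le> l" "l \<le> r * (n - 1) + 1"
  obtains i j where "i \<in> {1..r}" "j \<in> {1..n}" "j < n \<or> i = r" "l = (i - 1) * (n - 1) + j"
proof (cases "l = r * (n - 1) + 1")
  case True
  have "r * (n - 1) = (r - 1) * (n - 1) + (n - 1)" using assms(2) by (cases r) auto
  hence "l = (r - 1) * (n - 1) + n" using True assms(1) by simp
  thus ?thesis using that[of r n] assms by simp
next
  case False
  define p where "p = n - 1"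
  have lt: "l - 1 < r * p" using False assms by (simp add: p_def)
  \<comment> \<open>For \<open>n = 1\<close> the chain has a single member, which was treated as its
    end; so the divisor is positive here.\<close>
  hence p: "p \<ge> 1" by (cases p) auto
  define i where "i = (l - 1) div p + 1"
  define j where "j = (l - 1) mod p + 1"
  have "(l - 1) div p < r" using lt by (simp add: less_mult_imp_div_less)
  hence i: "i \<in> {1..r}" by (simp add: i_def)
  have "(l - 1) mod p < p" using p by simp
  hence j: "j \<in> {1..n}" "j < n" by (simp_all add: j_def p_def)
  have "(i - 1) * p + j = Suc (l - 1)" by (simp add: i_def j_def)
  hence "l = (i - 1) * (n - 1) + j" using assms(3) unfolding p_def by linarith
  with i j show ?thesis using that[of i j] by blast
qed

theorem theorem4p6p3:
  fixes n s r l :: nat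
    and X :: "(nat \<Rightarrow> 'k :: alg_closed_field) set set"
  assumes "n \<ge> 1" and "s \<ge> 1" and "r = s * n"
    and "1 \<le> l" and "l \<le> r * (n - 1) + 1"
    and "X = schubert_variety n r (tau n r l)"
  shows "inj_on (pluecker_section n r X) (admissible_on n r X)
       \<and> fun_space.independent (pluecker_section n r X ` admissible_on n r X)
       \<and> fun_space.span (pluecker_section n r X ` admissible_on n r X) = global_sections n r X"
proof -
  have "r \<ge> 1" using assms(1-3) by simp
  then obtain i j where ij: "i \<in> {1..r}" "j \<in> {1..n}" "j < n \<or> i = r" "l = (i - 1) * (n - 1) + j"
    using chain_index assms(1,4,5) by metis
  interpret F: cyclic_family n r "r + 1 - i" "n + 1 - j" "(i - 1) * n + j - i"
    by (rule cyclic_family_phi[OF assms(1) ij(1-3)])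
  have tau: "tau n r l = F.idx"
    unfolding ij(4) tau_eq[OF ij(1,2)] by (rule phi_eq_idx[OF assms(1) ij(1-3)])
  have X: "X = F.X"
    unfolding assms(6) schubert_variety_def tau F.schubert_cell_idx by (rule refl)
  show ?thesis
    unfolding X by (intro conjI F.admissible_basis)
qed
end
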